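(* Let $G$ be a countable nonabelian torsion-free CSA group, and let $H$ be the countable group, unique up to $G$-isomorphism, such that (1) $H$ is the union of an $ICE$-chain of groups in $ICE(G)$; (2) the $ICE$-age of $H$ is exactly $ICE(G)$; (3) any $G$-isomorphism between two groups $A,B\le_{ICE}H$ extends to an automorphism of $H$. Then $H$ is isomorphic to Lyndon's completion $G^{\mathbb{Z}[t]}$ of $G$. In particular, when $G$ is a (countable) nonabelian free group $\mathbb{F}$, $H$ is isomorphic to $\mathbb{F}^{\mathbb{Z}[t]}$.
   Context: A group is CSA if every maximal abelian subgroup $M$ is malnormal, i.e. $M\cap M^g=1$ for all $g\notin M$. For a group $K$ and a nontrivial element $u\in K$, the extension of the centralizer of $u$ is $K(u,t)=\langle K,t\mid [c,t]=1,\ c\in C_K(u)\rangle$. A finite iterated extension of centralizers of $K$ is a group obtained from $K$ by finitely many (possibly zero) successive extensions of centralizers. One works with $G$-groups, i.e. groups containing a fixed copy of $G$; $G$-isomorphisms, and all embeddings considered between $G$-groups, are the identity on $G$. $ICE(G)$ is the class of $G$-groups that are finite iterated extensions of centralizers of $G$ (so $G\in ICE(G)$). An embedding $\phi:A\to B$ is an $ICE$-embedding if $B$ can be obtained from $\phi(A)$ as a finite iterated extension of centralizers; when $A\le B$ and the inclusion is an $ICE$-embedding one writes $A\le_{ICE}B$. An $ICE$-chain is a sequence $G_0\le_{ICE}G_1\le_{ICE}\cdots$. If $H$ is the union of an $ICE$-chain $(G_i)$ of groups in $ICE(G)$, then $A\le_{ICE}H$ means $A\le_{ICE}G_i$ for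 some $i$, where $A$ is a subgroup containing $G$ with $A\in ICE(G)$ (independent of the chain). The $ICE$-age of $H$ is the class of all $A\le_{ICE}H$, up to $G$-isomorphism. Lyndon's $\mathbb{Z}[t]$-exponential completion $G^{\mathbb{Z}[t]}$ of $G$ is described in the paper (following Myasnikov and Remeslennikov) as follows: put $\tilde G_0=G$; given $\tilde G_i$, the group $\tilde G_{i+1}$ is obtained from $\tilde G_i$ by extending all non-conjugate centralizers, i.e. one chooses one representative from each conjugacy class of centralizers of nontrivial elements of $\tilde G_i$ and extends each of these centralizers $C$ by a new letter $t_C$ with relations $[C,t_C]=1$; then $G^{\mathbb{Z}[t]}=\bigcup_i\tilde G_i$. *)

theory Defs
  imports "HOL-Algebra.Generated_Groups" "HOL-Library.Countable_Set"
begin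

section \<open>CSA groups\<close>

abbreviation subgrp :: "'a monoid \<Rightarrow> 'a set \<Rightarrow> 'a monoid" where
  "subgrp G M \<equiv> G\<lparr>carrier := M\<rparr>"

definition torsion_free :: "'a monoid \<Rightarrow> bool" where
  "torsion_free G \<longleftrightarrow>
     (\<forall>x\<in>carrier G. \<forall>n::nat. n > 0 \<and> x [^]\<^bsub>G\<^esub> n = \<one>\<^bsub>G\<^esub> \<longrightarrow> x = \<one>\<^bsub>G\<^esub>)"

definition conj_set :: "'a monoid \<Rightarrow> 'a set \<Rightarrow> 'a \<Rightarrow> 'a set" where
  "conj_set G M g = (\<lambda>x. inv\<^bsub>G\<^esub> g \<otimes>\<^bsub>G\<^esub> x \<otimes>\<^bsub>G\<^esub> g) ` M"

definition malnormal :: "'a monoid \<Rightarrow> 'a set \<Rightarrow> bool" where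
  "malnormal G M \<longleftrightarrow> (\<forall>g\<in>carrier G - M. M \<inter> conj_set G M g = {\<one>\<^bsub>G\<^esub>})"

definition abelian_subgroup :: "'a monoid \<Rightarrow> 'a set \<Rightarrow> bool" where
  "abelian_subgroup G M \<longleftrightarrow> subgroup M G \<and> comm_group (subgrp G M)"

definition maximal_abelian_subgroup :: "'a monoid \<Rightarrow> 'a set \<Rightarrow> bool" where
  "maximal_abelian_subgroup G M \<longleftrightarrow>
     abelian_subgroup G M \<and> (\<forall>N. abelian_subgroup G N \<and> M \<subseteq> N \<longrightarrow> N = M)"

definition CSA :: "'a monoid \<Rightarrow> bool" where
  "CSA G \<longleftrightarrow> (\<forall>M. maximal_abelian_subgroup G M \<longrightarrow> malnormal G M)"


section \<open>Relative presentations\<close>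

text \<open>
  The group \<open>\<langle>K, T | R\<rangle>\<close> generated by a group \<open>K\<close> and a set \<open>T\<close> of new letters, subject to the
  relations \<open>r = 1\<close> for \<open>r\<close> in \<open>R\<close>: words over the elements of \<open>K\<close>, the letters in \<open>T\<close> and
  their formal inverses, modulo the least congruence containing the multiplication table of \<open>K\<close>,
  free cancellation of the letters, and the relators.
\<close>

datatype ('k, 't) letter = Base 'k | Stable 't | Stable_inv 't

definition rel_words :: "'k monoid \<Rightarrow> 't set \<Rightarrow> ('k, 't) letter list set" where
  "rel_words K T = lists (Base ` carrier K \<union> Stable ` T \<union> Stable_inv ` T)"

inductive_set rel_congruence ::
    "'k monoid \<Rightarrow> 't set \<Rightarrow> ('k, 't) letter list set \<Rightarrow> (('k, 't) letter list \<times> ('k, 't) letter list) set"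
  for K :: "'k monoid" and T :: "'t set" and R :: "('k, 't) letter list set" where
  refl: "w \<in> rel_words K T \<Longrightarrow> (w, w) \<in> rel_congruence K T R"
| sym: "(v, w) \<in> rel_congruence K T R \<Longrightarrow> (w, v) \<in> rel_congruence K T R"
| trans: "(u, v) \<in> rel_congruence K T R \<Longrightarrow> (v, w) \<in> rel_congruence K T R
    \<Longrightarrow> (u, w) \<in> rel_congruence K T R"
| congr: "(v, w) \<in> rel_congruence K T R \<Longrightarrow> x \<in> rel_words K T \<Longrightarrow> y \<in> rel_words K T
    \<Longrightarrow> (x @ v @ y, x @ w @ y) \<in> rel_congruence K T R"
| base_mult: "a \<in> carrier K \<Longrightarrow> b \<in> carrier K
    \<Longrightarrow> ([Base a, Base b], [Base (a \<otimes>\<^bsub>K\<^esub> b)]) \<in> rel_congruence K T R"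
| base_one: "([Base \<one>\<^bsub>K\<^esub>], []) \<in> rel_congruence K T R"
| cancel_right: "t \<in> T \<Longrightarrow> ([Stable t, Stable_inv t], []) \<in> rel_congruence K T R"
| cancel_left: "t \<in> T \<Longrightarrow> ([Stable_inv t, Stable t], []) \<in> rel_congruence K T R"
| relator: "r \<in> R \<Longrightarrow> r \<in> rel_words K T \<Longrightarrow> (r, []) \<in> rel_congruence K T R"

definition rel_class ::
    "'k monoid \<Rightarrow> 't set \<Rightarrow> ('k, 't) letter list set \<Rightarrow> ('k, 't) letter list \<Rightarrow> ('k, 't) letter list set"
  where "rel_class K T R w = rel_congruence K T R `` {w}"

definition rel_presentation ::
    "'k monoid \<Rightarrow> 't set \<Rightarrow> ('k, 't) letter list set \<Rightarrow> ('k, 't) letter list set monoid" where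
  "rel_presentation K T R =
     \<lparr>carrier = rel_words K T // rel_congruence K T R,
      monoid.mult = (\<lambda>X Y. \<Union>v\<in>X. \<Union>w\<in>Y. rel_class K T R (v @ w)),
      one = rel_class K T R []\<rparr>"

text \<open>A free group on a set of letters is a presentation over the trivial group without relators.\<close>

definition free_group_on :: "'a monoid \<Rightarrow> 'a set \<Rightarrow> bool" where
  "free_group_on F X \<longleftrightarrow> group F \<and> X \<subseteq> carrier F \<and>
     (\<exists>\<psi>\<in>iso (rel_presentation (subgrp F {\<one>\<^bsub>F\<^esub>}) X {}) F.
        \<forall>x\<in>X. \<psi> (rel_class (subgrp F {\<one>\<^bsub>F\<^esub>}) X {} [Stable x]) = x)"

definition free_group :: "'a monoid \<Rightarrow> bool" where
  "free_group F \<longleftrightarrow> (\<exists>X. free_group_on F X)"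


section \<open>Extensions of centralizers\<close>

definition centralizer :: "'k monoid \<Rightarrow> 'k \<Rightarrow> 'k set" where
  "centralizer K u = {c \<in> carrier K. c \<otimes>\<^bsub>K\<^esub> u = u \<otimes>\<^bsub>K\<^esub> c}"

text \<open>
  Several centralizers may be extended at once. The letter \<open>t\<^sub>C\<close> added for the centralizer \<open>C\<close> is
  \<open>Stable C\<close>, and the relators are the commutators \<open>c\<inverse> t\<^sub>C\<inverse> c t\<^sub>C\<close> with \<open>c\<close> in \<open>C\<close>.
\<close>

definition commutation_relators :: "'k monoid \<Rightarrow> 'k set set \<Rightarrow> ('k, 'k set) letter list set" where
  "commutation_relators K \<C> =
     {[Base (inv\<^bsub>K\<^esub> c), Stable_inv C, Base c, Stable C] | c C. C \<in> \<C> \<and> c \<in> C}"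

definition extend_centralizers :: "'k monoid \<Rightarrow> 'k set set \<Rightarrow> ('k, 'k set) letter list set monoid" where
  "extend_centralizers K \<C> = rel_presentation K \<C> (commutation_relators K \<C>)"

text \<open>
  The overgroup \<open>L\<close> of \<open>K\<close> is, over \<open>K\<close>, the group obtained from \<open>K\<close> by extending all centralizers
  in \<open>\<C>\<close>. Since \<open>\<psi>\<close> is injective, this includes that \<open>K\<close> embeds in the extension.
\<close>

definition is_extension_of_centralizers :: "'k monoid \<Rightarrow> 'k set set \<Rightarrow> 'k monoid \<Rightarrow> bool" where
  "is_extension_of_centralizers K \<C> L \<longleftrightarrow>
     (\<exists>\<psi>\<in>iso (extend_centralizers K \<C>) L.
        \<forall>k\<in>carrier K. \<psi> (rel_class K \<C> (commutation_relators K \<C>) [Base k]) = k)"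

text \<open>Steps and iterated extensions are formulated for subgroups of an ambient group \<open>H\<close>.\<close>

definition ICE_step :: "'h monoid \<Rightarrow> 'h set \<Rightarrow> 'h set \<Rightarrow> bool" where
  "ICE_step H A B \<longleftrightarrow> subgroup A H \<and> subgroup B H \<and> A \<subseteq> B \<and>
     (\<exists>u\<in>A. u \<noteq> \<one>\<^bsub>H\<^esub> \<and>
        is_extension_of_centralizers (subgrp H A) {centralizer (subgrp H A) u} (subgrp H B))"

definition ICE_le :: "'h monoid \<Rightarrow> 'h set \<Rightarrow> 'h set \<Rightarrow> bool" where
  "ICE_le H A B \<longleftrightarrow> subgroup A H \<and> (ICE_step H)\<^sup>*\<^sup>* A B"


section \<open>\<open>G\<close>-groups and the class \<open>ICE(G)\<close>\<close>

text \<open>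
  A \<open>G\<close>-group is a group \<open>A\<close> together with an embedding \<open>\<iota>\<close> of \<open>G\<close>, whose image is the fixed copy
  of \<open>G\<close> in \<open>A\<close>.
\<close>

definition G_group :: "'a monoid \<Rightarrow> ('a \<Rightarrow> 'b) \<Rightarrow> 'b monoid \<Rightarrow> bool" where
  "G_group G \<iota> A \<longleftrightarrow> group A \<and> \<iota> \<in> mon G A"

definition G_iso :: "'a monoid \<Rightarrow> ('a \<Rightarrow> 'b) \<Rightarrow> 'b monoid \<Rightarrow> ('a \<Rightarrow> 'c) \<Rightarrow> 'c monoid \<Rightarrow> ('b \<Rightarrow> 'c) set" where
  "G_iso G \<iota> A \<kappa> B = {\<psi> \<in> iso A B. \<forall>g\<in>carrier G. \<psi> (\<iota> g) = \<kappa> g}"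

definition G_isomorphic :: "'a monoid \<Rightarrow> ('a \<Rightarrow> 'b) \<Rightarrow> 'b monoid \<Rightarrow> ('a \<Rightarrow> 'c) \<Rightarrow> 'c monoid \<Rightarrow> bool" where
  "G_isomorphic G \<iota> A \<kappa> B \<longleftrightarrow> G_iso G \<iota> A \<kappa> B \<noteq> {}"

definition in_ICE :: "'a monoid \<Rightarrow> ('a \<Rightarrow> 'b) \<Rightarrow> 'b monoid \<Rightarrow> bool" where
  "in_ICE G \<iota> A \<longleftrightarrow> G_group G \<iota> A \<and> ICE_le A (\<iota> ` carrier G) (carrier A)"

definition ICE_chain :: "'h monoid \<Rightarrow> (nat \<Rightarrow> 'h set) \<Rightarrow> bool" where
  "ICE_chain H \<Gamma> \<longleftrightarrow> (\<forall>i. ICE_le H (\<Gamma> i) (\<Gamma> (Suc i)))"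

definition union_of_ICE_chain :: "'a monoid \<Rightarrow> ('a \<Rightarrow> 'h) \<Rightarrow> 'h monoid \<Rightarrow> (nat \<Rightarrow> 'h set) \<Rightarrow> bool" where
  "union_of_ICE_chain G \<iota> H \<Gamma> \<longleftrightarrow>
     G_group G \<iota> H \<and> ICE_chain H \<Gamma> \<and> (\<forall>i. in_ICE G \<iota> (subgrp H (\<Gamma> i))) \<and> (\<Union>i. \<Gamma> i) = carrier H"

text \<open>\<open>A \<le>\<^sub>I\<^sub>C\<^sub>E H\<close>, where \<open>H\<close> is the union of the \<open>ICE\<close>-chain \<open>\<Gamma>\<close> of groups in \<open>ICE(G)\<close>.\<close>

definition ICE_le_union ::
    "'a monoid \<Rightarrow> ('a \<Rightarrow> 'h) \<Rightarrow> 'h monoid \<Rightarrow> (nat \<Rightarrow> 'h set) \<Rightarrow> 'h set \<Rightarrow> bool" where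
  "ICE_le_union G \<iota> H \<Gamma> A \<longleftrightarrow>
     subgroup A H \<and> \<iota> ` carrier G \<subseteq> A \<and> in_ICE G \<iota> (subgrp H A) \<and> (\<exists>i. ICE_le H A (\<Gamma> i))"

text \<open>
  The \<open>ICE\<close>-age is closed under \<open>G\<close>-isomorphism. All members of \<open>ICE(G)\<close> are countable when \<open>G\<close> is,
  so \<open>ICE(G)\<close> and the \<open>ICE\<close>-age may be compared on \<open>G\<close>-groups with underlying set in \<open>nat\<close>.
\<close>

definition in_ICE_age ::
    "'a monoid \<Rightarrow> ('a \<Rightarrow> 'h) \<Rightarrow> 'h monoid \<Rightarrow> (nat \<Rightarrow> 'h set) \<Rightarrow> ('a \<Rightarrow> 'b) \<Rightarrow> 'b monoid \<Rightarrow> bool" where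
  "in_ICE_age G \<iota> H \<Gamma> \<kappa> A \<longleftrightarrow>
     G_group G \<kappa> A \<and> (\<exists>B. ICE_le_union G \<iota> H \<Gamma> B \<and> G_isomorphic G \<kappa> A \<iota> (subgrp H B))"

definition ICE_homogeneous_limit :: "'a monoid \<Rightarrow> ('a \<Rightarrow> 'h) \<Rightarrow> 'h monoid \<Rightarrow> bool" where
  "ICE_homogeneous_limit G \<iota> H \<longleftrightarrow> countable (carrier H) \<and>
     (\<exists>\<Gamma>. union_of_ICE_chain G \<iota> H \<Gamma> \<and>
       (\<forall>(\<kappa> :: 'a \<Rightarrow> nat) A. in_ICE_age G \<iota> H \<Gamma> \<kappa> A \<longleftrightarrow> in_ICE G \<kappa> A) \<and>
       (\<forall>A B. ICE_le_union G \<iota> H \<Gamma> A \<and> ICE_le_union G \<iota> H \<Gamma> B \<longrightarrow>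
          (\<forall>\<psi>\<in>G_iso G \<iota> (subgrp H A) \<iota> (subgrp H B). \<exists>\<alpha>\<in>iso H H. \<forall>x\<in>A. \<alpha> x = \<psi> x)))"


section \<open>Lyndon's completion\<close>

definition centralizer_representatives :: "'k monoid \<Rightarrow> 'k set set \<Rightarrow> bool" where
  "centralizer_representatives K \<C> \<longleftrightarrow>
     \<C> \<subseteq> centralizer K ` (carrier K - {\<one>\<^bsub>K\<^esub>}) \<and>
     (\<forall>u\<in>carrier K - {\<one>\<^bsub>K\<^esub>}. \<exists>!C. C \<in> \<C> \<and> (\<exists>g\<in>carrier K. C = conj_set K (centralizer K u) g))"

text \<open>
  The construction of \<open>G\<^bsup>\<int>[t]\<^esup>\<close> depends on the choice of representatives and of copies of the groups
  involved; the predicate holds of every \<open>G\<close>-group obtained by it.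
\<close>

definition Lyndon_completion :: "'a monoid \<Rightarrow> ('a \<Rightarrow> 'l) \<Rightarrow> 'l monoid \<Rightarrow> bool" where
  "Lyndon_completion G \<kappa> L \<longleftrightarrow> G_group G \<kappa> L \<and>
     (\<exists>\<Gamma> :: nat \<Rightarrow> 'l set.
        \<Gamma> 0 = \<kappa> ` carrier G \<and>
        (\<forall>i. subgroup (\<Gamma> i) L \<and> \<Gamma> i \<subseteq> \<Gamma> (Suc i) \<and>
           (\<exists>\<C>. centralizer_representatives (subgrp L (\<Gamma> i)) \<C> \<and>
                is_extension_of_centralizers (subgrp L (\<Gamma> i)) \<C> (subgrp L (\<Gamma> (Suc i))))) \<and>
        (\<Union>i. \<Gamma> i) = carrier L)"

end

theory Submission
  imports Defs "HOL-Library.Multiset"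
begin

text \<open>
  Over \<open>K\<close> the extension \<open>K(u,t)\<close> is the semidirect product \<open>F(X) \<rtimes> K\<close>, where \<open>F(X)\<close> is free on the
  conjugates \<open>k t k\<inverse>\<close> and \<open>K\<close> permutes this basis like the cosets of \<open>C(u)\<close>. If \<open>K\<close> is a torsion-free
  CSA group, every nontrivial element of \<open>K\<close> fixes at most one basis element, and a study of reduced words
  over \<open>X\<close> shows that the extension is again torsion-free and CSA; the same applies to the simultaneous
  extension of all nonconjugate centralizers. Hence Lyndon's completion can be built by finite iterated
  extensions of \<open>G\<close> in many orders: two successive extensions commute, because both orders satisfy the same
  universal property.

  Consequently both groups have a family of subgroups that is cofinal with respect to \<open>\<le>\<^sub>I\<^sub>C\<^sub>E\<close> and
  in which every one-step extension of a member is realized by a member, and a back-and-forth argument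
  gives the isomorphism. For the limit \<open>H\<close> the family consists of the \<open>A\<close> with \<open>A \<le>\<^sub>I\<^sub>C\<^sub>E \<alpha>(\<Gamma>\<^sub>i)\<close> for some
  automorphism \<open>\<alpha>\<close>, so that the independence of \<open>A \<le>\<^sub>I\<^sub>C\<^sub>E H\<close> from the chain is not needed. A free group is
  the case \<open>K = 1\<close> of the semidirect product, so it is torsion-free and CSA for the same reason.
\<close>

section \<open>Reduced words\<close>

type_synonym 'x word = "('x \<times> bool) list"

definition linv :: "'x \<times> bool \<Rightarrow> 'x \<times> bool" where
  "linv a = (fst a, \<not> snd a)"

definition winv :: "'x word \<Rightarrow> 'x word" where
  "winv w = rev (map linv w)"

definition over :: "'x set \<Rightarrow> 'x word \<Rightarrow> bool" where
  "over X w \<longleftrightarrow> fst ` set w \<subseteq> X"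

abbreviation reduced :: "'x word \<Rightarrow> bool" where
  "reduced \<equiv> successively (\<lambda>a b. b \<noteq> linv a)"

fun red_cons :: "'x \<times> bool \<Rightarrow> 'x word \<Rightarrow> 'x word" where
  "red_cons a [] = [a]"
| "red_cons a (b # w) = (if b = linv a then w else a # b # w)"

lemma linv_linv [simp]: "linv (linv a) = a"
  by (simp add: linv_def)

lemma linv_neq [simp]: "linv a \<noteq> a" "a \<noteq> linv a"
  by (simp_all add: linv_def prod_eq_iff)

lemma linv_eq_iff [simp]: "linv a = linv b \<longleftrightarrow> a = b"
  by (auto simp: linv_def prod_eq_iff)

lemma fst_linv [simp]: "fst (linv a) = fst a"
  by (simp add: linv_def)

lemma winv_Nil [simp]: "winv [] = []"
  and winv_Cons: "winv (a # w) = winv w @ [linv a]"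
  and winv_append [simp]: "winv (u @ v) = winv v @ winv u"
  and length_winv [simp]: "length (winv w) = length w"
  and winv_eq_Nil [simp]: "winv w = [] \<longleftrightarrow> w = []"
  by (simp_all add: winv_def)

lemma winv_winv [simp]: "winv (winv w) = w"
  by (simp add: winv_def rev_map comp_def)

lemma last_winv [simp]: "w \<noteq> [] \<Longrightarrow> last (winv w) = linv (hd w)"
  and hd_winv [simp]: "w \<noteq> [] \<Longrightarrow> hd (winv w) = linv (last w)"
  by (simp_all add: winv_def last_rev hd_rev hd_map last_map)

lemma fst_set_winv [simp]: "fst ` set (winv w) = fst ` set w"
  by (force simp: winv_def)

lemma over_Nil [simp]: "over X []"
  and over_Cons [simp]: "over X (a # w) \<longleftrightarrow> fst a \<in> X \<and> over X w"
  and over_append [simp]: "over X (u @ v) \<longleftrightarrow> over X u \<and> over X v"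
  and over_winv [simp]: "over X (winv w) \<longleftrightarrow> over X w"
  by (auto simp: over_def)

lemma over_mono: "over X w \<Longrightarrow> X \<subseteq> Y \<Longrightarrow> over Y w"
  by (auto simp: over_def)

lemma over_replicate [simp]: "over X (replicate n a) \<longleftrightarrow> n = 0 \<or> fst a \<in> X"
  by (cases n) (auto simp: over_def)

lemma over_hd: "over X w \<Longrightarrow> w \<noteq> [] \<Longrightarrow> fst (hd w) \<in> X"
  by (auto simp: over_def)

lemma reduced_winv [simp]: "reduced (winv w) \<longleftrightarrow> reduced w"
  unfolding winv_def successively_rev successively_map
  by (rule arg_cong[where f = "\<lambda>P. successively P w"]) (metis linv_linv)

lemma reduced_red_cons: "reduced w \<Longrightarrow> reduced (red_cons a w)"
  by (cases w) (auto simp: successively_Cons)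

lemma red_cons_reduced: "reduced (a # w) \<Longrightarrow> red_cons a w = a # w"
  by (cases w) auto

lemma red_cons_linv: "reduced w \<Longrightarrow> red_cons (linv a) (red_cons a w) = w"
  by (cases w) (auto simp: red_cons_reduced split: if_splits)

lemma over_red_cons: "fst a \<in> X \<Longrightarrow> over X w \<Longrightarrow> over X (red_cons a w)"
  by (cases w) auto

text \<open>A letter can be absorbed either by the end of a cyclically reduced word or by the end of its
  inverse, but not by both.\<close>

lemma reduced_append_cases:
  assumes "reduced w" "reduced (w @ w)" "w \<noteq> []" "reduced m"
  shows "reduced (w @ m) \<or> reduced (winv w @ m)"
  using assms by (auto simp: successively_append_iff)

lemma reduced_append_cases_right:
  assumes "reduced w" "reduced (w @ w)" "w \<noteq> []" "reduced m"
  shows "reduced (m @ w) \<or> reduced (m @ winv w)"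
  using assms by (auto simp: successively_append_iff)

lemma reduced_replicate [simp]: "reduced (replicate n a)"
  by (induction n) (auto simp: successively_Cons hd_replicate)

lemma reduced_map_letters:
  assumes "inj_on f X" "over X w"
  shows "reduced (map (\<lambda>a. (f (fst a), snd a)) w) \<longleftrightarrow> reduced w"
  using assms(2)
proof (induction w)
  case (Cons a w)
  have "(f (fst b), snd b) \<noteq> linv (f (fst a), snd a) \<longleftrightarrow> b \<noteq> linv a" if "fst b \<in> X" for b
    using that Cons.prems inj_on_eq_iff[OF assms(1), of "fst b" "fst a"] by (simp add: linv_def prod_eq_iff)
  then show ?case
    using Cons by (cases w) simp_all
qed simp

subsection \<open>Commuting lists\<close>

lemma commuting_list_prefix:
  assumes "w @ a = a @ w" "w \<noteq> []" "length a \<le> k"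
  shows "take (length a) (concat (replicate k w)) = a"
proof -
  have "concat (replicate k w) @ a = a @ concat (replicate k w)" for k
  proof (induction k)
    case (Suc k)
    then show ?case
      using assms(1) by simp
  qed simp
  then have "take (length a) (concat (replicate k w) @ a) = a"
    by simp
  moreover have "length a \<le> length (concat (replicate k w))"
  proof -
    have "k * 1 \<le> k * length w"
      using assms(2) by (intro mult_le_mono) (auto simp: Suc_le_eq)
    then have "length a \<le> k * length w"
      using assms(3) by linarith
    then show ?thesis
      by (simp add: length_concat sum_list_replicate)
  qed
  ultimately show ?thesis
    by simp
qed

lemma commuting_lists_trans:
  assumes "w \<noteq> []" "w @ a = a @ w" "w @ b = b @ w"
  shows "a @ b = b @ a"
  using assms(2,3)
proof (induction "length a + length b" arbitrary: a b rule: less_induct)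
  case less
  define k where "k = length a + length b"
  have pre: "take (length a) (concat (replicate k w)) = a" "take (length b) (concat (replicate k w)) = b"
    using commuting_list_prefix[OF less.prems(1) assms(1)] commuting_list_prefix[OF less.prems(2) assms(1)]
    unfolding k_def by simp_all
  have *: "u @ v = v @ u"
    if "u @ u' = v" "u \<noteq> []" "w @ u = u @ w" "w @ v = v @ w" "length u + length v = length a + length b"
    for u u' v
  proof -
    have "u @ w @ u' = u @ u' @ w"
      using that by (metis append.assoc)
    then have "w @ u' = u' @ w"
      by simp
    moreover have "length u + length u' < length a + length b"
      using that(2,5) arg_cong[OF that(1), of length] by (cases u) simp_all
    ultimately have "u @ u' = u' @ u"
      using less.hyps that(3) by blast
    then show ?thesis
      using that(1) by auto
  qed
  show ?case
  proof (cases "a = [] \<or> b = []")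
    case False
    consider "length a \<le> length b" | "length b \<le> length a"
      by linarith
    then show ?thesis
    proof cases
      case 1
      then have "take (length a) b = a"
        using pre by (metis min.absorb1 take_take)
      then have "a @ drop (length a) b = b"
        by (metis append_take_drop_id)
      then show ?thesis
        using *[of a _ b] False less.prems by blast
    next
      case 2
      then have "take (length b) a = b"
        using pre by (metis min.absorb1 take_take)
      then have "b @ drop (length b) a = a"
        by (metis append_take_drop_id)
      then have "b @ a = a @ b"
        using *[of b _ a] False less.prems by simp
      then show ?thesis by simp
    qed
  qed auto
qed

subsection \<open>Evaluation in a group\<close>

context group
begin

lemma inv_cancel_left [simp]:
  "x \<in> carrier G \<Longrightarrow> y \<in> carrier G \<Longrightarrow> inv x \<otimes> (x \<otimes> y) = y"
  "x \<in> carrier G \<Longrightarrow> y \<in> carrier G \<Longrightarrow> x \<otimes> (inv x \<otimes> y) = y"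
  by (simp_all flip: m_assoc)

lemma commute_inv:
  assumes "x \<in> carrier G" "y \<in> carrier G" "x \<otimes> y = y \<otimes> x"
  shows "inv x \<otimes> y = y \<otimes> inv x"
proof -
  have "inv x \<otimes> y = inv x \<otimes> (y \<otimes> x) \<otimes> inv x"
    using assms(1,2) by (simp add: m_assoc)
  also have "\<dots> = inv x \<otimes> (x \<otimes> y) \<otimes> inv x"
    using assms by simp
  also have "\<dots> = y \<otimes> inv x"
    using assms(1,2) by (simp flip: m_assoc)
  finally show ?thesis .
qed

lemma commute_mult:
  assumes "x \<in> carrier G" "y \<in> carrier G" "z \<in> carrier G" "x \<otimes> z = z \<otimes> x" "y \<otimes> z = z \<otimes> y"
  shows "(x \<otimes> y) \<otimes> z = z \<otimes> (x \<otimes> y)"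
proof -
  have "(x \<otimes> y) \<otimes> z = x \<otimes> (z \<otimes> y)"
    using assms by (simp add: m_assoc)
  also have "\<dots> = z \<otimes> (x \<otimes> y)"
    using assms(1-4) by (simp flip: m_assoc)
  finally show ?thesis .
qed

lemma conj_eq_iff:
  assumes "x \<in> carrier G" "y \<in> carrier G" "z \<in> carrier G"
  shows "x \<otimes> y \<otimes> inv x = z \<longleftrightarrow> x \<otimes> y = z \<otimes> x"
  using assms by (metis inv_solve_right' m_closed)

lemma conj_commute_iff:
  assumes "x \<in> carrier G" "y \<in> carrier G" "g \<in> carrier G"
  shows "(g \<otimes> x \<otimes> inv g) \<otimes> (g \<otimes> y \<otimes> inv g) = (g \<otimes> y \<otimes> inv g) \<otimes> (g \<otimes> x \<otimes> inv g)
    \<longleftrightarrow> x \<otimes> y = y \<otimes> x"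
  using assms by (simp add: m_assoc)  (simp flip: m_assoc)

lemma conj_commute_shift:
  assumes "x \<in> carrier G" "y \<in> carrier G" "g \<in> carrier G"
  shows "(g \<otimes> x \<otimes> inv g) \<otimes> y = y \<otimes> (g \<otimes> x \<otimes> inv g)
    \<longleftrightarrow> x \<otimes> (inv g \<otimes> y \<otimes> g) = (inv g \<otimes> y \<otimes> g) \<otimes> x"
  using conj_commute_iff[of x "inv g \<otimes> y \<otimes> g" g] assms by (simp add: m_assoc)

definition letter_val :: "'a \<times> bool \<Rightarrow> 'a" where
  "letter_val a = (if snd a then fst a else inv (fst a))"

definition word_val :: "'a word \<Rightarrow> 'a" where
  "word_val w = foldr (\<lambda>a g. letter_val a \<otimes> g) w \<one>"

definition conj_word :: "'a \<Rightarrow> 'a word \<Rightarrow> 'a word" where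
  "conj_word k = map (\<lambda>a. (k \<otimes> fst a \<otimes> inv k, snd a))"

lemma letter_val_closed [simp]: "fst a \<in> carrier G \<Longrightarrow> letter_val a \<in> carrier G"
  by (simp add: letter_val_def)

lemma letter_val_linv [simp]: "fst a \<in> carrier G \<Longrightarrow> letter_val (linv a) = inv (letter_val a)"
  by (simp add: letter_val_def linv_def)

lemma word_val_Nil [simp]: "word_val [] = \<one>"
  and word_val_Cons: "word_val (a # w) = letter_val a \<otimes> word_val w"
  by (simp_all add: word_val_def)

lemma word_val_closed [simp]: "over (carrier G) w \<Longrightarrow> word_val w \<in> carrier G"
  by (induction w) (auto simp: word_val_Cons)

lemma word_val_append:
  "over (carrier G) u \<Longrightarrow> over (carrier G) v \<Longrightarrow>
    word_val (u @ v) = word_val u \<otimes> word_val v"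
proof (induction u)
  case (Cons a u)
  then have "fst a \<in> carrier G" "over (carrier G) u"
    by auto
  with Cons show ?case
    by (simp add: word_val_Cons m_assoc)
qed auto

lemma word_val_single [simp]: "fst a \<in> carrier G \<Longrightarrow> word_val [a] = letter_val a"
  by (simp add: word_val_Cons)

lemma word_val_winv:
  "over (carrier G) w \<Longrightarrow> word_val (winv w) = inv (word_val w)"
proof (induction w)
  case (Cons a w)
  then show ?case
    by (simp add: winv_Cons word_val_append word_val_Cons inv_mult_group)
qed auto

lemma word_val_red_cons:
  "fst a \<in> carrier G \<Longrightarrow> over (carrier G) w \<Longrightarrow>
    word_val (red_cons a w) = letter_val a \<otimes> word_val w"
  by (cases w) (auto simp: word_val_Cons)

lemma reduced_form:
  assumes "over X w" "X \<subseteq> carrier G"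
  obtains w' where "over X w'" "reduced w'" "word_val w' = word_val w"
proof -
  have "\<exists>w'. over X w' \<and> reduced w' \<and> word_val w' = word_val w"
    using assms(1)
  proof (induction w)
    case (Cons a w)
    then obtain w' where w': "over X w'" "reduced w'" "word_val w' = word_val w"
      by auto
    have "over (carrier G) w'"
      using w'(1) assms(2) over_mono by blast
    then have "word_val (red_cons a w') = word_val (a # w)"
      using w' Cons.prems assms(2) by (subst word_val_red_cons) (auto simp: word_val_Cons)
    moreover have "over X (red_cons a w')"
      using w' Cons.prems by (simp add: over_red_cons)
    ultimately show ?case
      using reduced_red_cons w'(2) by blast
  qed (auto intro: exI[of _ "[]"])
  then show ?thesis
    using that by blast
qed

lemma letter_val_conj:
  "k \<in> carrier G \<Longrightarrow> fst a \<in> carrier G \<Longrightarrow>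
    letter_val (k \<otimes> fst a \<otimes> inv k, snd a) = k \<otimes> letter_val a \<otimes> inv k"
  by (auto simp: letter_val_def inv_mult_group m_assoc)

lemma over_conj_word:
  "k \<in> carrier G \<Longrightarrow> over (carrier G) w \<Longrightarrow> over (carrier G) (conj_word k w)"
  by (auto simp: over_def conj_word_def)

lemma word_val_conj:
  "k \<in> carrier G \<Longrightarrow> over (carrier G) w \<Longrightarrow>
    word_val (conj_word k w) = k \<otimes> word_val w \<otimes> inv k"
proof (induction w)
  case (Cons a w)
  have a: "fst a \<in> carrier G" and w: "over (carrier G) w"
    using Cons.prems(2) by auto
  have "word_val (conj_word k (a # w)) =
      letter_val (k \<otimes> fst a \<otimes> inv k, snd a) \<otimes> word_val (conj_word k w)"
    by (simp add: conj_word_def word_val_Cons)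
  also have "\<dots> = (k \<otimes> letter_val a \<otimes> inv k) \<otimes> (k \<otimes> word_val w \<otimes> inv k)"
    using Cons.IH[OF Cons.prems(1) w] letter_val_conj[OF Cons.prems(1) a] by simp
  also have "\<dots> = k \<otimes> word_val (a # w) \<otimes> inv k"
    using a w Cons.prems(1) by (simp add: word_val_Cons m_assoc)
  finally show ?case .
qed (auto simp: conj_word_def)

lemma length_conj_word [simp]: "length (conj_word k w) = length w"
  and conj_word_append: "conj_word k (u @ v) = conj_word k u @ conj_word k v"
  and conj_word_eq_Nil [simp]: "conj_word k w = [] \<longleftrightarrow> w = []"
  and fst_set_conj_word: "fst ` set (conj_word k w) = (\<lambda>x. k \<otimes> x \<otimes> inv k) ` fst ` set w"
  and hd_conj_word: "w \<noteq> [] \<Longrightarrow> hd (conj_word k w) = (k \<otimes> fst (hd w) \<otimes> inv k, snd (hd w))"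
  by (auto simp: conj_word_def image_image hd_map)

lemma conj_inj:
  assumes "k \<in> carrier G" "x \<in> carrier G" "y \<in> carrier G"
  shows "k \<otimes> x \<otimes> inv k = k \<otimes> y \<otimes> inv k \<longleftrightarrow> x = y"
  using assms by (simp add: m_assoc)

lemma reduced_conj_word:
  assumes "k \<in> carrier G" "over (carrier G) w"
  shows "reduced (conj_word k w) \<longleftrightarrow> reduced w"
  using assms(2)
proof (induction w)
  case (Cons a w)
  then have "w \<noteq> [] \<Longrightarrow> fst (hd w) \<in> carrier G"
    using over_hd[of _ w] by simp
  with Cons assms(1) show ?case
    by (auto simp: successively_Cons hd_conj_word linv_def prod_eq_iff conj_inj conj_word_def hd_map)
qed (auto simp: conj_word_def)

end

section \<open>Free extensions\<close>

definition commutation_transitive_on :: "('a, 'm) monoid_scheme \<Rightarrow> 'a set \<Rightarrow> bool" where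
  "commutation_transitive_on G S \<longleftrightarrow>
     (\<forall>x\<in>S. \<forall>y\<in>S. \<forall>z\<in>S. x \<noteq> \<one>\<^bsub>G\<^esub> \<longrightarrow> x \<otimes>\<^bsub>G\<^esub> y = y \<otimes>\<^bsub>G\<^esub> x \<longrightarrow> x \<otimes>\<^bsub>G\<^esub> z = z \<otimes>\<^bsub>G\<^esub> x
        \<longrightarrow> y \<otimes>\<^bsub>G\<^esub> z = z \<otimes>\<^bsub>G\<^esub> y)"

definition conjugately_separated_on :: "('a, 'm) monoid_scheme \<Rightarrow> 'a set \<Rightarrow> bool" where
  "conjugately_separated_on G S \<longleftrightarrow>
     (\<forall>x\<in>S. \<forall>y\<in>S. x \<noteq> \<one>\<^bsub>G\<^esub> \<longrightarrow>
        x \<otimes>\<^bsub>G\<^esub> (inv\<^bsub>G\<^esub> y \<otimes>\<^bsub>G\<^esub> x \<otimes>\<^bsub>G\<^esub> y) = (inv\<^bsub>G\<^esub> y \<otimes>\<^bsub>G\<^esub> x \<otimes>\<^bsub>G\<^esub> y) \<otimes>\<^bsub>G\<^esub> x \<longrightarrow>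
        x \<otimes>\<^bsub>G\<^esub> y = y \<otimes>\<^bsub>G\<^esub> x)"

definition torsion_free_on :: "('a, 'm) monoid_scheme \<Rightarrow> 'a set \<Rightarrow> bool" where
  "torsion_free_on G S \<longleftrightarrow> (\<forall>x\<in>S. \<forall>n::nat. n > 0 \<and> x [^]\<^bsub>G\<^esub> n = \<one>\<^bsub>G\<^esub> \<longrightarrow> x = \<one>\<^bsub>G\<^esub>)"

definition CSA_torsion_free_on :: "('a, 'm) monoid_scheme \<Rightarrow> 'a set \<Rightarrow> bool" where
  "CSA_torsion_free_on G S \<longleftrightarrow>
     commutation_transitive_on G S \<and> conjugately_separated_on G S \<and> torsion_free_on G S"

context group
begin

lemma commute_int_pow:
  assumes "x \<in> carrier G" "y \<in> carrier G" "x \<otimes> y = y \<otimes> x"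
  shows "x [^] (i::int) \<otimes> y = y \<otimes> x [^] i"
proof -
  have "x [^] n \<otimes> y = y \<otimes> x [^] n" for n :: nat
    by (rule group_commutes_pow[OF assms(3,1,2)])
  then have "x [^] nat i \<otimes> y = y \<otimes> x [^] nat i" "inv (x [^] nat (- i)) \<otimes> y = y \<otimes> inv (x [^] nat (- i))"
    using commute_inv[of "x [^] nat (- i)" y] assms(1,2) by blast+
  then show ?thesis
    unfolding int_pow_def2 by presburger
qed

definition power_word :: "'a \<Rightarrow> int \<Rightarrow> 'a word" where
  "power_word a i = replicate (nat \<bar>i\<bar>) (a, 0 < i)"

lemma word_val_replicate:
  assumes "fst a \<in> carrier G"
  shows "word_val (replicate n a) = letter_val a [^] n"
proof (induction n)
  case (Suc n)
  then show ?case
    using nat_pow_Suc2[OF letter_val_closed[OF assms], of n]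
    by (simp only: replicate_Suc word_val_Cons)
qed simp

lemma word_val_power_word [simp]:
  assumes "a \<in> carrier G"
  shows "word_val (power_word a i) = a [^] i"
proof (cases "0 < i")
  case True
  have "word_val (power_word a i) = a [^] nat i"
    using assms True by (simp add: power_word_def word_val_replicate letter_val_def)
  then show ?thesis
    using True pow_nat[of i G a] by simp
next
  case False
  have "word_val (power_word a i) = inv a [^] nat (- i)"
    using assms False by (simp add: power_word_def word_val_replicate letter_val_def)
  also have "\<dots> = inv (a [^] int (nat (- i)))"
    using assms nat_pow_inv int_pow_int[of G a "nat (- i)"] by simp
  also have "\<dots> = a [^] i"
    using int_pow_neg[OF assms, of "- i"] False by simp
  finally show ?thesis .
qed

lemma power_word_eq_Nil [simp]: "power_word a i = [] \<longleftrightarrow> i = 0"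
  and length_power_word [simp]: "length (power_word a i) = nat \<bar>i\<bar>"
  and over_power_word: "a \<in> X \<Longrightarrow> over X (power_word a i)"
  and reduced_power_word [simp]: "reduced (power_word a i)"
  and hd_power_word: "i \<noteq> 0 \<Longrightarrow> hd (power_word a i) = (a, 0 < i)"
  and last_power_word: "i \<noteq> 0 \<Longrightarrow> last (power_word a i) = (a, 0 < i)"
  by (auto simp: power_word_def hd_replicate)

end

locale letter_system = group G for G (structure) +
  fixes K X :: "'a set"
  assumes subgroup_K: "subgroup K G"
    and X_carrier: "X \<subseteq> carrier G"
    and conj_X: "k \<in> K \<Longrightarrow> x \<in> X \<Longrightarrow> k \<otimes> x \<otimes> inv k \<in> X"
begin

definition span :: "'a set" where
  "span = {word_val w \<otimes> k | w k. over X w \<and> reduced w \<and> k \<in> K}"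

lemma K_carrier [simp]: "k \<in> K \<Longrightarrow> k \<in> carrier G"
  using subgroup.mem_carrier[OF subgroup_K] .

lemma X_closed [simp]: "x \<in> X \<Longrightarrow> x \<in> carrier G"
  using X_carrier by blast

lemma K_closed [simp]: "k \<in> K \<Longrightarrow> k' \<in> K \<Longrightarrow> k \<otimes> k' \<in> K" "k \<in> K \<Longrightarrow> inv k \<in> K" "\<one> \<in> K"
  using subgroup_K by (auto simp: subgroup_def)

lemma over_carrier [simp]: "over X w \<Longrightarrow> over (carrier G) w"
  using X_carrier over_mono by blast

lemma over_X_conj_word: "k \<in> K \<Longrightarrow> over X w \<Longrightarrow> over X (conj_word k w)"
  using conj_X by (auto simp: over_def conj_word_def)

lemma spanI: "over X w \<Longrightarrow> k \<in> K \<Longrightarrow> word_val w \<otimes> k \<in> span"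
  by (rule reduced_form[OF _ X_carrier, of w]) (auto simp: span_def, metis)

lemma spanE:
  assumes "y \<in> span"
  obtains w k where "over X w" "reduced w" "k \<in> K" "y = word_val w \<otimes> k"
  using assms by (auto simp: span_def)

lemma move_left:
  assumes "k \<in> K" "over X w"
  shows "k \<otimes> word_val w = word_val (conj_word k w) \<otimes> k"
  using assms by (simp add: word_val_conj m_assoc)

lemma normal_form_mult:
  assumes "over X w" "over X w'" "k \<in> K" "k' \<in> K"
  shows "(word_val w \<otimes> k) \<otimes> (word_val w' \<otimes> k') = word_val (w @ conj_word k w') \<otimes> (k \<otimes> k')"
proof -
  have "(word_val w \<otimes> k) \<otimes> (word_val w' \<otimes> k') = word_val w \<otimes> (k \<otimes> word_val w') \<otimes> k'"
    using assms by (simp add: m_assoc)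
  also have "\<dots> = word_val w \<otimes> (word_val (conj_word k w') \<otimes> k) \<otimes> k'"
    using assms by (simp add: move_left)
  finally show ?thesis
    using assms over_X_conj_word[of k w'] by (simp add: word_val_append m_assoc)
qed

lemma span_carrier: "span \<subseteq> carrier G"
  by (auto simp: span_def)

lemma span_closed [simp]: "y \<in> span \<Longrightarrow> y \<in> carrier G"
  using span_carrier by blast

lemma subgroup_span: "subgroup span G"
proof (rule subgroupI)
  show "span \<noteq> {}"
    using spanI[of "[]" \<one>] by auto
  show "inv y \<in> span" if "y \<in> span" for y
  proof -
    obtain w k where y: "over X w" "k \<in> K" "y = word_val w \<otimes> k"
      using spanE \<open>y \<in> span\<close> by metis
    then have "inv y = inv k \<otimes> word_val (winv w)"
      by (simp add: word_val_winv inv_mult_group)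
    also have "\<dots> = word_val (conj_word (inv k) (winv w)) \<otimes> inv k"
      using y by (intro move_left) auto
    finally show ?thesis
      using y over_X_conj_word[of "inv k" "winv w"] by (simp add: spanI)
  qed
  show "y \<otimes> z \<in> span" if "y \<in> span" "z \<in> span" for y z
  proof -
    obtain w k where y: "over X w" "k \<in> K" "y = word_val w \<otimes> k"
      using spanE \<open>y \<in> span\<close> by metis
    obtain w' k' where z: "over X w'" "k' \<in> K" "z = word_val w' \<otimes> k'"
      using spanE \<open>z \<in> span\<close> by metis
    show ?thesis
      using y z over_X_conj_word[of k w'] by (simp add: normal_form_mult spanI)
  qed
qed (rule span_carrier)

lemma span_mult [simp]: "y \<in> span \<Longrightarrow> z \<in> span \<Longrightarrow> y \<otimes> z \<in> span"
  and span_inv [simp]: "y \<in> span \<Longrightarrow> inv y \<in> span"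
  and span_one [simp]: "\<one> \<in> span"
  using subgroup_span by (auto simp: subgroup_def)

lemma word_val_in_span: "over X w \<Longrightarrow> word_val w \<in> span"
  using spanI[of w \<one>] by simp

lemma X_in_span: "x \<in> X \<Longrightarrow> x \<in> span"
  using word_val_in_span[of "[(x, True)]"] by (simp add: letter_val_def)

lemma K_in_span: "k \<in> K \<Longrightarrow> k \<in> span"
  using spanI[of "[]" k] by simp

end

locale free_over = letter_system +
  assumes free: "over X w \<Longrightarrow> reduced w \<Longrightarrow> word_val w \<in> K \<Longrightarrow> w = []"
begin

lemma word_val_inject:
  assumes "over X w" "over X w'" "reduced w" "reduced w'" "inv (word_val w') \<otimes> word_val w \<in> K"
  shows "w = w'"
  using assms
proof (induction w arbitrary: w')
  case Nil
  then have "word_val (winv w') \<in> K"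
    by (simp add: word_val_winv)
  then show ?case
    using free[of "winv w'"] Nil by simp
next
  case (Cons a w)
  have eq: "word_val (winv w' @ a # w) \<in> K"
    using Cons.prems by (simp add: word_val_append word_val_winv)
  show ?case
  proof (cases "w' \<noteq> [] \<and> hd w' = a")
    case True
    then obtain v where v: "w' = a # v"
      by (cases w') auto
    then have "inv (word_val v) \<otimes> word_val w \<in> K"
      using Cons.prems by (simp add: word_val_Cons inv_mult_group m_assoc)
    with Cons v show ?thesis
      by (auto simp: successively_Cons)
  next
    case False
    then have "reduced (winv w' @ a # w)"
      using Cons.prems by (auto simp: successively_append_iff)
    then have "winv w' @ a # w = []"
      using free[of "winv w' @ a # w"] eq Cons.prems by simp
    then show ?thesis by simp
  qed
qed

lemma normal_form_unique:
  assumes "over X w" "over X w'" "reduced w" "reduced w'" "k \<in> K" "k' \<in> K"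
    and "word_val w \<otimes> k = word_val w' \<otimes> k'"
  shows "w = w'" "k = k'"
proof -
  have "inv (word_val w') \<otimes> word_val w = inv (word_val w') \<otimes> (word_val w \<otimes> k) \<otimes> inv k"
    using assms(1-6) by (simp add: m_assoc)
  also have "\<dots> = inv (word_val w') \<otimes> (word_val w' \<otimes> k') \<otimes> inv k"
    by (simp only: assms(7))
  also have "\<dots> = k' \<otimes> inv k"
    using assms(1-6) by simp
  finally have "inv (word_val w') \<otimes> word_val w \<in> K"
    using assms by simp
  then show *: "w = w'"
    using word_val_inject assms by blast
  then show "k = k'"
    using assms by simp
qed

lemma word_val_unique:
  assumes "over X w" "over X w'" "reduced w" "reduced w'" "word_val w = word_val w'"
  shows "w = w'"
  using normal_form_unique(1)[of w w' \<one> \<one>] assms by simp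

lemma conj_word_eq_self:
  assumes "k \<in> K" "over X w" "conj_word k w = w" "a \<in> set w"
  shows "k \<otimes> fst a = fst a \<otimes> k"
proof -
  have "(k \<otimes> fst a \<otimes> inv k, snd a) = a"
    using assms(3,4) unfolding conj_word_def by (induction w) auto
  moreover have "fst a \<in> carrier G"
    using assms(2,4) X_carrier by (auto simp: over_def)
  ultimately show ?thesis
    using conj_eq_iff[of k "fst a" "fst a"] assms(1) by (metis K_carrier fst_conv)
qed

lemma centralizer_of_base:
  assumes "u \<in> K" "over X w" "reduced w" "k \<in> K" "u \<otimes> (word_val w \<otimes> k) = (word_val w \<otimes> k) \<otimes> u"
  shows "conj_word u w = w" "u \<otimes> k = k \<otimes> u"
proof -
  have "word_val (conj_word u w) \<otimes> (u \<otimes> k) = (u \<otimes> word_val w) \<otimes> k"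
    using assms over_X_conj_word[of u w] by (simp add: move_left m_assoc)
  also have "\<dots> = word_val w \<otimes> (k \<otimes> u)"
    using assms by (simp add: m_assoc)
  finally show "conj_word u w = w" "u \<otimes> k = k \<otimes> u"
    using normal_form_unique[of "conj_word u w" w "u \<otimes> k" "k \<otimes> u"] assms
    by (simp_all add: over_X_conj_word reduced_conj_word)
qed

lemma cyclic_reduction:
  assumes "over X w" "reduced w" "w \<noteq> []"
  shows "\<exists>g v. over X g \<and> over X v \<and> reduced (v @ v) \<and> v \<noteq> [] \<and>
    word_val w = word_val g \<otimes> word_val v \<otimes> inv (word_val g)"
  using assms
proof (induction "length w" arbitrary: w rule: less_induct)
  case less
  show ?case
  proof (cases "reduced (w @ w)")
    case True
    then show ?thesis
      using less.prems by (intro exI[of _ "[]"] exI[of _ w]) simp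
  next
    case False
    then have hd: "hd w = linv (last w)"
      using less.prems by (auto simp: successively_append_iff)
    obtain a u where w: "w = a # u"
      using less.prems by (cases w) auto
    have "u \<noteq> []"
      using hd w by auto
    then obtain v b where "u = v @ [b]"
      by (cases u rule: rev_cases) auto
    then have w': "w = a # v @ [linv a]"
      using hd w by auto
    have "v \<noteq> []"
      using less.prems(2) w' by auto
    then obtain g r where r: "over X g" "over X r" "reduced (r @ r)" "r \<noteq> []"
        "word_val v = word_val g \<otimes> word_val r \<otimes> inv (word_val g)"
      using less.hyps[of v] less.prems w' by (auto simp: successively_append_iff successively_Cons)
    have "word_val w = letter_val a \<otimes> word_val v \<otimes> inv (letter_val a)"
      using less.prems w' by (simp add: word_val_Cons word_val_append m_assoc)
    also have "\<dots> = word_val (a # g) \<otimes> word_val r \<otimes> inv (word_val (a # g))"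
      using r less.prems w' by (simp add: word_val_Cons inv_mult_group m_assoc)
    finally show ?thesis
      using r less.prems w' by (intro exI[of _ "a # g"] exI[of _ r]) auto
  qed
qed

text \<open>If neither \<open>w m\<close> nor its inverse counterpart can be read off as an equation between reduced
  words, then \<open>w\<^sup>\<plusminus>\<^sup>1 m v\<^sup>\<minusplus>\<^sup>1\<close> is a reduced word representing the same element as \<open>m\<close>.\<close>

lemma conjugate_cyclically_reduced:
  assumes w: "over X w" "reduced (w @ w)" "w \<noteq> []" and v: "over X v" "reduced (v @ v)" "v \<noteq> []"
    and m: "over X m" "reduced m"
    and eq: "word_val w \<otimes> word_val m = word_val m \<otimes> word_val v"
  shows "w @ m = m @ v \<or> winv w @ m = m @ winv v"
proof (cases "m = []")
  case True
  then show ?thesis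
    using eq w v word_val_unique[of w v] by (simp add: successively_append_iff)
next
  case False
  have red: "reduced w" "reduced v"
    using w v by (auto simp: successively_append_iff)
  have eq': "word_val (winv w) \<otimes> word_val m = word_val m \<otimes> word_val (winv v)"
  proof -
    have "word_val (winv w) \<otimes> word_val m = inv (word_val w) \<otimes> (word_val m \<otimes> word_val v) \<otimes> inv (word_val v)"
      using w v m by (simp add: word_val_winv m_assoc)
    also have "\<dots> = inv (word_val w) \<otimes> (word_val w \<otimes> word_val m) \<otimes> inv (word_val v)"
      by (simp only: eq)
    also have "\<dots> = word_val m \<otimes> word_val (winv v)"
      using w v m by (simp add: word_val_winv)
    finally show ?thesis .
  qed
  have same: "p @ m = m @ q"
    if "over X p" "over X q" "reduced (p @ m)" "reduced (m @ q)"
       "word_val p \<otimes> word_val m = word_val m \<otimes> word_val q" for p q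
    using word_val_unique[of "p @ m" "m @ q"] that m by (simp add: word_val_append)
  have mixed: False
    if "over X p" "over X q" "p \<noteq> []" "reduced (p @ m)" "reduced (m @ winv q)"
       "word_val p \<otimes> word_val m = word_val m \<otimes> word_val q" for p q
  proof -
    have "reduced (p @ m @ winv q)"
      using that False by (auto simp: successively_append_iff)
    moreover have "word_val (p @ m @ winv q) = word_val m"
    proof -
      have "word_val (p @ m @ winv q) = (word_val p \<otimes> word_val m) \<otimes> inv (word_val q)"
        using that(1,2) m by (simp add: word_val_append word_val_winv m_assoc)
      also have "\<dots> = word_val m"
        using that(1,2) m by (simp add: that(6) m_assoc)
      finally show ?thesis .
    qed
    ultimately have "p @ m @ winv q = m"
      using word_val_unique[of "p @ m @ winv q" m] that m by simp
    then have "length p + length m + length q = length m"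
      by (metis add.assoc length_append length_winv)
    then show False
      using that(3) by simp
  qed
  show ?thesis
    using reduced_append_cases[OF red(1) w(2,3) m(2)] reduced_append_cases_right[OF red(2) v(2,3) m(2)]
      same[of w v] same[of "winv w" "winv v"] mixed[of w v] mixed[of "winv w" "winv v"] w v eq eq'
    by auto
qed

end

section \<open>Free extensions of torsion-free CSA groups\<close>

locale tame_extension = free_over +
  assumes base: "CSA_torsion_free_on G K"
    and fixed_unique: "\<lbrakk>k \<in> K; k \<noteq> \<one>; x \<in> X; y \<in> X; k \<otimes> x = x \<otimes> k; k \<otimes> y = y \<otimes> k\<rbrakk> \<Longrightarrow> x = y"
    and stabilizer_abelian:
      "\<lbrakk>k \<in> K; l \<in> K; x \<in> X; k \<otimes> x = x \<otimes> k; l \<otimes> x = x \<otimes> l\<rbrakk> \<Longrightarrow> k \<otimes> l = l \<otimes> k"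
begin

definition axis_group :: "'a \<Rightarrow> 'a set" where
  "axis_group a = {a [^] (i::int) \<otimes> k | i k. k \<in> K \<and> k \<otimes> a = a \<otimes> k}"

lemma axis_groupI: "k \<in> K \<Longrightarrow> k \<otimes> a = a \<otimes> k \<Longrightarrow> a [^] (i::int) \<otimes> k \<in> axis_group a"
  by (auto simp: axis_group_def)

lemma axis_group_commute:
  assumes "a \<in> X" "y \<in> axis_group a" "z \<in> axis_group a"
  shows "y \<otimes> z = z \<otimes> y"
proof -
  obtain i k where y: "y = a [^] (i::int) \<otimes> k" "k \<in> K" "k \<otimes> a = a \<otimes> k"
    using assms(2) by (auto simp: axis_group_def)
  obtain j l where z: "z = a [^] (j::int) \<otimes> l" "l \<in> K" "l \<otimes> a = a \<otimes> l"
    using assms(3) by (auto simp: axis_group_def)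
  have kl: "k \<otimes> l = l \<otimes> k"
    using stabilizer_abelian[of k l a] assms(1) y z by blast
  have a: "a \<in> carrier G" and k: "k \<in> carrier G" and l: "l \<in> carrier G"
    using assms(1) y z by simp_all
  have ai: "a [^] i \<otimes> l = l \<otimes> a [^] i"
    using commute_int_pow[OF a l] z(3) by simp
  have aj: "a [^] j \<otimes> k = k \<otimes> a [^] j"
    using commute_int_pow[OF a k] y(3) by simp
  have aij: "a [^] i \<otimes> a [^] j = a [^] j \<otimes> a [^] i"
    using int_pow_mult[OF a, of i j] int_pow_mult[OF a, of j i] by (simp add: add.commute)
  have 1: "a [^] i \<otimes> z = z \<otimes> a [^] i"
    unfolding z(1) using commute_mult[of "a [^] j" l "a [^] i"] aij ai a l by simp
  have 2: "k \<otimes> z = z \<otimes> k"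
    unfolding z(1) using commute_mult[of "a [^] j" l k] aj kl a k l by simp
  have "z \<in> carrier G"
    using z a l by simp
  then show ?thesis
    unfolding y(1) using commute_mult[of "a [^] i" k z] 1 2 a k by simp
qed

lemma subgroup_axis_group:
  assumes "a \<in> X"
  shows "subgroup (axis_group a) G"
proof (rule subgroupI)
  show "axis_group a \<subseteq> carrier G"
    using assms by (auto simp: axis_group_def)
  have "a [^] (0::int) \<otimes> \<one> \<in> axis_group a"
    using assms by (intro axis_groupI) auto
  then show "axis_group a \<noteq> {}"
    by auto
  show "inv y \<in> axis_group a" if "y \<in> axis_group a" for y
  proof -
    obtain i k where y: "y = a [^] (i::int) \<otimes> k" "k \<in> K" "k \<otimes> a = a \<otimes> k"
      using \<open>y \<in> axis_group a\<close> by (auto simp: axis_group_def)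
    have c: "inv k \<otimes> a = a \<otimes> inv k"
      using commute_inv[of k a] y assms by simp
    have "inv y = inv k \<otimes> a [^] (- i)"
      using y assms by (simp add: inv_mult_group int_pow_neg)
    also have "\<dots> = a [^] (- i) \<otimes> inv k"
      using commute_int_pow[of a "inv k" "- i"] y c assms by simp
    finally show ?thesis
      using axis_groupI[of "inv k" a "- i"] y c by simp
  qed
  show "y \<otimes> z \<in> axis_group a" if "y \<in> axis_group a" "z \<in> axis_group a" for y z
  proof -
    obtain i k where y: "y = a [^] (i::int) \<otimes> k" "k \<in> K" "k \<otimes> a = a \<otimes> k"
      using \<open>y \<in> axis_group a\<close> by (auto simp: axis_group_def)
    obtain j l where z: "z = a [^] (j::int) \<otimes> l" "l \<in> K" "l \<otimes> a = a \<otimes> l"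
      using \<open>z \<in> axis_group a\<close> by (auto simp: axis_group_def)
    have c: "a [^] j \<otimes> k = k \<otimes> a [^] j"
      using commute_int_pow[of a k j] y assms by simp
    have "y \<otimes> z = a [^] i \<otimes> (k \<otimes> a [^] j) \<otimes> l"
      using y z assms by (simp add: m_assoc)
    also have "\<dots> = a [^] i \<otimes> (a [^] j \<otimes> k) \<otimes> l"
      by (simp only: c)
    also have "\<dots> = a [^] (i + j) \<otimes> (k \<otimes> l)"
      using y z assms by (simp add: m_assoc int_pow_mult)
    finally have yz: "y \<otimes> z = a [^] (i + j) \<otimes> (k \<otimes> l)" .
    have "(k \<otimes> l) \<otimes> a = a \<otimes> (k \<otimes> l)"
      using commute_mult[of k l a] y z assms by simp
    then show ?thesis
      unfolding yz using y z by (intro axis_groupI) simp_all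
  qed
qed

lemma axis_group_carrier: "a \<in> X \<Longrightarrow> y \<in> axis_group a \<Longrightarrow> y \<in> carrier G"
  using subgroup.mem_carrier[OF subgroup_axis_group] .

lemma axis_in_axis_group: "a \<in> X \<Longrightarrow> a \<in> axis_group a"
  using axis_groupI[of \<one> a 1] by simp

lemma word_val_in_axis_group:
  assumes "a \<in> X" "over {a} w"
  shows "word_val w \<in> axis_group a"
  using assms(2)
proof (induction w)
  case Nil
  then show ?case
    using subgroup.one_closed[OF subgroup_axis_group[OF assms(1)]] by simp
next
  case (Cons b w)
  have "letter_val b \<in> axis_group a"
    using axis_in_axis_group[OF assms(1)] Cons.prems
      subgroup.m_inv_closed[OF subgroup_axis_group[OF assms(1)]]
    by (auto simp: letter_val_def)
  then show ?case
    using Cons subgroup.m_closed[OF subgroup_axis_group[OF assms(1)]] by (simp add: word_val_Cons)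
qed

lemma conj_power_word: "conj_word k (power_word a i) = power_word (k \<otimes> a \<otimes> inv k) i"
  by (simp add: conj_word_def power_word_def)

text \<open>Letters over \<open>a\<close> at the left end of \<open>w\<close> and letters over \<open>k a k\<inverse>\<close> at its right end can be
  stripped off. For the remaining word both sides of \<open>z y = y z'\<close> are reduced as they stand.\<close>

lemma axis_group_malnormal_aux:
  assumes a: "a \<in> X" and z: "z \<in> axis_group a" "z \<noteq> \<one>" and z': "z' \<in> axis_group a" and k: "k \<in> K"
    and w: "over X w" "reduced w" "z \<otimes> (word_val w \<otimes> k) = (word_val w \<otimes> k) \<otimes> z'"
  shows "word_val w \<otimes> k \<in> axis_group a"
  using w
proof (induction "length w" arbitrary: w rule: less_induct)
  case less
  note IH = less.hyps and w = less.prems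
  obtain i b where zi: "z = a [^] (i::int) \<otimes> b" "b \<in> K" "b \<otimes> a = a \<otimes> b"
    using z(1) by (auto simp: axis_group_def)
  obtain i' b' where zi': "z' = a [^] (i'::int) \<otimes> b'" "b' \<in> K" "b' \<otimes> a = a \<otimes> b'"
    using z' by (auto simp: axis_group_def)
  have aG: "a \<in> carrier G" and zG: "z \<in> carrier G" and zG': "z' \<in> carrier G" and kG: "k \<in> carrier G"
    using axis_group_carrier a z z' k by auto
  define a' where "a' = k \<otimes> a \<otimes> inv k"
  have a': "a' \<in> X"
    using conj_X[OF k a] by (simp add: a'_def)
  have letter: "letter_val (a, e) \<in> axis_group a" for e
    using word_val_in_axis_group[OF a, of "[(a, e)]"] a by simp
  have b_inj: "b \<otimes> x \<otimes> inv b \<noteq> a" if "x \<in> X" "x \<noteq> a" for x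
  proof -
    have "b \<otimes> a \<otimes> inv b = a"
      using conj_eq_iff[of b a a] zi aG by simp
    then show ?thesis
      using conj_inj[of b x a] that zi aG by auto
  qed
  consider (left) "w \<noteq> []" "fst (hd w) = a" | (right) "w \<noteq> []" "fst (last w) = a'"
    | (core) "w \<noteq> [] \<Longrightarrow> fst (hd w) \<noteq> a" "w \<noteq> [] \<Longrightarrow> fst (last w) \<noteq> a'"
    by blast
  then show ?case
  proof cases
    case left
    then obtain e v where v: "w = (a, e) # v"
      by (metis list.collapse prod.collapse)
    define p y where "p = letter_val (a, e)" and "y = word_val v \<otimes> k"
    have pG: "p \<in> carrier G" and yG: "y \<in> carrier G"
      using w v aG k by (simp_all add: p_def y_def)
    have wy: "word_val w \<otimes> k = p \<otimes> y"
      using w v aG k by (simp add: p_def y_def word_val_Cons m_assoc)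
    have "p \<otimes> (z \<otimes> y) = z \<otimes> (p \<otimes> y)"
      using axis_group_commute[OF a letter z(1), of e] pG yG zG by (simp add: p_def flip: m_assoc)
    also have "\<dots> = p \<otimes> (y \<otimes> z')"
      using w(3) pG yG zG' by (simp add: wy m_assoc)
    finally have "z \<otimes> y = y \<otimes> z'"
      using pG yG zG zG' by simp
    then have "y \<in> axis_group a"
      unfolding y_def using IH[of v] w v by (auto simp: successively_Cons y_def)
    then show ?thesis
      unfolding wy using letter subgroup.m_closed[OF subgroup_axis_group[OF a]] by (simp add: p_def)
  next
    case right
    then obtain e v where v: "w = v @ [(a', e)]"
      by (metis append_butlast_last_id prod.collapse)
    define p y where "p = letter_val (a, e)" and "y = word_val v \<otimes> k"
    have pG: "p \<in> carrier G" and yG: "y \<in> carrier G"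
      using w v aG k by (simp_all add: p_def y_def)
    have "letter_val (a', e) = k \<otimes> p \<otimes> inv k"
      using letter_val_conj[of k "(a, e)"] k aG by (simp add: a'_def p_def)
    then have wy: "word_val w \<otimes> k = y \<otimes> p"
      using w v aG k pG by (simp add: y_def word_val_append m_assoc)
    have "z \<otimes> y \<otimes> p = y \<otimes> (p \<otimes> z')"
      using w(3) pG yG zG zG' by (simp add: wy m_assoc)
    also have "\<dots> = y \<otimes> z' \<otimes> p"
      using axis_group_commute[OF a letter z', of e] pG yG zG' by (simp add: p_def m_assoc)
    finally have "z \<otimes> y = y \<otimes> z'"
      using pG yG zG zG' by simp
    then have "y \<in> axis_group a"
      unfolding y_def using IH[of v] w v by (simp add: successively_append_iff)
    then show ?thesis
      unfolding wy using letter subgroup.m_closed[OF subgroup_axis_group[OF a]] by (simp add: p_def)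
  next
    case core
    have c: "over X (conj_word b w)" "reduced (conj_word b w)"
      using w zi by (simp_all add: over_X_conj_word reduced_conj_word)
    have "word_val (power_word a i @ conj_word b w) \<otimes> (b \<otimes> k)
        = a [^] i \<otimes> (word_val (conj_word b w) \<otimes> b) \<otimes> k"
      using c zi k aG a by (simp add: word_val_append over_power_word m_assoc)
    also have "\<dots> = z \<otimes> (word_val w \<otimes> k)"
      using w zi k aG by (simp add: zi(1) m_assoc flip: move_left)
    also have "\<dots> = word_val w \<otimes> (k \<otimes> word_val (power_word a i')) \<otimes> b'"
      using w zi' k aG by (simp add: w(3) zi'(1) m_assoc)
    also have "\<dots> = word_val w \<otimes> (word_val (power_word a' i') \<otimes> k) \<otimes> b'"
      using move_left[of k "power_word a i'"] k a by (simp only: conj_power_word over_power_word a'_def)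
    also have "\<dots> = word_val (w @ power_word a' i') \<otimes> (k \<otimes> b')"
      using w zi' k a' by (simp add: word_val_append over_power_word m_assoc)
    finally have eq: "word_val (power_word a i @ conj_word b w) \<otimes> (b \<otimes> k)
        = word_val (w @ power_word a' i') \<otimes> (k \<otimes> b')" .
    have red1: "reduced (power_word a i @ conj_word b w)"
    proof -
      have "hd (conj_word b w) \<noteq> linv (last (power_word a i))" if "i \<noteq> 0" "w \<noteq> []"
        using that b_inj[of "fst (hd w)"] core(1) over_hd[OF w(1)]
        by (simp add: last_power_word hd_conj_word linv_def)
      then show ?thesis
        using c(2) by (auto simp: successively_append_iff)
    qed
    have red2: "reduced (w @ power_word a' i')"
    proof -
      have "hd (power_word a' i') \<noteq> linv (last w)" if "i' \<noteq> 0" "w \<noteq> []"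
        using that core(2) by (auto simp: hd_power_word linv_def prod_eq_iff)
      then show ?thesis
        using w(2) by (auto simp: successively_append_iff)
    qed
    have words: "power_word a i @ conj_word b w = w @ power_word a' i'" and bk: "b \<otimes> k = k \<otimes> b'"
      using normal_form_unique[OF _ _ red1 red2 _ _ eq] c w a a' k zi zi'
      by (simp_all add: over_power_word)
    have b1: "b \<noteq> \<one>" if "i = 0"
      using z(2) zi that by auto
    show ?thesis
    proof (cases "w = []")
      case True
      then have pw: "power_word a i = power_word a' i'"
        using words by (simp add: conj_word_def)
      have "a' = a"
      proof (cases "i = 0")
        case False
        moreover have "i' \<noteq> 0"
          using pw False by (metis power_word_eq_Nil)
        ultimately show ?thesis
          using pw hd_power_word[of i a] hd_power_word[of i' a'] by simp
      next
        case True
        have bG: "b \<in> carrier G" and bG': "b' \<in> carrier G"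
          using zi zi' by simp_all
        have "b \<otimes> a' = (b \<otimes> k) \<otimes> a \<otimes> inv k"
          using bG kG aG by (simp add: a'_def m_assoc)
        also have "\<dots> = k \<otimes> (b' \<otimes> a) \<otimes> inv k"
          using bG' kG aG by (simp add: bk m_assoc)
        also have "\<dots> = k \<otimes> a \<otimes> inv k \<otimes> (k \<otimes> b') \<otimes> inv k"
          using bG' kG aG by (simp add: zi'(3) m_assoc)
        also have "\<dots> = a' \<otimes> b"
          using bG kG aG by (simp add: a'_def m_assoc flip: bk)
        finally show ?thesis
          using fixed_unique[of b a' a] zi b1 True a a' by simp
      qed
      then have "k \<otimes> a = a \<otimes> k"
        using conj_eq_iff[OF kG aG aG] by (simp add: a'_def)
      then show ?thesis
        using axis_groupI[of k a 0] k True by simp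
    next
      case False
      have i: "i = 0"
      proof (rule ccontr)
        assume "i \<noteq> 0"
        then have "hd (power_word a i @ conj_word b w) = (a, 0 < i)"
          by (simp add: hd_power_word)
        then show False
          using core(1) False words by simp
      qed
      have "nat \<bar>i\<bar> + length w = length w + nat \<bar>i'\<bar>"
        using arg_cong[OF words, of length] by simp
      then have "i' = 0"
        using i by simp
      then have "conj_word b w = w"
        using words i by (simp add: power_word_def)
      then have "b \<otimes> fst (hd w) = fst (hd w) \<otimes> b"
        using conj_word_eq_self[of b w "hd w"] zi w False by simp
      then show ?thesis
        using fixed_unique[of b "fst (hd w)" a] zi b1 i a core(1) False over_hd[OF w(1) False] by simp
    qed
  qed
qed

lemma axis_group_malnormal:
  assumes "a \<in> X" "z \<in> axis_group a" "z \<noteq> \<one>" "z' \<in> axis_group a" "y \<in> span" "z \<otimes> y = y \<otimes> z'"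
  shows "y \<in> axis_group a"
  using axis_group_malnormal_aux[OF assms(1-4)] assms(5,6) by (auto elim!: spanE)

subsection \<open>The projection to the base group\<close>

definition proj :: "'a \<Rightarrow> 'a" where
  "proj y = (THE k. k \<in> K \<and> (\<exists>w. over X w \<and> reduced w \<and> y = word_val w \<otimes> k))"

lemma proj_normal_form [simp]:
  assumes "over X w" "k \<in> K"
  shows "proj (word_val w \<otimes> k) = k"
proof -
  obtain w' where w': "over X w'" "reduced w'" "word_val w' = word_val w"
    using reduced_form[OF assms(1) X_carrier] .
  show ?thesis
    unfolding proj_def
  proof (rule the_equality)
    show "k \<in> K \<and> (\<exists>v. over X v \<and> reduced v \<and> word_val w \<otimes> k = word_val v \<otimes> k)"
      using w' assms(2) by metis
    fix l
    assume "l \<in> K \<and> (\<exists>v. over X v \<and> reduced v \<and> word_val w \<otimes> k = word_val v \<otimes> l)"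
    then show "l = k"
      using w' assms normal_form_unique(2)[of _ w' l k] by metis
  qed
qed

lemma proj_in_K [simp]: "y \<in> span \<Longrightarrow> proj y \<in> K"
  by (auto elim!: spanE)

lemma proj_mult:
  assumes "y \<in> span" "z \<in> span"
  shows "proj (y \<otimes> z) = proj y \<otimes> proj z"
  using assms by (auto elim!: spanE simp: normal_form_mult over_X_conj_word)

lemma proj_word [simp]: "over X w \<Longrightarrow> proj (word_val w) = \<one>"
  using proj_normal_form[of w \<one>] by simp

lemma proj_one [simp]: "proj \<one> = \<one>"
  using proj_word[of "[]"] by simp

lemma proj_inv:
  assumes "y \<in> span"
  shows "proj (inv y) = inv (proj y)"
proof -
  have "proj (inv y) \<otimes> proj y = \<one>"
    using assms by (simp flip: proj_mult)
  then show ?thesis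
    using assms inv_equality[of "proj (inv y)" "proj y"] by simp
qed

lemma proj_pow: "y \<in> span \<Longrightarrow> y [^] (n::nat) \<in> span \<and> proj (y [^] n) = proj y [^] n"
  by (induction n) (auto simp: proj_mult)

lemma proj_eq_one:
  assumes "y \<in> span" "proj y = \<one>"
  obtains w where "over X w" "reduced w" "y = word_val w"
  using assms by (auto elim!: spanE)

subsection \<open>Elliptic elements\<close>

definition elliptic :: "'a \<Rightarrow> bool" where
  "elliptic y \<longleftrightarrow> (\<exists>a\<in>X. \<exists>h\<in>span. h \<otimes> y \<otimes> inv h \<in> axis_group a)"

text \<open>Some power of \<open>c\<close> centralizes a letter \<open>x\<close> occurring in \<open>v\<close>; it also centralizes \<open>c x c\<inverse>\<close>.\<close>

lemma cyclically_reduced_axis: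
  assumes v: "over X v" "reduced (v @ v)" "v \<noteq> []" and y: "y \<in> span" "y \<otimes> word_val v = word_val v \<otimes> y"
    and ny: "proj y \<noteq> \<one>"
  shows "\<exists>a\<in>X. word_val v \<in> axis_group a"
proof -
  obtain m c where m: "over X m" "reduced m" "c \<in> K" "y = word_val m \<otimes> c"
    using spanE[OF y(1)] .
  have c1: "c \<noteq> \<one>"
    using ny m by simp
  have cv: "over X (conj_word c v)" "reduced (conj_word c v @ conj_word c v)" "conj_word c v \<noteq> []"
    using v m by (simp_all add: over_X_conj_word reduced_conj_word flip: conj_word_append)
  have "(word_val v \<otimes> word_val m) \<otimes> c = word_val m \<otimes> (c \<otimes> word_val v)"
    using y m v by (simp add: m_assoc)
  also have "\<dots> = (word_val m \<otimes> word_val (conj_word c v)) \<otimes> c"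
    using m v cv by (simp add: move_left m_assoc)
  finally have "word_val v \<otimes> word_val m = word_val m \<otimes> word_val (conj_word c v)"
    using m v cv by simp
  then have "v @ m = m @ conj_word c v \<or> winv v @ m = m @ winv (conj_word c v)"
    using conjugate_cyclically_reduced[OF v cv m(1,2)] by blast
  then have "mset v + mset m = mset m + mset (conj_word c v) \<or>
      mset (winv v) + mset m = mset m + mset (winv (conj_word c v))"
    by (metis mset_append)
  then have "mset v = mset (conj_word c v) \<or> mset (winv v) = mset (winv (conj_word c v))"
    by (simp add: add.commute)
  then have "fst ` set v = fst ` set (conj_word c v)"
    by (metis fst_set_winv mset_eq_setD)
  then have inv_set: "(\<lambda>x. c \<otimes> x \<otimes> inv c) ` fst ` set v = fst ` set v"
    by (simp add: fst_set_conj_word)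
  define Y where "Y = fst ` set v"
  have Y: "finite Y" "Y \<subseteq> X" "Y \<noteq> {}" "\<And>x. x \<in> Y \<Longrightarrow> c \<otimes> x \<otimes> inv c \<in> Y"
    using v unfolding Y_def over_def by (simp_all, metis imageI inv_set)
  have cG: "c \<in> carrier G"
    using m by simp
  have fixed: "c \<otimes> x = x \<otimes> c" if x: "x \<in> Y" for x
  proof -
    have xX: "x \<in> X" and xG: "x \<in> carrier G"
      using x Y by auto
    define f where "f = (\<lambda>n::nat. c [^] n \<otimes> x \<otimes> inv (c [^] n))"
    have "f n \<in> Y" for n
    proof (induction n)
      case (Suc n)
      have "f (Suc n) = c \<otimes> f n \<otimes> inv c"
        using cG xG nat_pow_Suc2[OF cG, of n] by (simp add: f_def inv_mult_group m_assoc del: nat_pow_Suc)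
      then show ?case
        using Y(4) Suc by simp
    qed (use x xG in \<open>simp add: f_def\<close>)
    then have "\<not> inj f"
      using Y(1) by (metis finite_subset finite_imageD image_subsetI infinite_UNIV_nat)
    then obtain i j where "i < j" "f i = f j"
      unfolding inj_def by (metis linorder_neqE_nat)
    then obtain d where d: "0 < d" "f i = f (i + d)"
      by (metis less_imp_add_positive)
    have "c [^] i \<otimes> x \<otimes> inv (c [^] i) = c [^] i \<otimes> (c [^] d \<otimes> x \<otimes> inv (c [^] d)) \<otimes> inv (c [^] i)"
      using d(2) cG xG by (simp add: f_def inv_mult_group m_assoc flip: nat_pow_mult)
    then have "x = c [^] d \<otimes> x \<otimes> inv (c [^] d)"
      using conj_inj[of "c [^] i" x "c [^] d \<otimes> x \<otimes> inv (c [^] d)"] cG xG by simp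
    then have cx: "c [^] d \<otimes> x = x \<otimes> c [^] d"
      using conj_eq_iff[of "c [^] d" x x] cG xG by simp
    have cc: "c [^] d \<otimes> c = c \<otimes> c [^] d"
      by (rule group_commutes_pow[OF HOL.refl cG cG])
    have "c [^] d \<otimes> (c \<otimes> x \<otimes> inv c) = (c \<otimes> x \<otimes> inv c) \<otimes> c [^] d"
    proof -
      have "inv c \<otimes> c [^] d \<otimes> c = c [^] d"
        using cG cc by (simp add: m_assoc)
      then show ?thesis
        using conj_commute_shift[of x "c [^] d" c] cG xG cx by simp
    qed
    moreover have "c [^] d \<in> K"
      using m(3) by (induction d) auto
    moreover have "c [^] d \<noteq> \<one>"
      using base m(3) c1 d(1) by (auto simp: CSA_torsion_free_on_def torsion_free_on_def)
    ultimately have "c \<otimes> x \<otimes> inv c = x"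
      using fixed_unique[of "c [^] d" "c \<otimes> x \<otimes> inv c" x] cx xX conj_X[OF m(3) xX] by simp
    then show ?thesis
      using conj_eq_iff[OF cG xG xG] by simp
  qed
  obtain a where a: "a \<in> Y"
    using Y(3) by blast
  have "Y \<subseteq> {a}"
    using fixed_unique[OF m(3) c1] fixed a Y(2) by blast
  then have "over {a} v"
    by (simp add: over_def Y_def)
  then show ?thesis
    using word_val_in_axis_group a Y(2) by blast
qed

lemma kernel_elliptic:
  assumes n: "n \<in> span" "proj n = \<one>" "n \<noteq> \<one>" and y: "y \<in> span" "y \<otimes> n = n \<otimes> y" "proj y \<noteq> \<one>"
  shows "elliptic n"
proof -
  obtain w where w: "over X w" "reduced w" "n = word_val w"
    using proj_eq_one[OF n(1,2)] .
  then obtain g v where v: "over X g" "over X v" "reduced (v @ v)" "v \<noteq> []"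
      "n = word_val g \<otimes> word_val v \<otimes> inv (word_val g)"
    using cyclic_reduction[of w] n(3) by (metis word_val_Nil)
  define h where "h = inv (word_val g)"
  have h: "h \<in> span" "proj h = \<one>"
    using v word_val_in_span by (simp_all add: h_def proj_inv)
  have hn: "h \<otimes> n \<otimes> inv h = word_val v"
    using v by (simp add: h_def m_assoc)
  have "(h \<otimes> y \<otimes> inv h) \<otimes> word_val v = word_val v \<otimes> (h \<otimes> y \<otimes> inv h)"
    using conj_commute_iff[of y n h] y n h by (simp add: hn)
  moreover have "proj (h \<otimes> y \<otimes> inv h) \<noteq> \<one>"
    using h y by (simp add: proj_mult proj_inv)
  ultimately obtain a where "a \<in> X" "word_val v \<in> axis_group a"
    using cyclically_reduced_axis[OF v(2-4), of "h \<otimes> y \<otimes> inv h"] h y by auto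
  then show ?thesis
    using h hn unfolding elliptic_def by metis
qed

lemma elliptic_commute:
  assumes "elliptic n" "n \<in> span" "n \<noteq> \<one>" "y \<in> span" "n \<otimes> y = y \<otimes> n"
  shows "elliptic y"
proof -
  obtain a h where a: "a \<in> X" "h \<in> span" "h \<otimes> n \<otimes> inv h \<in> axis_group a"
    using assms(1) by (auto simp: elliptic_def)
  have "h \<otimes> n \<otimes> inv h \<noteq> \<one>"
    using conj_eq_iff[of h n \<one>] a assms by auto
  moreover have "(h \<otimes> n \<otimes> inv h) \<otimes> (h \<otimes> y \<otimes> inv h) = (h \<otimes> y \<otimes> inv h) \<otimes> (h \<otimes> n \<otimes> inv h)"
    using conj_commute_iff[of n y h] a assms by simp
  ultimately have "h \<otimes> y \<otimes> inv h \<in> axis_group a"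
    using axis_group_malnormal[OF a(1,3) _ a(3), of "h \<otimes> y \<otimes> inv h"] a assms by simp
  then show ?thesis
    using a by (auto simp: elliptic_def)
qed

lemma nonelliptic_kernel_trivial:
  assumes "x \<in> span" "\<not> elliptic x" "proj x \<noteq> \<one>" "n \<in> span" "proj n = \<one>" "x \<otimes> n = n \<otimes> x"
  shows "n = \<one>"
  using kernel_elliptic[of n x] elliptic_commute[of n x] assms by auto

lemma commuting_with_cyclically_reduced:
  assumes "over X v" "reduced (v @ v)" "v \<noteq> []" "over X m" "reduced m"
    and "word_val v \<otimes> word_val m = word_val m \<otimes> word_val v"
  shows "v @ m = m @ v \<or> v @ winv m = winv m @ v"
proof -
  have "v @ m = m @ v \<or> winv v @ m = m @ winv v"
    using conjugate_cyclically_reduced[of v v m] assms by blast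
  moreover have "v @ winv m = winv m @ v" if "winv v @ m = m @ winv v"
    using arg_cong[OF that, of winv] by simp
  ultimately show ?thesis
    by blast
qed

lemma kernel_centralizer_abelian:
  assumes v: "over X v" "reduced (v @ v)" "v \<noteq> []"
    and m: "over X m" "reduced m" "word_val v \<otimes> word_val m = word_val m \<otimes> word_val v"
    and r: "over X r" "reduced r" "word_val v \<otimes> word_val r = word_val r \<otimes> word_val v"
  shows "word_val m \<otimes> word_val r = word_val r \<otimes> word_val m"
proof -
  have *: "\<exists>m'. over X m' \<and> v @ m' = m' @ v \<and> (word_val m = word_val m' \<or> word_val m = inv (word_val m'))"
    if "over X m" "reduced m" "word_val v \<otimes> word_val m = word_val m \<otimes> word_val v" for m
    using commuting_with_cyclically_reduced[OF v that]
  proof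
    assume "v @ winv m = winv m @ v"
    then show ?thesis
      using that by (intro exI[of _ "winv m"]) (simp add: word_val_winv)
  qed (use that in blast)
  obtain m' where m': "over X m'" "v @ m' = m' @ v" "word_val m = word_val m' \<or> word_val m = inv (word_val m')"
    using *[OF m] by blast
  obtain r' where r': "over X r'" "v @ r' = r' @ v" "word_val r = word_val r' \<or> word_val r = inv (word_val r')"
    using *[OF r] by blast
  have "m' @ r' = r' @ m'"
    using commuting_lists_trans[OF v(3) m'(2) r'(2)] .
  then have c: "word_val m' \<otimes> word_val r' = word_val r' \<otimes> word_val m'"
    using m' r' by (metis over_carrier word_val_append)
  have G: "word_val m' \<in> carrier G" "word_val r' \<in> carrier G"
    using m' r' by simp_all
  have c2: "inv (word_val m') \<otimes> word_val r' = word_val r' \<otimes> inv (word_val m')"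
    using commute_inv[OF G c] .
  have c3: "inv (word_val r') \<otimes> word_val m' = word_val m' \<otimes> inv (word_val r')"
    using commute_inv[OF G(2,1) c[symmetric]] .
  have c4: "inv (word_val m') \<otimes> inv (word_val r') = inv (word_val r') \<otimes> inv (word_val m')"
    using commute_inv[OF G(1) inv_closed[OF G(2)] c3[symmetric]] .
  show ?thesis
    using m'(3) r'(3) c c2 c3 c4 by auto
qed

subsection \<open>Inheritance of the torsion-free CSA property\<close>

lemma base_CT:
  "x \<in> K \<Longrightarrow> y \<in> K \<Longrightarrow> z \<in> K \<Longrightarrow> x \<noteq> \<one> \<Longrightarrow> x \<otimes> y = y \<otimes> x \<Longrightarrow> x \<otimes> z = z \<otimes> x \<Longrightarrow> y \<otimes> z = z \<otimes> y"
  and base_CS: "x \<in> K \<Longrightarrow> y \<in> K \<Longrightarrow> x \<noteq> \<one> \<Longrightarrow>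
    x \<otimes> (inv y \<otimes> x \<otimes> y) = (inv y \<otimes> x \<otimes> y) \<otimes> x \<Longrightarrow> x \<otimes> y = y \<otimes> x"
  and base_TF: "x \<in> K \<Longrightarrow> (n::nat) > 0 \<Longrightarrow> x [^] n = \<one> \<Longrightarrow> x = \<one>"
  using base unfolding CSA_torsion_free_on_def commutation_transitive_on_def
    conjugately_separated_on_def torsion_free_on_def by blast+

lemma kernel_conj_cyclically_reduced:
  assumes "x \<in> span" "proj x = \<one>" "x \<noteq> \<one>"
  obtains h v where "h \<in> span" "proj h = \<one>" "over X v" "reduced (v @ v)" "v \<noteq> []" "h \<otimes> x \<otimes> inv h = word_val v"
proof -
  obtain w where w: "over X w" "reduced w" "x = word_val w"
    using proj_eq_one[OF assms(1,2)] .
  then obtain g v where v: "over X g" "over X v" "reduced (v @ v)" "v \<noteq> []"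
      "x = word_val g \<otimes> word_val v \<otimes> inv (word_val g)"
    using cyclic_reduction[of w] assms(3) by (metis word_val_Nil)
  show ?thesis
    using that[of "inv (word_val g)" v] v word_val_in_span by (simp add: m_assoc proj_inv)
qed

lemma span_CT:
  assumes "x \<in> span" "y \<in> span" "z \<in> span" "x \<noteq> \<one>" "x \<otimes> y = y \<otimes> x" "x \<otimes> z = z \<otimes> x"
  shows "y \<otimes> z = z \<otimes> y"
proof -
  have G: "x \<in> carrier G" "y \<in> carrier G" "z \<in> carrier G"
    using assms by simp_all
  consider (elliptic) "elliptic x" | (kernel) "\<not> elliptic x" "proj x = \<one>" | (other) "\<not> elliptic x" "proj x \<noteq> \<one>"
    by blast
  then show ?thesis
  proof cases
    case elliptic
    then obtain a h where a: "a \<in> X" "h \<in> span" "h \<otimes> x \<otimes> inv h \<in> axis_group a"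
      by (auto simp: elliptic_def)
    have "h \<otimes> x \<otimes> inv h \<noteq> \<one>"
      using conj_eq_iff[of h x \<one>] a assms by auto
    then have "h \<otimes> u \<otimes> inv h \<in> axis_group a" if "u \<in> span" "x \<otimes> u = u \<otimes> x" for u
      using axis_group_malnormal[OF a(1,3) _ a(3), of "h \<otimes> u \<otimes> inv h"] a that
        conj_commute_iff[of x u h] G by simp
    then show ?thesis
      using axis_group_commute[OF a(1), of "h \<otimes> y \<otimes> inv h" "h \<otimes> z \<otimes> inv h"] assms
        conj_commute_iff[of y z h] a G by simp
  next
    case kernel
    have py: "proj y = \<one>" and pz: "proj z = \<one>"
      using kernel_elliptic[of x y] kernel_elliptic[of x z] kernel assms by auto
    obtain h v where h: "h \<in> span" "proj h = \<one>" and v: "over X v" "reduced (v @ v)" "v \<noteq> []"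
      and hx: "h \<otimes> x \<otimes> inv h = word_val v"
      using kernel_conj_cyclically_reduced[OF assms(1) kernel(2) assms(4)] .
    have "\<exists>m. over X m \<and> reduced m \<and> h \<otimes> u \<otimes> inv h = word_val m" if "u \<in> span" "proj u = \<one>" for u
      using proj_eq_one[of "h \<otimes> u \<otimes> inv h"] h that by (metis K_closed(3) inv_one l_one one_closed proj_inv
          proj_mult span_inv span_mult)
    then obtain m r where m: "over X m" "reduced m" "h \<otimes> y \<otimes> inv h = word_val m"
      and r: "over X r" "reduced r" "h \<otimes> z \<otimes> inv h = word_val r"
      using assms(2,3) py pz by metis
    have "word_val v \<otimes> word_val m = word_val m \<otimes> word_val v" "word_val v \<otimes> word_val r = word_val r \<otimes> word_val v"
      using conj_commute_iff[of x y h] conj_commute_iff[of x z h] G h assms by (simp_all flip: hx m(3) r(3))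
    then have "word_val m \<otimes> word_val r = word_val r \<otimes> word_val m"
      using kernel_centralizer_abelian[OF v m(1,2) _ r(1,2)] by blast
    then show ?thesis
      using conj_commute_iff[of y z h] G h by (simp flip: m(3) r(3))
  next
    case other
    define c where "c = (y \<otimes> z) \<otimes> inv (z \<otimes> y)"
    have c: "c \<in> span"
      using assms by (simp add: c_def)
    have pr: "proj x \<otimes> proj y = proj y \<otimes> proj x" "proj x \<otimes> proj z = proj z \<otimes> proj x"
      using proj_mult assms by metis+
    have "proj y \<otimes> proj z = proj z \<otimes> proj y"
      using base_CT[of "proj x" "proj y" "proj z"] other pr assms by simp
    then have "proj c = \<one>"
      using assms by (simp add: c_def proj_mult proj_inv)
    moreover have "x \<otimes> c = c \<otimes> x"
    proof -
      have 1: "(y \<otimes> z) \<otimes> x = x \<otimes> (y \<otimes> z)" "(z \<otimes> y) \<otimes> x = x \<otimes> (z \<otimes> y)"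
        using commute_mult[of y z x] commute_mult[of z y x] G assms by simp_all
      then show ?thesis
        unfolding c_def using commute_mult[of "y \<otimes> z" "inv (z \<otimes> y)" x] commute_inv[of "z \<otimes> y" x] G
        by simp
    qed
    ultimately have "c = \<one>"
      using nonelliptic_kernel_trivial[of x c] other assms c by simp
    then show ?thesis
      using G by (metis c_def inv_equality inv_inv m_closed inv_closed)
  qed
qed

lemma span_TF:
  assumes "x \<in> span" "(n::nat) > 0" "x [^] n = \<one>"
  shows "x = \<one>"
proof (rule ccontr)
  assume x1: "x \<noteq> \<one>"
  have "proj x = \<one>"
    using base_TF[of "proj x" n] proj_pow[OF assms(1), of n] assms by simp
  then obtain h v where h: "h \<in> span" and v: "over X v" "reduced (v @ v)" "v \<noteq> []"
      and hx: "h \<otimes> x \<otimes> inv h = word_val v"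
    using kernel_conj_cyclically_reduced[OF assms(1) _ x1] by metis
  have G: "x \<in> carrier G" "h \<in> carrier G"
    using assms h by simp_all
  define V where "V = (\<lambda>n. concat (replicate n v))"
  have V: "over X (V n) \<and> reduced (V n) \<and> (n > 0 \<longrightarrow> hd (V n) = hd v \<and> V n \<noteq> []) \<and>
      word_val (V n) = h \<otimes> x [^] n \<otimes> inv h" for n
  proof (induction n)
    case (Suc n)
    have "word_val (V (Suc n)) = (h \<otimes> x \<otimes> inv h) \<otimes> (h \<otimes> x [^] n \<otimes> inv h)"
      using Suc v by (simp add: V_def word_val_append hx)
    also have "\<dots> = h \<otimes> (x \<otimes> x [^] n) \<otimes> inv h"
      using G by (simp add: m_assoc)
    also have "\<dots> = h \<otimes> x [^] Suc n \<otimes> inv h"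
      using nat_pow_Suc2[OF G(1), of n] by (simp only:)
    finally have "word_val (V (Suc n)) = h \<otimes> x [^] Suc n \<otimes> inv h" .
    moreover have "over X (V (Suc n)) \<and> hd (V (Suc n)) = hd v \<and> V (Suc n) \<noteq> []"
      using Suc v by (simp add: V_def)
    moreover have "reduced (V (Suc n))"
      using Suc v by (cases "n = 0") (auto simp: V_def successively_append_iff)
    ultimately show ?case
      by blast
  qed (use G in \<open>simp add: V_def\<close>)
  have "word_val (V n) = \<one>"
    using V[of n] assms(3) G by simp
  then show False
    using V[of n] free[of "V n"] assms(2) by simp
qed

lemma span_CS:
  assumes "x \<in> span" "y \<in> span" "x \<noteq> \<one>" "x \<otimes> (inv y \<otimes> x \<otimes> y) = (inv y \<otimes> x \<otimes> y) \<otimes> x"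
  shows "x \<otimes> y = y \<otimes> x"
proof -
  have G: "x \<in> carrier G" "y \<in> carrier G"
    using assms by simp_all
  define u where "u = inv y \<otimes> x \<otimes> y"
  have u: "u \<in> span" "u \<in> carrier G" "x \<otimes> u = u \<otimes> x" "x \<otimes> y = y \<otimes> u"
    using assms by (simp_all add: u_def m_assoc)
  have u1: "u \<noteq> \<one>"
    using u(4) G assms(3) by auto
  consider (elliptic) "elliptic x" | (kernel) "\<not> elliptic x" "proj x = \<one>" | (other) "\<not> elliptic x" "proj x \<noteq> \<one>"
    by blast
  then show ?thesis
  proof cases
    case elliptic
    then obtain a h where a: "a \<in> X" "h \<in> span" "h \<otimes> x \<otimes> inv h \<in> axis_group a"
      by (auto simp: elliptic_def)
    have x1: "h \<otimes> x \<otimes> inv h \<noteq> \<one>"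
      using conj_eq_iff[of h x \<one>] a assms by auto
    have "h \<otimes> u \<otimes> inv h \<in> axis_group a"
      using axis_group_malnormal[OF a(1,3) x1 a(3), of "h \<otimes> u \<otimes> inv h"] a u
        conj_commute_iff[of x u h] G by simp
    moreover have "(h \<otimes> x \<otimes> inv h) \<otimes> (h \<otimes> y \<otimes> inv h) = (h \<otimes> y \<otimes> inv h) \<otimes> (h \<otimes> u \<otimes> inv h)"
    proof -
      have "(h \<otimes> x \<otimes> inv h) \<otimes> (h \<otimes> y \<otimes> inv h) = h \<otimes> (x \<otimes> y) \<otimes> inv h"
        using G a by (simp add: m_assoc)
      also have "\<dots> = h \<otimes> (y \<otimes> u) \<otimes> inv h"
        by (simp only: u(4))
      also have "\<dots> = (h \<otimes> y \<otimes> inv h) \<otimes> (h \<otimes> u \<otimes> inv h)"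
        using G a u by (simp add: m_assoc)
      finally show ?thesis .
    qed
    ultimately have "h \<otimes> y \<otimes> inv h \<in> axis_group a"
      using axis_group_malnormal[OF a(1,3) x1, of "h \<otimes> u \<otimes> inv h" "h \<otimes> y \<otimes> inv h"] a assms by simp
    then show ?thesis
      using axis_group_commute[OF a(1,3)] conj_commute_iff[of x y h] a G by simp
  next
    case other
    have "proj x \<otimes> (inv (proj y) \<otimes> proj x \<otimes> proj y) = (inv (proj y) \<otimes> proj x \<otimes> proj y) \<otimes> proj x"
    proof -
      have "proj (x \<otimes> u) = proj (u \<otimes> x)"
        by (simp only: u(3))
      then show ?thesis
        unfolding u_def using assms(1,2) by (simp add: proj_mult proj_inv)
    qed
    then have c: "proj x \<otimes> proj y = proj y \<otimes> proj x"
      using base_CS[of "proj x" "proj y"] other assms by simp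
    have pu: "proj u = proj x"
    proof -
      have "proj u = inv (proj y) \<otimes> (proj x \<otimes> proj y)"
        using assms by (simp add: u_def proj_mult proj_inv m_assoc)
      also have "\<dots> = proj x"
        using assms by (simp add: c)
      finally show ?thesis .
    qed
    have "x \<otimes> (inv x \<otimes> u) = (inv x \<otimes> u) \<otimes> x"
      using u G by (simp add: m_assoc flip: u(3))
    then have "inv x \<otimes> u = \<one>"
      using nonelliptic_kernel_trivial[of x "inv x \<otimes> u"] other assms u pu
      by (simp add: proj_mult proj_inv)
    then have "u = x"
      using G u by (metis inv_cancel_left(2) r_one)
    then show ?thesis
      using u by simp
  next
    case kernel
    obtain h v where h: "h \<in> span" "proj h = \<one>" and v: "over X v" "reduced (v @ v)" "v \<noteq> []"
      and hx: "h \<otimes> x \<otimes> inv h = word_val v"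
      using kernel_conj_cyclically_reduced[OF assms(1) kernel(2) assms(3)] .
    have hG: "h \<in> carrier G"
      using h by simp
    define y' u' where "y' = h \<otimes> y \<otimes> inv h" and "u' = h \<otimes> u \<otimes> inv h"
    have y': "y' \<in> span" "y' \<in> carrier G"
      using h assms by (simp_all add: y'_def)
    have xy: "word_val v \<otimes> y' = y' \<otimes> u'"
    proof -
      have "(h \<otimes> x \<otimes> inv h) \<otimes> (h \<otimes> y \<otimes> inv h) = h \<otimes> (x \<otimes> y) \<otimes> inv h"
        using G hG by (simp add: m_assoc)
      also have "\<dots> = h \<otimes> (y \<otimes> u) \<otimes> inv h"
        by (simp only: u(4))
      also have "\<dots> = (h \<otimes> y \<otimes> inv h) \<otimes> (h \<otimes> u \<otimes> inv h)"
        using G hG u by (simp add: m_assoc)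
      finally show ?thesis
        by (simp only: hx y'_def u'_def)
    qed
    have "proj u = \<one>"
      using assms kernel by (simp add: u_def proj_mult proj_inv)
    then have "proj u' = \<one>" "u' \<in> span"
      using h u by (simp_all add: u'_def proj_mult proj_inv)
    then obtain m where m: "over X m" "reduced m" "u' = word_val m"
      using proj_eq_one by metis
    have "u' \<noteq> \<one>"
      using u1 conj_eq_iff[of h u \<one>] hG u by (auto simp: u'_def)
    then have m0: "m \<noteq> []"
      using m by auto
    have vm: "word_val v \<otimes> word_val m = word_val m \<otimes> word_val v"
      using conj_commute_iff[of x u h] u G hG by (simp add: u'_def flip: hx m(3))
    obtain s c where s: "over X s" "reduced s" "c \<in> K" "inv y' = word_val s \<otimes> c"
      using spanE[of "inv y'"] y' by auto
    have cv: "over X (conj_word c v)" "reduced (conj_word c v @ conj_word c v)" "conj_word c v \<noteq> []"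
      using v s by (simp_all add: over_X_conj_word reduced_conj_word flip: conj_word_append)
    have "(word_val m \<otimes> word_val s) \<otimes> c = u' \<otimes> inv y'"
      using m s by (simp add: m_assoc)
    also have "\<dots> = inv y' \<otimes> (y' \<otimes> u') \<otimes> inv y'"
      using m y' by simp
    also have "\<dots> = inv y' \<otimes> word_val v"
      using v y' by (simp add: m_assoc flip: xy)
    also have "\<dots> = word_val s \<otimes> (c \<otimes> word_val v)"
      using s v by (simp add: m_assoc)
    also have "\<dots> = (word_val s \<otimes> word_val (conj_word c v)) \<otimes> c"
      using s v cv by (simp add: move_left m_assoc)
    finally have ms: "word_val m \<otimes> word_val s = word_val s \<otimes> word_val (conj_word c v)"
      using m s cv by simp
    have same: "v @ m = m @ v \<or> winv v @ m = m @ winv v"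
      using conjugate_cyclically_reduced[OF v v m(1,2) vm] .
    have cyc: "reduced (m @ m)" if "p @ m = m @ p" "reduced (p @ p)" "p \<noteq> []" for p
    proof -
      have "hd m = hd p" "last m = last p"
        using that m0 by (metis hd_append2, metis last_appendR)
      then show ?thesis
        using that m m0 by (auto simp: successively_append_iff)
    qed
    have "reduced (winv v @ winv v)"
      using v(2) reduced_winv[of "v @ v"] by simp
    then have mm: "reduced (m @ m)"
      using same cyc[of v] cyc[of "winv v"] v by auto
    have "m @ s = s @ conj_word c v \<or> winv m @ s = s @ winv (conj_word c v)"
      using conjugate_cyclically_reduced[OF m(1) mm m0 cv s(1,2) ms] .
    then have "length m + length s = length s + length v"
      by (metis length_append length_conj_word length_winv)
    then have "v = m \<or> winv v = m"
      using same by auto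
    then show ?thesis
    proof
      assume "v = m"
      then have "(h \<otimes> x \<otimes> inv h) \<otimes> (h \<otimes> y \<otimes> inv h) = (h \<otimes> y \<otimes> inv h) \<otimes> (h \<otimes> x \<otimes> inv h)"
        using xy m by (simp add: y'_def hx)
      then show ?thesis
        using conj_commute_iff[of x y h] G hG by simp
    next
      assume "winv v = m"
      then have inverted: "word_val v \<otimes> y' = y' \<otimes> inv (word_val v)"
        using xy m v by (auto simp: word_val_winv)
      have vG: "word_val v \<in> carrier G"
        using v by simp
      have inverted': "inv (word_val v) \<otimes> y' = y' \<otimes> word_val v"
      proof -
        have "inv (word_val v) \<otimes> y' = inv (word_val v) \<otimes> (y' \<otimes> inv (word_val v)) \<otimes> word_val v"
          using vG y' by (simp add: m_assoc)
        also have "\<dots> = y' \<otimes> word_val v"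
          using vG y' by (simp flip: inverted)
        finally show ?thesis .
      qed
      have sq: "(y' \<otimes> y') \<otimes> word_val v = word_val v \<otimes> (y' \<otimes> y')"
      proof -
        have "word_val v \<otimes> (y' \<otimes> y') = (word_val v \<otimes> y') \<otimes> y'"
          using vG y' by (simp add: m_assoc)
        also have "\<dots> = y' \<otimes> (inv (word_val v) \<otimes> y')"
          using vG y' by (simp add: inverted m_assoc)
        also have "\<dots> = (y' \<otimes> y') \<otimes> word_val v"
          using vG y' by (simp add: inverted' m_assoc)
        finally show ?thesis
          by simp
      qed
      have "word_val v \<otimes> y' = y' \<otimes> word_val v"
      proof (cases "y' \<otimes> y' = \<one>")
        case True
        then have "y' [^] (2::nat) = \<one>"
          using y' by (simp add: numeral_2_eq_2)
        then have "y' = \<one>"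
          using span_TF[OF y'(1), of 2] by simp
        then show ?thesis
          using vG by simp
      next
        case False
        then show ?thesis
          using span_CT[of "y' \<otimes> y'" "word_val v" y'] y' v word_val_in_span sq by (simp add: m_assoc)
      qed
      then show ?thesis
        using conj_commute_iff[of x y h] G hG by (simp add: y'_def flip: hx)
    qed
  qed
qed

theorem CSA_torsion_free_span: "CSA_torsion_free_on G span"
  unfolding CSA_torsion_free_on_def commutation_transitive_on_def conjugately_separated_on_def
    torsion_free_on_def
  using span_CT span_CS span_TF by blast

end

section \<open>Relative presentations\<close>

locale relative_presentation = group K for K :: "'k monoid" (structure) +
  fixes T :: "'t set" and R :: "('k, 't) letter list set"
begin

abbreviation "words \<equiv> rel_words K T"
abbreviation "cong \<equiv> rel_congruence K T R"
abbreviation "cls \<equiv> rel_class K T R"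
abbreviation "P \<equiv> rel_presentation K T R"

lemma words_append [simp]: "u @ v \<in> words \<longleftrightarrow> u \<in> words \<and> v \<in> words"
  and words_Nil [simp]: "[] \<in> words"
  and words_Base [simp]: "Base k # w \<in> words \<longleftrightarrow> k \<in> carrier K \<and> w \<in> words"
  and words_Stable [simp]: "Stable t # w \<in> words \<longleftrightarrow> t \<in> T \<and> w \<in> words"
  and words_Stable_inv [simp]: "Stable_inv t # w \<in> words \<longleftrightarrow> t \<in> T \<and> w \<in> words"
  by (auto simp: rel_words_def)

lemma cong_words: "(v, w) \<in> cong \<Longrightarrow> v \<in> words \<and> w \<in> words"
  by (induction rule: rel_congruence.induct) auto

lemma equiv_cong: "equiv words cong"
  using cong_words
  by (intro equivI refl_onI symI transI) (auto intro: rel_congruence.intros)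

lemma cong_append:
  assumes "(v, v') \<in> cong" "(w, w') \<in> cong"
  shows "(v @ w, v' @ w') \<in> cong"
proof -
  have "([] @ v @ w, [] @ v' @ w) \<in> cong"
    using assms cong_words by (intro rel_congruence.congr) auto
  moreover have "(v' @ w @ [], v' @ w' @ []) \<in> cong"
    using assms cong_words by (intro rel_congruence.congr) auto
  ultimately show ?thesis
    by (auto intro: rel_congruence.trans)
qed

lemma cls_eq_iff: "v \<in> words \<Longrightarrow> w \<in> words \<Longrightarrow> cls v = cls w \<longleftrightarrow> (v, w) \<in> cong"
  unfolding rel_class_def using eq_equiv_class_iff[OF equiv_cong] .

lemma cls_eqI: "(v, w) \<in> cong \<Longrightarrow> cls v = cls w"
  using cls_eq_iff cong_words by blast

lemma carrier_P: "carrier P = cls ` words"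
  by (auto simp: rel_presentation_def quotient_def rel_class_def)

lemma cls_in_P [simp]: "w \<in> words \<Longrightarrow> cls w \<in> carrier P"
  by (simp add: carrier_P)

lemma one_P: "\<one>\<^bsub>P\<^esub> = cls []"
  by (simp add: rel_presentation_def)

lemma mult_P [simp]:
  assumes "v \<in> words" "w \<in> words"
  shows "cls v \<otimes>\<^bsub>P\<^esub> cls w = cls (v @ w)"
proof -
  have "cls (v' @ w') = cls (v @ w)" if "v' \<in> cls v" "w' \<in> cls w" for v' w'
  proof -
    have "(v @ w, v' @ w') \<in> cong"
      using that by (intro cong_append) (auto simp: rel_class_def)
    then show ?thesis
      using cls_eqI by blast
  qed
  then have "(\<Union>v'\<in>cls v. \<Union>w'\<in>cls w. cls (v' @ w')) = (\<Union>v'\<in>cls v. \<Union>w'\<in>cls w. cls (v @ w))"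
    by simp
  moreover have "v \<in> cls v" "w \<in> cls w"
    using assms by (auto simp: rel_class_def intro: rel_congruence.refl)
  then have "(\<Union>v'\<in>cls v. \<Union>w'\<in>cls w. cls (v @ w)) = cls (v @ w)"
    by blast
  ultimately show ?thesis
    by (simp add: rel_presentation_def)
qed

lemma P_cases:
  assumes "p \<in> carrier P"
  obtains w where "w \<in> words" "p = cls w"
  using assms by (auto simp: carrier_P)

lemma letter_inverse:
  assumes "[l] \<in> words"
  shows "\<exists>l'. [l'] \<in> words \<and> ([l', l], []) \<in> cong"
proof (cases l)
  case (Base k)
  then have "([Base (inv k), Base k], [Base (inv k \<otimes> k)]) \<in> cong"
    using assms by (intro rel_congruence.base_mult) auto
  then have "([Base (inv k), l], []) \<in> cong"
    using assms Base by (auto intro: rel_congruence.trans rel_congruence.base_one)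
  then show ?thesis
    using assms Base by (intro exI[of _ "Base (inv k)"]) auto
next
  case (Stable t)
  then show ?thesis
    using assms rel_congruence.cancel_left[of t T K R] by (intro exI[of _ "Stable_inv t"]) auto
next
  case (Stable_inv t)
  then show ?thesis
    using assms rel_congruence.cancel_right[of t T K R] by (intro exI[of _ "Stable t"]) auto
qed

lemma word_inverse:
  assumes "w \<in> words"
  shows "\<exists>w'\<in>words. (w' @ w, []) \<in> cong"
  using assms
proof (induction w)
  case Nil
  then show ?case
    by (auto intro!: bexI[of _ "[]"] rel_congruence.refl)
next
  case (Cons l w)
  then have lw: "[l] \<in> words" "w \<in> words"
    using words_append[of "[l]" w] by simp_all
  then obtain w' l' where w': "w' \<in> words" "(w' @ w, []) \<in> cong"
    and l': "[l'] \<in> words" "([l', l], []) \<in> cong"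
    using Cons.IH letter_inverse by blast
  have "(w' @ [l', l] @ w, w' @ [] @ w) \<in> cong"
    using w' l' lw by (intro rel_congruence.congr) auto
  then have "((w' @ [l']) @ l # w, []) \<in> cong"
    using w' by (auto intro: rel_congruence.trans)
  then show ?case
    using w' l' by (intro bexI[of _ "w' @ [l']"]) auto
qed

lemma group_P: "group P"
proof (rule groupI)
  fix x y z
  assume "x \<in> carrier P" "y \<in> carrier P" "z \<in> carrier P"
  then show "(x \<otimes>\<^bsub>P\<^esub> y) \<otimes>\<^bsub>P\<^esub> z = x \<otimes>\<^bsub>P\<^esub> (y \<otimes>\<^bsub>P\<^esub> z)"
    by (auto elim!: P_cases)
next
  fix x
  assume "x \<in> carrier P"
  then obtain w where w: "w \<in> words" "x = cls w"
    by (auto elim: P_cases)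
  then obtain w' where "w' \<in> words" "(w' @ w, []) \<in> cong"
    using word_inverse by blast
  then show "\<exists>y\<in>carrier P. y \<otimes>\<^bsub>P\<^esub> x = \<one>\<^bsub>P\<^esub>"
    using w cls_eqI by (intro bexI[of _ "cls w'"]) (auto simp: one_P)
qed (auto elim!: P_cases simp: one_P)

lemma base_hom: "(\<lambda>k. cls [Base k]) \<in> hom K P"
proof (rule homI)
  fix k l
  assume "k \<in> carrier K" "l \<in> carrier K"
  then show "cls [Base (k \<otimes> l)] = cls [Base k] \<otimes>\<^bsub>P\<^esub> cls [Base l]"
    using cls_eqI[OF rel_congruence.base_mult[of k K l T R]] by simp
qed simp

lemma stable_inverse: "t \<in> T \<Longrightarrow> inv\<^bsub>P\<^esub> (cls [Stable t]) = cls [Stable_inv t]"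
  by (rule group.inv_equality[OF group_P])
    (auto simp: one_P intro!: cls_eqI rel_congruence.cancel_left)

lemma stable_commute:
  assumes "c \<in> carrier K" "t \<in> T" "[Base (inv c), Stable_inv t, Base c, Stable t] \<in> R"
  shows "cls [Base c] \<otimes>\<^bsub>P\<^esub> cls [Stable t] = cls [Stable t] \<otimes>\<^bsub>P\<^esub> cls [Base c]"
proof -
  interpret P: group P
    by (rule group_P)
  let ?c = "cls [Base c]" and ?t = "cls [Stable t]"
  have G: "?c \<in> carrier P" "?t \<in> carrier P"
    using assms by simp_all
  have inv_c: "cls [Base (inv c)] = inv\<^bsub>P\<^esub> ?c"
    using group_hom.hom_inv[of K P "\<lambda>k. cls [Base k]" c] base_hom group_P assms(1)
    by (simp add: group_hom_def group_hom_axioms_def)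
  have "cls [Base (inv c), Stable_inv t, Base c, Stable t] = cls []"
    using assms by (intro cls_eqI rel_congruence.relator) auto
  also have "cls [Base (inv c), Stable_inv t, Base c, Stable t] =
      inv\<^bsub>P\<^esub> ?c \<otimes>\<^bsub>P\<^esub> (inv\<^bsub>P\<^esub> ?t \<otimes>\<^bsub>P\<^esub> (?c \<otimes>\<^bsub>P\<^esub> ?t))"
    using assms by (simp flip: inv_c add: stable_inverse)
  finally have "?c \<otimes>\<^bsub>P\<^esub> (inv\<^bsub>P\<^esub> ?c \<otimes>\<^bsub>P\<^esub> (inv\<^bsub>P\<^esub> ?t \<otimes>\<^bsub>P\<^esub> (?c \<otimes>\<^bsub>P\<^esub> ?t))) = ?c \<otimes>\<^bsub>P\<^esub> \<one>\<^bsub>P\<^esub>"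
    by (simp only: one_P)
  then have "inv\<^bsub>P\<^esub> ?t \<otimes>\<^bsub>P\<^esub> (?c \<otimes>\<^bsub>P\<^esub> ?t) = ?c"
    using G by (simp del: mult_P)
  then have "?t \<otimes>\<^bsub>P\<^esub> (inv\<^bsub>P\<^esub> ?t \<otimes>\<^bsub>P\<^esub> (?c \<otimes>\<^bsub>P\<^esub> ?t)) = ?t \<otimes>\<^bsub>P\<^esub> ?c"
    by (simp only:)
  then show ?thesis
    using G by (simp del: mult_P)
qed

lemma hom_P_eqI:
  assumes "group M" "f \<in> hom P M" "g \<in> hom P M"
    and "\<And>k. k \<in> carrier K \<Longrightarrow> f (cls [Base k]) = g (cls [Base k])"
    and "\<And>t. t \<in> T \<Longrightarrow> f (cls [Stable t]) = g (cls [Stable t])"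
    and "p \<in> carrier P"
  shows "f p = g p"
proof -
  interpret f: group_hom P M f
    using assms group_P by (simp add: group_hom_def group_hom_axioms_def)
  interpret g: group_hom P M g
    using assms group_P by (simp add: group_hom_def group_hom_axioms_def)
  have letter: "f (cls [l]) = g (cls [l])" if "[l] \<in> words" for l
  proof (cases l)
    case (Stable_inv t)
    then have t: "t \<in> T"
      using that by simp
    have "f (inv\<^bsub>P\<^esub> cls [Stable t]) = g (inv\<^bsub>P\<^esub> cls [Stable t])"
      using t assms(5) by simp
    then show ?thesis
      using Stable_inv t by (simp add: stable_inverse)
  qed (use that assms in auto)
  have "f (cls w) = g (cls w)" if "w \<in> words" for w
    using that
  proof (induction w)
    case Nil
    then show ?case
      by (metis f.hom_one g.hom_one one_P)
  next
    case (Cons l w)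
    then have "[l] \<in> words" "w \<in> words"
      using words_append[of "[l]" w] by simp_all
    then show ?case
      using Cons letter f.hom_mult[of "cls [l]" "cls w"] g.hom_mult[of "cls [l]" "cls w"] by simp
  qed
  then show ?thesis
    using assms(6) by (auto elim!: P_cases)
qed

end

definition letter_eval :: "('m, 'z) monoid_scheme \<Rightarrow> ('k \<Rightarrow> 'm) \<Rightarrow> ('t \<Rightarrow> 'm) \<Rightarrow> ('k, 't) letter \<Rightarrow> 'm" where
  "letter_eval M \<phi> \<sigma> l = (case l of Base k \<Rightarrow> \<phi> k | Stable t \<Rightarrow> \<sigma> t | Stable_inv t \<Rightarrow> inv\<^bsub>M\<^esub> (\<sigma> t))"

definition word_eval :: "('m, 'z) monoid_scheme \<Rightarrow> ('k \<Rightarrow> 'm) \<Rightarrow> ('t \<Rightarrow> 'm) \<Rightarrow> ('k, 't) letter list \<Rightarrow> 'm" where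
  "word_eval M \<phi> \<sigma> w = foldr (\<lambda>l g. letter_eval M \<phi> \<sigma> l \<otimes>\<^bsub>M\<^esub> g) w \<one>\<^bsub>M\<^esub>"

locale presentation_eval = relative_presentation K T R + M: group M
  for K :: "'k monoid" (structure) and T :: "'t set" and R and M :: "('m, 'z) monoid_scheme" +
  fixes \<phi> :: "'k \<Rightarrow> 'm" and \<sigma> :: "'t \<Rightarrow> 'm"
  assumes phi: "\<phi> \<in> hom K M" and sigma: "t \<in> T \<Longrightarrow> \<sigma> t \<in> carrier M"
    and relators: "r \<in> R \<Longrightarrow> r \<in> words \<Longrightarrow> word_eval M \<phi> \<sigma> r = \<one>\<^bsub>M\<^esub>"
begin

abbreviation "eval \<equiv> word_eval M \<phi> \<sigma>"

lemma eval_Nil [simp]: "eval [] = \<one>\<^bsub>M\<^esub>"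
  and eval_Cons [simp]: "eval (l # w) = letter_eval M \<phi> \<sigma> l \<otimes>\<^bsub>M\<^esub> eval w"
  by (simp_all add: word_eval_def)

lemma letter_eval_simps [simp]: "letter_eval M \<phi> \<sigma> (Base k) = \<phi> k"
  "letter_eval M \<phi> \<sigma> (Stable t) = \<sigma> t" "letter_eval M \<phi> \<sigma> (Stable_inv t) = inv\<^bsub>M\<^esub> (\<sigma> t)"
  by (simp_all add: letter_eval_def)

lemma phi_closed [simp]: "k \<in> carrier K \<Longrightarrow> \<phi> k \<in> carrier M"
  using phi by (rule hom_in_carrier)

lemma letter_eval_closed: "[l] \<in> words \<Longrightarrow> letter_eval M \<phi> \<sigma> l \<in> carrier M"
  by (cases l) (auto simp: sigma)

lemma eval_closed [simp]: "w \<in> words \<Longrightarrow> eval w \<in> carrier M"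
proof (induction w)
  case (Cons l w)
  then show ?case
    using letter_eval_closed[of l] words_append[of "[l]" w] by simp
qed simp

lemma eval_append: "u \<in> words \<Longrightarrow> v \<in> words \<Longrightarrow> eval (u @ v) = eval u \<otimes>\<^bsub>M\<^esub> eval v"
proof (induction u)
  case (Cons l u)
  then show ?case
    using letter_eval_closed[of l] words_append[of "[l]" u] by (simp add: M.m_assoc)
qed simp

lemma phi_one: "\<phi> \<one> = \<one>\<^bsub>M\<^esub>"
  using hom_one[OF phi] M.is_group is_group by simp

lemma eval_cong: "(v, w) \<in> cong \<Longrightarrow> eval v = eval w"
proof (induction rule: rel_congruence.induct)
  case (congr v w x y)
  then show ?case
    using cong_words by (simp add: eval_append)
next
  case (base_mult a b)
  then show ?case
    using phi by (simp add: hom_mult)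
qed (use relators phi_one in \<open>auto simp: sigma\<close>)

definition lift :: "('k, 't) letter list set \<Rightarrow> 'm" where
  "lift X = eval (SOME w. w \<in> words \<and> cls w = X)"

lemma lift_cls: 
  assumes "w \<in> words"
  shows "lift (cls w) = eval w"
proof -
  define v where "v = (SOME v. v \<in> words \<and> cls v = cls w)"
  have "v \<in> words \<and> cls v = cls w"
    unfolding v_def by (rule someI[of _ w]) (simp add: assms)
  then have "(v, w) \<in> cong"
    using cls_eq_iff assms by blast
  then show ?thesis
    unfolding lift_def v_def[symmetric] by (rule eval_cong)
qed

lemma lift_hom: "lift \<in> hom P M"
  by (rule homI) (auto elim!: P_cases simp: lift_cls eval_append)

lemma lift_base: "k \<in> carrier K \<Longrightarrow> lift (cls [Base k]) = \<phi> k"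
  and lift_stable: "t \<in> T \<Longrightarrow> lift (cls [Stable t]) = \<sigma> t"
  by (simp_all add: lift_cls sigma)

end

subsection \<open>The action on reduced words\<close>

text \<open>The points are translates \<open>k S\<^sub>t\<close>. The letter \<open>t\<close> acts on reduced words over the points by
  multiplication with the point \<open>S\<^sub>t\<close>, and the base group acts by translation of points. This
  separates the normal forms of a presentation in which only elements of \<open>S\<^sub>t\<close> commute with \<open>t\<close>.\<close>

locale commuting_presentation = relative_presentation K T R
  for K :: "'k monoid" (structure) and T :: "'t set" and R +
  fixes S :: "'t \<Rightarrow> 'k set"
  assumes subgroup_S: "t \<in> T \<Longrightarrow> subgroup (S t) K"
    and R_commute: "r \<in> R \<Longrightarrow> r \<in> words \<Longrightarrow>
      \<exists>t\<in>T. \<exists>c\<in>S t. r = [Base (inv c), Stable_inv t, Base c, Stable t]"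
begin

definition translate :: "'k \<Rightarrow> ('t \<times> 'k set) word \<Rightarrow> ('t \<times> 'k set) word" where
  "translate k = map (\<lambda>((t, Y), e). ((t, k <#\<^bsub>K\<^esub> Y), e))"

fun act :: "('k, 't) letter \<Rightarrow> ('t \<times> 'k set) word \<Rightarrow> ('t \<times> 'k set) word" where
  "act (Base k) w = translate k w"
| "act (Stable t) w = red_cons ((t, S t), True) w"
| "act (Stable_inv t) w = red_cons ((t, S t), False) w"

abbreviation "points \<equiv> UNIV \<times> Pow (carrier K)"

definition states :: "('t \<times> 'k set) word set" where
  "states = {w. over points w \<and> reduced w}"

lemma translate_Nil [simp]: "translate k [] = []"
  and translate_Cons [simp]: "translate k (a # w) = ((fst (fst a), k <#\<^bsub>K\<^esub> snd (fst a)), snd a) # translate k w"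
  by (auto simp: translate_def split: prod.split)

lemma lcos_inj: "k \<in> carrier K \<Longrightarrow> Y \<subseteq> carrier K \<Longrightarrow> Z \<subseteq> carrier K \<Longrightarrow> k <#\<^bsub>K\<^esub> Y = k <#\<^bsub>K\<^esub> Z \<longleftrightarrow> Y = Z"
  by (metis lcos_m_assoc lcos_mult_one l_inv inv_closed)

lemma translate_comp:
  "k \<in> carrier K \<Longrightarrow> l \<in> carrier K \<Longrightarrow> over points w \<Longrightarrow> translate k (translate l w) = translate (k \<otimes> l) w"
  by (induction w) (auto simp: lcos_m_assoc)

lemma translate_one: "over points w \<Longrightarrow> translate \<one> w = w"
  by (induction w) (auto simp: lcos_mult_one)

lemma over_translate: "k \<in> carrier K \<Longrightarrow> over points w \<Longrightarrow> over points (translate k w)"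
proof (induction w)
  case (Cons a w)
  then show ?case
    using l_coset_subset_G[of "snd (fst a)" k] by (cases a) auto
qed simp

lemma reduced_translate: "k \<in> carrier K \<Longrightarrow> over points w \<Longrightarrow> reduced (translate k w) \<longleftrightarrow> reduced w"
proof (induction w)
  case (Cons a w)
  then show ?case
    by (cases w) (auto simp: linv_def prod_eq_iff lcos_inj)
qed simp

lemma translate_red_cons:
  "k \<in> carrier K \<Longrightarrow> over points (a # w) \<Longrightarrow>
    translate k (red_cons a w) = red_cons ((fst (fst a), k <#\<^bsub>K\<^esub> snd (fst a)), snd a) (translate k w)"
  by (cases w) (auto simp: linv_def prod_eq_iff lcos_inj)

lemma S_subset: "t \<in> T \<Longrightarrow> S t \<subseteq> carrier K"
  using subgroup.subset[OF subgroup_S] .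

lemma act_states: "[l] \<in> words \<Longrightarrow> w \<in> states \<Longrightarrow> act l w \<in> states"
  using S_subset
  by (cases l) (auto simp: states_def over_translate reduced_translate over_red_cons reduced_red_cons)

lemma foldr_act_states: "v \<in> words \<Longrightarrow> w \<in> states \<Longrightarrow> foldr act v w \<in> states"
proof (induction v)
  case (Cons l v)
  then show ?case
    using words_append[of "[l]" v] by (simp add: act_states)
qed simp

lemma lcos_S: "t \<in> T \<Longrightarrow> c \<in> S t \<Longrightarrow> c <#\<^bsub>K\<^esub> S t = S t"
  using coset_join3[of c "S t"] subgroup_S S_subset by blast

lemma act_cong: "(v, w) \<in> cong \<Longrightarrow> x \<in> states \<Longrightarrow> foldr act v x = foldr act w x"
proof (induction arbitrary: x rule: rel_congruence.induct)
  case (congr v w y z)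
  then show ?case
    using foldr_act_states by simp
next
  case (base_mult a b)
  then show ?case
    by (simp add: translate_comp states_def)
next
  case base_one
  then show ?case
    by (simp add: translate_one states_def)
next
  case (cancel_right t)
  then show ?case
    using red_cons_linv[of x "((t, S t), False)"] by (simp add: linv_def states_def)
next
  case (cancel_left t)
  then show ?case
    using red_cons_linv[of x "((t, S t), True)"] by (simp add: linv_def states_def)
next
  case (relator r)
  then obtain t c where t: "t \<in> T" "c \<in> S t" "r = [Base (inv c), Stable_inv t, Base c, Stable t]"
    using R_commute by blast
  have c: "c \<in> carrier K"
    using t S_subset by blast
  have x: "over points x" "reduced x"
    using relator by (simp_all add: states_def)
  have "translate c (red_cons ((t, S t), True) x) = red_cons ((t, S t), True) (translate c x)"
    using translate_red_cons[of c "((t, S t), True)" x] t c x S_subset by (simp add: lcos_S)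
  moreover have "red_cons ((t, S t), False) (red_cons ((t, S t), True) (translate c x)) = translate c x"
  proof -
    have "reduced (translate c x)"
      using x c reduced_translate by blast
    moreover have "linv ((t, S t), True) = ((t, S t), False)"
      by (simp add: linv_def)
    ultimately show ?thesis
      using red_cons_linv[of "translate c x" "((t, S t), True)"] by simp
  qed
  ultimately show ?case
    using t c x by (simp add: translate_comp translate_one)
qed auto

end

section \<open>Extensions inside an ambient group\<close>

locale relative_extension = group H for H :: "'h monoid" (structure) +
  fixes A B :: "'h set" and T :: "'t set" and R :: "('h, 't) letter list set" and S :: "'t \<Rightarrow> 'h set"
    and \<psi> :: "('h, 't) letter list set \<Rightarrow> 'h" and \<tau> :: "'t \<Rightarrow> 'h"
  assumes subgroup_A: "subgroup A H" and subgroup_B: "subgroup B H"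
    and iso: "\<psi> \<in> iso (rel_presentation (subgrp H A) T R) (subgrp H B)"
    and psi_base: "k \<in> A \<Longrightarrow> \<psi> (rel_class (subgrp H A) T R [Base k]) = k"
    and psi_stable: "t \<in> T \<Longrightarrow> \<psi> (rel_class (subgrp H A) T R [Stable t]) = \<tau> t"
    and subgroup_S: "t \<in> T \<Longrightarrow> subgroup (S t) H" and S_A: "t \<in> T \<Longrightarrow> S t \<subseteq> A"
    and R_commute: "r \<in> R \<Longrightarrow> \<exists>t\<in>T. \<exists>c\<in>S t. r = [Base (inv c), Stable_inv t, Base c, Stable t]"
    and commute: "t \<in> T \<Longrightarrow> c \<in> S t \<Longrightarrow> c \<otimes> \<tau> t = \<tau> t \<otimes> c"
begin

sublocale P: relative_presentation "subgrp H A" T R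
  unfolding relative_presentation_def using subgroup_A by (rule subgroup_imp_group)

sublocale P: commuting_presentation "subgrp H A" T R S
proof (intro commuting_presentation.intro commuting_presentation_axioms.intro P.relative_presentation_axioms)
  show "subgroup (S t) (subgrp H A)" if "t \<in> T" for t
    using subgroup_incl[OF subgroup_S subgroup_A S_A] that by blast
  show "\<exists>t\<in>T. \<exists>c\<in>S t. r = [Base (inv\<^bsub>subgrp H A\<^esub> c), Stable_inv t, Base c, Stable t]"
    if "r \<in> R" "r \<in> P.words" for r
  proof -
    obtain t c where r: "t \<in> T" "c \<in> S t" "r = [Base (inv c), Stable_inv t, Base c, Stable t]"
      using R_commute \<open>r \<in> R\<close> by blast
    then have "inv\<^bsub>subgrp H A\<^esub> c = inv c"
      using m_inv_consistent[OF subgroup_A] S_A by blast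
    with r show ?thesis
      by metis
  qed
qed

lemma A_closed [simp]: "k \<in> A \<Longrightarrow> l \<in> A \<Longrightarrow> k \<otimes> l \<in> A" "k \<in> A \<Longrightarrow> inv k \<in> A" "\<one> \<in> A"
  using subgroup_A by (auto simp: subgroup_def)

lemma A_carrier [simp]: "k \<in> A \<Longrightarrow> k \<in> carrier H"
  using subgroup.mem_carrier[OF subgroup_A] .

lemma B_carrier: "b \<in> B \<Longrightarrow> b \<in> carrier H"
  using subgroup.mem_carrier[OF subgroup_B] .

lemma psi_hom: "\<psi> \<in> hom P.P (subgrp H B)"
  using iso by (simp add: iso_def)

lemma psi_in_B: "w \<in> P.words \<Longrightarrow> \<psi> (P.cls w) \<in> B"
  using hom_in_carrier[OF psi_hom] P.cls_in_P by fastforce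

lemma psi_append: "u \<in> P.words \<Longrightarrow> v \<in> P.words \<Longrightarrow> \<psi> (P.cls (u @ v)) = \<psi> (P.cls u) \<otimes> \<psi> (P.cls v)"
  using hom_mult[OF psi_hom, of "P.cls u" "P.cls v"] by simp

lemma psi_Nil: "\<psi> (P.cls []) = \<one>"
  using hom_one[OF psi_hom P.group_P] subgroup_imp_group[OF subgroup_B] by (simp add: P.one_P)

lemma psi_inject: "u \<in> P.words \<Longrightarrow> v \<in> P.words \<Longrightarrow> \<psi> (P.cls u) = \<psi> (P.cls v) \<Longrightarrow> (u, v) \<in> P.cong"
  using iso P.cls_eq_iff by (auto simp: iso_def bij_betw_def dest: inj_onD)

lemma tau_in_B: "t \<in> T \<Longrightarrow> \<tau> t \<in> B"
  using psi_in_B[of "[Stable t]"] psi_stable by simp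

lemma tau_carrier [simp]: "t \<in> T \<Longrightarrow> \<tau> t \<in> carrier H"
  using tau_in_B B_carrier by blast

lemma A_B: "A \<subseteq> B"
proof
  fix k
  assume "k \<in> A"
  then show "k \<in> B"
    using psi_in_B[of "[Base k]"] psi_base[of k] by simp
qed

lemma psi_stable_inv:
  assumes "t \<in> T"
  shows "\<psi> (P.cls [Stable_inv t]) = inv (\<tau> t)"
proof -
  have "\<psi> (P.cls [Stable_inv t]) \<otimes> \<tau> t = \<psi> (P.cls [Stable_inv t, Stable t])"
    using assms psi_append[of "[Stable_inv t]" "[Stable t]"] by (simp add: psi_stable)
  also have "\<dots> = \<one>"
    using assms P.cls_eqI[OF rel_congruence.cancel_left[of t T "subgrp H A" R]] by (simp add: psi_Nil)
  finally show ?thesis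
    using assms inv_equality[of "\<psi> (P.cls [Stable_inv t])" "\<tau> t"] B_carrier psi_in_B[of "[Stable_inv t]"]
    by simp
qed

lemma psi_in_subgroup:
  assumes "subgroup D H" "A \<subseteq> D" "\<tau> ` T \<subseteq> D" "w \<in> P.words"
  shows "\<psi> (P.cls w) \<in> D"
  using assms(4)
proof (induction w)
  case Nil
  then show ?case
    using subgroup.one_closed[OF assms(1)] by (simp add: psi_Nil)
next
  case (Cons l w)
  then have lw: "[l] \<in> P.words" "w \<in> P.words"
    using P.words_append[of "[l]" w] by simp_all
  have "\<psi> (P.cls [l]) \<in> D"
    using lw assms(2,3) psi_base psi_stable psi_stable_inv subgroup.m_inv_closed[OF assms(1)]
    by (cases l) auto
  then show ?case
    using psi_append[OF lw] Cons.IH lw subgroup.m_closed[OF assms(1)] by simp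
qed

lemma B_subset:
  assumes "subgroup D H" "A \<subseteq> D" "\<tau> ` T \<subseteq> D"
  shows "B \<subseteq> D"
proof
  fix b
  assume "b \<in> B"
  then obtain p where "p \<in> carrier P.P" "\<psi> p = b"
    using iso by (auto simp: iso_def bij_betw_def)
  then show "b \<in> D"
    using psi_in_subgroup[OF assms] by (auto elim: P.P_cases)
qed

lemma B_generate: "B = generate H (A \<union> \<tau> ` T)"
proof
  have gens: "A \<union> \<tau> ` T \<subseteq> carrier H"
    by auto
  show "B \<subseteq> generate H (A \<union> \<tau> ` T)"
    by (rule B_subset[OF generate_is_subgroup[OF gens]]) (auto intro: generate.incl)
  show "generate H (A \<union> \<tau> ` T) \<subseteq> B"
    using A_B tau_in_B by (intro generate_subgroup_incl[OF _ subgroup_B]) auto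
qed

definition letters :: "'h set" where
  "letters = {k \<otimes> \<tau> t \<otimes> inv k | k t. k \<in> A \<and> t \<in> T}"

lemma conj_stable_eq:
  assumes "k \<in> A" "t \<in> T" "t' \<in> T" "k \<otimes> \<tau> t \<otimes> inv k = \<tau> t'"
  shows "t = t'" "k \<in> S t"
proof -
  let ?w = "[Base k, Stable t, Base (inv k)]"
  have "\<psi> (P.cls ?w) = \<psi> (P.cls [Stable t'])"
    using assms psi_append[of "[Base k]" "[Stable t, Base (inv k)]"]
      psi_append[of "[Stable t]" "[Base (inv k)]"] by (simp add: psi_base psi_stable m_assoc)
  then have "(?w, [Stable t']) \<in> P.cong"
    using assms by (intro psi_inject) auto
  then have "foldr P.act ?w [] = foldr P.act [Stable t'] []"
    by (rule P.act_cong) (simp add: P.states_def)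
  then have "t = t' \<and> k <#\<^bsub>subgrp H A\<^esub> S t = S t'"
    by auto
  moreover have "k \<otimes> \<one> \<in> k <#\<^bsub>subgrp H A\<^esub> S t"
    using subgroup.one_closed[OF subgroup_S[OF assms(2)]] by (auto simp: l_coset_def)
  ultimately show "t = t'" "k \<in> S t"
    using assms by auto
qed

lemma stable_commute_iff:
  assumes "k \<in> A" "t \<in> T"
  shows "k \<otimes> \<tau> t = \<tau> t \<otimes> k \<longleftrightarrow> k \<in> S t"
  using conj_stable_eq(2)[of k t t] commute[of t k] assms conj_eq_iff[of k "\<tau> t" "\<tau> t"] by auto

sublocale letter_system H A letters
proof
  fix k x
  assume k: "k \<in> A" and "x \<in> letters"
  then obtain l t where x: "x = l \<otimes> \<tau> t \<otimes> inv l" "l \<in> A" "t \<in> T"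
    by (auto simp: letters_def)
  then have "k \<otimes> x \<otimes> inv k = (k \<otimes> l) \<otimes> \<tau> t \<otimes> inv (k \<otimes> l)"
    using k by (simp add: inv_mult_group m_assoc)
  then show "k \<otimes> x \<otimes> inv k \<in> letters"
    using A_closed(1)[OF k x(2)] x(3) unfolding letters_def by blast
qed (use subgroup_A in \<open>auto simp: letters_def subgroup_def\<close>)

lemma foldr_red_cons: "reduced w \<Longrightarrow> foldr red_cons w [] = w"
proof (induction w)
  case (Cons a w)
  then show ?case
    using red_cons_reduced[of a w] by (cases w) auto
qed simp

text \<open>A reduced word over the conjugates of the letters acts on the empty state by writing down
  the corresponding word over points.\<close>

sublocale free_over H A letters
proof
  fix w
  assume w: "over letters w" "reduced w" "word_val w \<in> A"
  have "\<forall>x\<in>letters. \<exists>kt. fst kt \<in> A \<and> snd kt \<in> T \<and> x = fst kt \<otimes> \<tau> (snd kt) \<otimes> inv (fst kt)"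
    by (auto simp: letters_def)
  then obtain f where f: "\<And>x. x \<in> letters \<Longrightarrow> fst (f x) \<in> A \<and> snd (f x) \<in> T \<and>
      x = fst (f x) \<otimes> \<tau> (snd (f x)) \<otimes> inv (fst (f x))"
    using bchoice[of letters "\<lambda>x kt. fst kt \<in> A \<and> snd kt \<in> T \<and> x = fst kt \<otimes> \<tau> (snd kt) \<otimes> inv (fst kt)"]
    by blast
  define lw where "lw = (\<lambda>a. [Base (fst (f (fst a))),
      (if snd a then Stable (snd (f (fst a))) else Stable_inv (snd (f (fst a)))), Base (inv (fst (f (fst a))))])"
  define pt where "pt = (\<lambda>x. (snd (f x), fst (f x) <#\<^bsub>subgrp H A\<^esub> S (snd (f x))))"
  define ptl where "ptl = (\<lambda>a. (pt (fst a), snd a :: bool))"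
  have lw_eq: "lw a = [Base k, (if snd a then Stable t else Stable_inv t), Base (inv k)]"
    if "k = fst (f (fst a))" "t = snd (f (fst a))" for a k t
    using that by (simp add: lw_def)
  have lw_words: "lw a \<in> P.words" if "fst a \<in> letters" for a
    using f[OF that] by (simp add: lw_def)
  have lw_val: "\<psi> (P.cls (lw a)) = letter_val a" if "fst a \<in> letters" for a
  proof -
    define k t where "k = fst (f (fst a))" and "t = snd (f (fst a))"
    have kt: "k \<in> A" "t \<in> T" "fst a = k \<otimes> \<tau> t \<otimes> inv k"
      using f[OF that] by (simp_all add: k_def t_def)
    show ?thesis
    proof (cases "snd a")
      case True
      then have "\<psi> (P.cls (lw a)) = k \<otimes> (\<tau> t \<otimes> inv k)"
        using kt psi_append[of "[Base k]" "[Stable t, Base (inv k)]"] psi_append[of "[Stable t]" "[Base (inv k)]"]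
        by (simp add: lw_eq[OF k_def t_def] psi_base psi_stable)
      then show ?thesis
        using kt True by (simp add: letter_val_def m_assoc)
    next
      case False
      then have "\<psi> (P.cls (lw a)) = k \<otimes> (inv (\<tau> t) \<otimes> inv k)"
        using kt psi_append[of "[Base k]" "[Stable_inv t, Base (inv k)]"]
          psi_append[of "[Stable_inv t]" "[Base (inv k)]"]
        by (simp add: lw_eq[OF k_def t_def] psi_base psi_stable_inv)
      then show ?thesis
        using kt False by (simp add: letter_val_def m_assoc inv_mult_group)
    qed
  qed
  have lw_act: "foldr P.act (lw a) x = red_cons (ptl a) x" if "fst a \<in> letters" "x \<in> P.states" for a x
  proof -
    define k t where "k = fst (f (fst a))" and "t = snd (f (fst a))"
    have kt: "k \<in> A" "t \<in> T" "S t \<subseteq> A"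
      using f[OF that(1)] S_A by (auto simp: k_def t_def)
    have x: "over (UNIV \<times> Pow A) x" "reduced x"
      using that(2) by (simp_all add: P.states_def)
    have "over (UNIV \<times> Pow A) (((t, S t), snd a) # P.translate (inv k) x)"
      using P.over_translate[of "inv k" x] kt x by simp
    then have "P.translate k (red_cons ((t, S t), snd a) (P.translate (inv k) x))
      = red_cons (ptl a) (P.translate k (P.translate (inv k) x))"
      using P.translate_red_cons[of k "((t, S t), snd a)"] kt
      by (simp add: ptl_def pt_def flip: k_def t_def)
    also have "P.translate k (P.translate (inv k) x) = x"
      using P.translate_comp[of k "inv k" x] P.translate_one[of x] kt x by simp
    finally show ?thesis
      by (auto simp: lw_eq[OF k_def t_def])
  qed
  have main: "concat (map lw v) \<in> P.words \<and> \<psi> (P.cls (concat (map lw v))) = word_val v \<and>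
      foldr P.act (concat (map lw v)) [] = foldr red_cons (map ptl v) []" if "over letters v" for v
    using that
  proof (induction v)
    case Nil
    then show ?case
      by (simp add: psi_Nil)
  next
    case (Cons a v)
    have "foldr P.act (concat (map lw v)) [] \<in> P.states"
      using Cons by (intro P.foldr_act_states) (auto simp: P.states_def)
    then show ?case
      using Cons psi_append[of "lw a" "concat (map lw v)"] by (simp add: lw_words lw_val lw_act word_val_Cons)
  qed
  have pt_inj: "x = y" if "x \<in> letters" "y \<in> letters" "pt x = pt y" for x y
  proof -
    define k l t where "k = fst (f x)" and "l = fst (f y)" and "t = snd (f x)"
    have t: "snd (f y) = t" and cosets: "k <#\<^bsub>subgrp H A\<^esub> S t = l <#\<^bsub>subgrp H A\<^esub> S t"
      using that(3) unfolding k_def l_def t_def pt_def by (metis prod.inject)+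
    have kt: "k \<in> A" "l \<in> A" "t \<in> T" "x = k \<otimes> \<tau> t \<otimes> inv k" "y = l \<otimes> \<tau> t \<otimes> inv l"
      using f[OF that(1)] f[OF that(2)] unfolding t k_def[symmetric] l_def[symmetric] t_def[symmetric]
      by blast+
    have "k \<otimes> \<one> \<in> l <#\<^bsub>subgrp H A\<^esub> S t"
      using subgroup.one_closed[OF subgroup_S[OF kt(3)]] unfolding cosets[symmetric]
      by (auto simp: l_coset_def)
    then obtain c where c: "c \<in> S t" "k = l \<otimes> c"
      using kt by (auto simp: l_coset_def)
    have cG: "c \<in> carrier H"
      using c(1) S_A[OF kt(3)] A_carrier by blast
    have "c \<otimes> \<tau> t \<otimes> inv c = \<tau> t"
      using commute[OF kt(3) c(1)] conj_eq_iff[of c "\<tau> t" "\<tau> t"] cG kt by simp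
    moreover have "x = l \<otimes> (c \<otimes> \<tau> t \<otimes> inv c) \<otimes> inv l"
      using kt cG by (simp add: c(2) inv_mult_group m_assoc)
    ultimately show ?thesis
      using kt(5) by (simp only:)
  qed
  have "reduced (map ptl w)"
    using w(1,2)
  proof (induction w)
    case (Cons a w)
    then show ?case
      using pt_inj by (cases w) (auto simp: ptl_def linv_def)
  qed simp
  then have "foldr P.act (concat (map lw w)) [] = map ptl w"
    using main[OF w(1)] by (simp add: foldr_red_cons)
  moreover have "(concat (map lw w), [Base (word_val w)]) \<in> P.cong"
    using main[OF w(1)] w(3) by (intro psi_inject) (auto simp: psi_base)
  then have "foldr P.act (concat (map lw w)) [] = foldr P.act [Base (word_val w)] []"
    by (rule P.act_cong) (simp add: P.states_def)
  ultimately show "w = []"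
    by simp
qed

lemma tau_in_letters: "t \<in> T \<Longrightarrow> \<tau> t \<in> letters"
  unfolding letters_def by (rule CollectI) (metis A_closed(3) inv_one l_one r_one tau_carrier)

lemma span_eq: "span = B"
proof
  show "B \<subseteq> span"
    using K_in_span X_in_span tau_in_letters by (intro B_subset[OF subgroup_span]) auto
  have "letter_val a \<in> B" if a: "fst a \<in> letters" for a
    using that A_B tau_in_B subgroup.m_closed[OF subgroup_B] subgroup.m_inv_closed[OF subgroup_B]
  proof -
    obtain k t where kt: "k \<in> A" "t \<in> T" "fst a = k \<otimes> \<tau> t \<otimes> inv k"
      using a by (auto simp: letters_def)
    then have "fst a \<in> B"
      using A_B tau_in_B subgroup.m_closed[OF subgroup_B] A_closed(2)[of k] by (simp add: subset_iff)
    then show ?thesis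
      using subgroup.m_inv_closed[OF subgroup_B] by (simp add: letter_val_def)
  qed
  then have "word_val w \<in> B" if "over letters w" for w
    using that subgroup.one_closed[OF subgroup_B] subgroup.m_closed[OF subgroup_B]
    by (induction w) (auto simp: word_val_Cons)
  then show "span \<subseteq> B"
    using A_B subgroup.m_closed[OF subgroup_B] by (auto simp: span_def)
qed

lemma universal:
  assumes "group M" "\<phi> \<in> hom (subgrp H A) M" "\<And>t. t \<in> T \<Longrightarrow> \<sigma> t \<in> carrier M"
    and "\<And>t c. t \<in> T \<Longrightarrow> c \<in> S t \<Longrightarrow> \<phi> c \<otimes>\<^bsub>M\<^esub> \<sigma> t = \<sigma> t \<otimes>\<^bsub>M\<^esub> \<phi> c"
  obtains \<theta> where "\<theta> \<in> hom (subgrp H B) M" "\<And>k. k \<in> A \<Longrightarrow> \<theta> k = \<phi> k" "\<And>t. t \<in> T \<Longrightarrow> \<theta> (\<tau> t) = \<sigma> t"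
proof -
  interpret M: group M by fact
  interpret \<phi>: group_hom "subgrp H A" M \<phi>
    using assms(2) subgroup_imp_group[OF subgroup_A] by (simp add: group_hom_def group_hom_axioms_def)
  interpret E: presentation_eval "subgrp H A" T R M \<phi> \<sigma>
  proof
    show "word_eval M \<phi> \<sigma> r = \<one>\<^bsub>M\<^esub>" if r: "r \<in> R" for r
    proof -
      obtain t c where t: "t \<in> T" "c \<in> S t" "r = [Base (inv c), Stable_inv t, Base c, Stable t]"
        using R_commute r by blast
      then have c: "c \<in> A"
        using S_A by blast
      have c': "\<phi> (inv c) = inv\<^bsub>M\<^esub> (\<phi> c)"
        using \<phi>.hom_inv[of c] c m_inv_consistent[OF subgroup_A c] by simp
      have M: "\<phi> c \<in> carrier M" "\<sigma> t \<in> carrier M"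
        using \<phi>.hom_closed[of c] c t assms(3) by simp_all
      show ?thesis
        using M by (simp add: t(3) c' word_eval_def letter_eval_def assms(4)[OF t(1,2)])
    qed
  qed (use assms in auto)
  have "inv_into (carrier P.P) \<psi> \<in> iso (subgrp H B) P.P"
    using group.iso_set_sym[OF P.group_P iso] .
  then have inv_hom: "inv_into (carrier P.P) \<psi> \<in> hom (subgrp H B) P.P"
    by (simp add: iso_def)
  have inj: "inj_on \<psi> (carrier P.P)"
    using iso by (simp add: iso_def bij_betw_def)
  let ?\<theta> = "E.lift \<circ> inv_into (carrier P.P) \<psi>"
  have "?\<theta> \<in> hom (subgrp H B) M"
    using Group.hom_compose[OF inv_hom E.lift_hom] .
  moreover have "?\<theta> k = \<phi> k" if "k \<in> A" for k
    using inv_into_f_f[OF inj, of "P.cls [Base k]"] that by (simp add: psi_base E.lift_base)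
  moreover have "?\<theta> (\<tau> t) = \<sigma> t" if "t \<in> T" for t
    using inv_into_f_f[OF inj, of "P.cls [Stable t]"] that by (simp add: psi_stable E.lift_stable)
  ultimately show ?thesis
    using that by blast
qed

end

section \<open>Extensions of centralizers inside an ambient group\<close>

definition base_class :: "'h monoid \<Rightarrow> 'h set \<Rightarrow> 'h set set \<Rightarrow> 'h \<Rightarrow> ('h, 'h set) letter list set" where
  "base_class H A \<C> k = rel_class (subgrp H A) \<C> (commutation_relators (subgrp H A) \<C>) [Base k]"

definition stable_class :: "'h monoid \<Rightarrow> 'h set \<Rightarrow> 'h set set \<Rightarrow> 'h set \<Rightarrow> ('h, 'h set) letter list set" where
  "stable_class H A \<C> C = rel_class (subgrp H A) \<C> (commutation_relators (subgrp H A) \<C>) [Stable C]"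

text \<open>The map \<open>\<tau>\<close> names the letters of the extension as elements of \<open>B\<close>: the letter for \<open>C\<close> is \<open>\<tau> C\<close>.\<close>

definition extension_by :: "'h monoid \<Rightarrow> 'h set \<Rightarrow> 'h set set \<Rightarrow> ('h set \<Rightarrow> 'h) \<Rightarrow> 'h set \<Rightarrow> bool" where
  "extension_by H A \<C> \<tau> B \<longleftrightarrow> group H \<and> subgroup A H \<and> subgroup B H \<and> (\<forall>C\<in>\<C>. subgroup C H \<and> C \<subseteq> A) \<and>
     (\<exists>\<psi>\<in>iso (extend_centralizers (subgrp H A) \<C>) (subgrp H B).
        (\<forall>k\<in>A. \<psi> (base_class H A \<C> k) = k) \<and> (\<forall>C\<in>\<C>. \<psi> (stable_class H A \<C> C) = \<tau> C))"

lemma relative_presentation_subgrp: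
  assumes "group H" "subgroup A H"
  shows "relative_presentation (subgrp H A)"
  using group.subgroup_imp_group[OF assms] by (simp add: relative_presentation_def)

lemma group_extend_centralizers:
  assumes "group H" "subgroup A H"
  shows "group (extend_centralizers (subgrp H A) \<C>)"
  unfolding extend_centralizers_def
  by (rule relative_presentation.group_P[OF relative_presentation_subgrp[OF assms]])

lemma base_class_hom:
  assumes "group H" "subgroup A H"
  shows "base_class H A \<C> \<in> hom (subgrp H A) (extend_centralizers (subgrp H A) \<C>)"
  unfolding extend_centralizers_def
  using relative_presentation.base_hom[OF relative_presentation_subgrp[OF assms]]
  by (simp add: base_class_def[abs_def])

lemma stable_class_carrier:
  assumes "group H" "subgroup A H" "C \<in> \<C>"
  shows "stable_class H A \<C> C \<in> carrier (extend_centralizers (subgrp H A) \<C>)"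
proof -
  interpret relative_presentation "subgrp H A" \<C> "commutation_relators (subgrp H A) \<C>"
    by (rule relative_presentation_subgrp[OF assms(1,2)])
  show ?thesis
    unfolding extend_centralizers_def stable_class_def using assms(3) by (intro cls_in_P) simp
qed

lemma stable_class_commute:
  assumes "group H" "subgroup A H" "C \<in> \<C>" "c \<in> C" "C \<subseteq> A"
  shows "base_class H A \<C> c \<otimes>\<^bsub>extend_centralizers (subgrp H A) \<C>\<^esub> stable_class H A \<C> C =
    stable_class H A \<C> C \<otimes>\<^bsub>extend_centralizers (subgrp H A) \<C>\<^esub> base_class H A \<C> c"
proof -
  interpret relative_presentation "subgrp H A" \<C> "commutation_relators (subgrp H A) \<C>"
    by (rule relative_presentation_subgrp[OF assms(1,2)])
  show ?thesis
    unfolding extend_centralizers_def stable_class_def base_class_def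
    using assms by (intro stable_commute) (auto simp: commutation_relators_def)
qed

lemma extension_by_locale:
  assumes "extension_by H A \<C> \<tau> B"
  obtains \<psi> where "relative_extension H A B \<C> (commutation_relators (subgrp H A) \<C>) (\<lambda>C. C) \<psi> \<tau>"
proof -
  let ?R = "commutation_relators (subgrp H A) \<C>"
  have H: "group H" "subgroup A H" "subgroup B H" and C: "\<And>C. C \<in> \<C> \<Longrightarrow> subgroup C H \<and> C \<subseteq> A"
    using assms by (auto simp: extension_by_def)
  obtain \<psi> where \<psi>: "\<psi> \<in> iso (extend_centralizers (subgrp H A) \<C>) (subgrp H B)"
      "\<And>k. k \<in> A \<Longrightarrow> \<psi> (base_class H A \<C> k) = k" "\<And>C. C \<in> \<C> \<Longrightarrow> \<psi> (stable_class H A \<C> C) = \<tau> C"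
    using assms by (auto simp: extension_by_def)
  interpret group H by fact
  show ?thesis
  proof (rule that[of \<psi>], intro relative_extension.intro relative_extension_axioms.intro)
    show "group H" "subgroup A H" "subgroup B H"
      by fact+
    show "\<psi> \<in> iso (rel_presentation (subgrp H A) \<C> ?R) (subgrp H B)"
      using \<psi>(1) by (simp add: extend_centralizers_def)
    show "\<psi> (rel_class (subgrp H A) \<C> ?R [Base k]) = k" if "k \<in> A" for k
      using \<psi>(2)[OF that] by (simp add: base_class_def)
    show "\<psi> (rel_class (subgrp H A) \<C> ?R [Stable C]) = \<tau> C" if "C \<in> \<C>" for C
      using \<psi>(3)[OF that] by (simp add: stable_class_def)
    show "subgroup C H" "C \<subseteq> A" if "C \<in> \<C>" for C
      using C[OF that] by auto
    show "\<exists>C\<in>\<C>. \<exists>c\<in>C. r = [Base (inv\<^bsub>H\<^esub> c), Stable_inv C, Base c, Stable C]" if r: "r \<in> ?R" for r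
    proof -
      obtain c D where D: "D \<in> \<C>" "c \<in> D" "r = [Base (inv\<^bsub>subgrp H A\<^esub> c), Stable_inv D, Base c, Stable D]"
        using r by (auto simp: commutation_relators_def)
      then have "inv\<^bsub>subgrp H A\<^esub> c = inv\<^bsub>H\<^esub> c"
        using m_inv_consistent[OF H(2)] C by blast
      with D show ?thesis
        by metis
    qed
    show "c \<otimes>\<^bsub>H\<^esub> \<tau> C = \<tau> C \<otimes>\<^bsub>H\<^esub> c" if "C \<in> \<C>" "c \<in> C" for C c
    proof -
      have \<psi>_hom: "\<psi> \<in> hom (extend_centralizers (subgrp H A) \<C>) (subgrp H B)"
        using \<psi>(1) by (simp add: iso_def)
      have c: "c \<in> A"
        using C that by blast
      have P: "base_class H A \<C> c \<in> carrier (extend_centralizers (subgrp H A) \<C>)"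
        using hom_in_carrier[OF base_class_hom[OF H(1,2)]] c by simp
      have "\<psi> (base_class H A \<C> c) \<otimes>\<^bsub>H\<^esub> \<psi> (stable_class H A \<C> C) =
          \<psi> (stable_class H A \<C> C) \<otimes>\<^bsub>H\<^esub> \<psi> (base_class H A \<C> c)"
        using hom_mult[OF \<psi>_hom P stable_class_carrier[OF H(1,2) that(1)]]
          hom_mult[OF \<psi>_hom stable_class_carrier[OF H(1,2) that(1)] P]
          stable_class_commute[OF H(1,2) that] C[OF that(1)] by simp
      then show ?thesis
        using \<psi>(2)[OF c] \<psi>(3)[OF that(1)] by simp
    qed
  qed
qed

definition conj_letters :: "'h monoid \<Rightarrow> 'h set \<Rightarrow> 'h set set \<Rightarrow> ('h set \<Rightarrow> 'h) \<Rightarrow> 'h set" where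
  "conj_letters H A \<C> \<tau> = {k \<otimes>\<^bsub>H\<^esub> \<tau> C \<otimes>\<^bsub>H\<^esub> inv\<^bsub>H\<^esub> k | k C. k \<in> A \<and> C \<in> \<C>}"

lemma extension_by_free:
  assumes "extension_by H A \<C> \<tau> B"
  shows "free_over H A (conj_letters H A \<C> \<tau>)" "letter_system.span H A (conj_letters H A \<C> \<tau>) = B"
proof -
  obtain \<psi> where "relative_extension H A B \<C> (commutation_relators (subgrp H A) \<C>) (\<lambda>C. C) \<psi> \<tau>"
    using extension_by_locale[OF assms] .
  then interpret relative_extension H A B \<C> "commutation_relators (subgrp H A) \<C>" "\<lambda>C. C" \<psi> \<tau> .
  show "free_over H A (conj_letters H A \<C> \<tau>)"
    using free_over_axioms by (simp add: letters_def conj_letters_def)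
  show "letter_system.span H A (conj_letters H A \<C> \<tau>) = B"
    using span_eq by (simp add: letters_def conj_letters_def)
qed

lemma extension_byD:
  assumes "extension_by H A \<C> \<tau> B"
  shows "group H" "subgroup A H" "subgroup B H" "A \<subseteq> B" "C \<in> \<C> \<Longrightarrow> \<tau> C \<in> B"
    "C \<in> \<C> \<Longrightarrow> subgroup C H" "C \<in> \<C> \<Longrightarrow> C \<subseteq> A"
    "B = generate H (A \<union> \<tau> ` \<C>)"
    "C \<in> \<C> \<Longrightarrow> k \<in> A \<Longrightarrow> k \<otimes>\<^bsub>H\<^esub> \<tau> C = \<tau> C \<otimes>\<^bsub>H\<^esub> k \<longleftrightarrow> k \<in> C"
    "C \<in> \<C> \<Longrightarrow> D \<in> \<C> \<Longrightarrow> k \<in> A \<Longrightarrow> k \<otimes>\<^bsub>H\<^esub> \<tau> C \<otimes>\<^bsub>H\<^esub> inv\<^bsub>H\<^esub> k = \<tau> D \<Longrightarrow> C = D"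
proof -
  obtain \<psi> where "relative_extension H A B \<C> (commutation_relators (subgrp H A) \<C>) (\<lambda>C. C) \<psi> \<tau>"
    using extension_by_locale[OF assms] .
  then interpret relative_extension H A B \<C> "commutation_relators (subgrp H A) \<C>" "\<lambda>C. C" \<psi> \<tau> .
  show "group H" "subgroup A H" "subgroup B H" "A \<subseteq> B"
    by (fact is_group subgroup_A subgroup_B A_B)+
  show "C \<in> \<C> \<Longrightarrow> \<tau> C \<in> B" "C \<in> \<C> \<Longrightarrow> subgroup C H" "C \<in> \<C> \<Longrightarrow> C \<subseteq> A"
    using tau_in_B subgroup_S S_A by blast+
  show "B = generate H (A \<union> \<tau> ` \<C>)"
    by (rule B_generate)
  show "C \<in> \<C> \<Longrightarrow> k \<in> A \<Longrightarrow> k \<otimes>\<^bsub>H\<^esub> \<tau> C = \<tau> C \<otimes>\<^bsub>H\<^esub> k \<longleftrightarrow> k \<in> C"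
    by (rule stable_commute_iff)
  show "C \<in> \<C> \<Longrightarrow> D \<in> \<C> \<Longrightarrow> k \<in> A \<Longrightarrow> k \<otimes>\<^bsub>H\<^esub> \<tau> C \<otimes>\<^bsub>H\<^esub> inv\<^bsub>H\<^esub> k = \<tau> D \<Longrightarrow> C = D"
    using conj_stable_eq(1) by blast
qed

lemma extension_by_universal:
  assumes "extension_by H A \<C> \<tau> B" "group M" "\<phi> \<in> hom (subgrp H A) M" "\<And>C. C \<in> \<C> \<Longrightarrow> \<sigma> C \<in> carrier M"
    and "\<And>C c. C \<in> \<C> \<Longrightarrow> c \<in> C \<Longrightarrow> \<phi> c \<otimes>\<^bsub>M\<^esub> \<sigma> C = \<sigma> C \<otimes>\<^bsub>M\<^esub> \<phi> c"
  obtains \<theta> where "\<theta> \<in> hom (subgrp H B) M" "\<And>k. k \<in> A \<Longrightarrow> \<theta> k = \<phi> k" "\<And>C. C \<in> \<C> \<Longrightarrow> \<theta> (\<tau> C) = \<sigma> C"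
proof -
  obtain \<psi> where "relative_extension H A B \<C> (commutation_relators (subgrp H A) \<C>) (\<lambda>C. C) \<psi> \<tau>"
    using extension_by_locale[OF assms(1)] .
  then interpret relative_extension H A B \<C> "commutation_relators (subgrp H A) \<C>" "\<lambda>C. C" \<psi> \<tau> .
  show ?thesis
    by (rule universal[OF assms(2,3), of \<sigma>]) (use assms that in auto)
qed

lemma extension_by_centralizer:
  assumes ext: "extension_by H A \<C> \<tau> B" and u: "u \<in> A" and y: "y \<in> B" "u \<otimes>\<^bsub>H\<^esub> y = y \<otimes>\<^bsub>H\<^esub> u"
    and D: "subgroup D H" "\<And>k. k \<in> A \<Longrightarrow> u \<otimes>\<^bsub>H\<^esub> k = k \<otimes>\<^bsub>H\<^esub> u \<Longrightarrow> k \<in> D"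
      "\<And>x. x \<in> conj_letters H A \<C> \<tau> \<Longrightarrow> u \<otimes>\<^bsub>H\<^esub> x = x \<otimes>\<^bsub>H\<^esub> u \<Longrightarrow> x \<in> D"
  shows "y \<in> D"
proof -
  interpret free_over H A "conj_letters H A \<C> \<tau>"
    by (rule extension_by_free(1)[OF ext])
  obtain w k where w: "over (conj_letters H A \<C> \<tau>) w" "reduced w" "k \<in> A" "y = word_val w \<otimes>\<^bsub>H\<^esub> k"
    using y(1) extension_by_free(2)[OF ext] spanE by metis
  have c: "conj_word u w = w" "u \<otimes>\<^bsub>H\<^esub> k = k \<otimes>\<^bsub>H\<^esub> u"
    using centralizer_of_base[OF u w(1,2,3)] y(2) w(4) by simp_all
  have "fst a \<in> D" if "a \<in> set w" for a
    using conj_word_eq_self[OF u w(1) c(1) that] D(3) w(1) that by (auto simp: over_def)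
  then have "letter_val a \<in> D" if "a \<in> set w" for a
    using that subgroup.m_inv_closed[OF D(1)] by (auto simp: letter_val_def)
  then have "word_val w \<in> D"
    using subgroup.one_closed[OF D(1)] subgroup.m_closed[OF D(1)]
    by (induction w) (auto simp: word_val_Cons)
  then show ?thesis
    using w(3,4) D(2) c(2) subgroup.m_closed[OF D(1)] by simp
qed

lemma hom_eq_on_generate:
  assumes "group H" "group M" "S \<subseteq> carrier H" "f \<in> hom (subgrp H (generate H S)) M"
    "g \<in> hom (subgrp H (generate H S)) M" "\<And>s. s \<in> S \<Longrightarrow> f s = g s" "x \<in> generate H S"
  shows "f x = g x"
proof -
  interpret group H by fact
  have sub: "subgroup (generate H S) H"
    using generate_is_subgroup[OF assms(3)] .
  have grp: "group (subgrp H (generate H S))"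
    by (rule subgroup_imp_group[OF sub])
  interpret f: group_hom "subgrp H (generate H S)" M f
    using assms grp by (simp add: group_hom_def group_hom_axioms_def)
  interpret g: group_hom "subgrp H (generate H S)" M g
    using assms grp by (simp add: group_hom_def group_hom_axioms_def)
  show ?thesis
    using assms(7)
  proof (induction rule: generate.induct)
    case one
    then show ?case
      using f.hom_one g.hom_one by simp
  next
    case (incl s)
    then show ?case
      using assms(6) by simp
  next
    case (inv s)
    then have s: "s \<in> generate H S"
      by (rule generate.incl)
    then have "inv\<^bsub>subgrp H (generate H S)\<^esub> s = inv\<^bsub>H\<^esub> s"
      by (rule m_inv_consistent[OF sub])
    then show ?case
      using f.hom_inv[of s] g.hom_inv[of s] s assms(6)[OF inv] by simp
  next
    case (eng a b)
    then show ?case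
      using f.hom_mult[of a b] g.hom_mult[of a b] by simp
  qed
qed

lemma extension_by_hom_eq:
  assumes "extension_by H A \<C> \<tau> B" "group M" "f \<in> hom (subgrp H B) M" "g \<in> hom (subgrp H B) M"
    "\<And>k. k \<in> A \<Longrightarrow> f k = g k" "\<And>C. C \<in> \<C> \<Longrightarrow> f (\<tau> C) = g (\<tau> C)" "x \<in> B"
  shows "f x = g x"
proof -
  note D = extension_byD[OF assms(1)]
  have "A \<union> \<tau> ` \<C> \<subseteq> carrier H"
    using D(4,5) subgroup.subset[OF D(3)] by blast
  then show ?thesis
    using hom_eq_on_generate[OF D(1) assms(2), of "A \<union> \<tau> ` \<C>" f g x] assms(3-7)
    unfolding D(8)[symmetric] by blast
qed

lemma presentation_map:
  assumes H: "group H" "subgroup A H" "group M" and \<phi>: "\<phi> \<in> hom (subgrp H A) M"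
    and C: "\<And>C. C \<in> \<C> \<Longrightarrow> C \<subseteq> A" and \<sigma>: "\<And>C. C \<in> \<C> \<Longrightarrow> \<sigma> C \<in> carrier M"
    and comm: "\<And>C c. C \<in> \<C> \<Longrightarrow> c \<in> C \<Longrightarrow> \<phi> c \<otimes>\<^bsub>M\<^esub> \<sigma> C = \<sigma> C \<otimes>\<^bsub>M\<^esub> \<phi> c"
  obtains \<psi> where "\<psi> \<in> hom (extend_centralizers (subgrp H A) \<C>) M" "\<And>k. k \<in> A \<Longrightarrow> \<psi> (base_class H A \<C> k) = \<phi> k"
    "\<And>C. C \<in> \<C> \<Longrightarrow> \<psi> (stable_class H A \<C> C) = \<sigma> C"
proof -
  interpret relative_presentation "subgrp H A" \<C> "commutation_relators (subgrp H A) \<C>"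
    by (rule relative_presentation_subgrp[OF H(1,2)])
  interpret M: group M by fact
  interpret \<phi>: group_hom "subgrp H A" M \<phi>
    using \<phi> is_group H(3) by (simp add: group_hom_def group_hom_axioms_def)
  interpret E: presentation_eval "subgrp H A" \<C> "commutation_relators (subgrp H A) \<C>" M \<phi> \<sigma>
  proof
    show "word_eval M \<phi> \<sigma> r = \<one>\<^bsub>M\<^esub>" if "r \<in> commutation_relators (subgrp H A) \<C>" for r
    proof -
      obtain c D where D: "D \<in> \<C>" "c \<in> D" "r = [Base (inv\<^bsub>subgrp H A\<^esub> c), Stable_inv D, Base c, Stable D]"
        using \<open>r \<in> commutation_relators (subgrp H A) \<C>\<close> by (auto simp: commutation_relators_def)
      then have c: "c \<in> A"
        using C by blast
      then have "\<phi> (inv\<^bsub>subgrp H A\<^esub> c) = inv\<^bsub>M\<^esub> (\<phi> c)" "\<phi> c \<in> carrier M" "\<sigma> D \<in> carrier M"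
        using \<phi>.hom_inv[of c] \<phi>.hom_closed[of c] \<sigma> D by simp_all
      then show ?thesis
        by (simp add: D(3) word_eval_def letter_eval_def comm[OF D(1,2)])
    qed
  qed (use \<phi> \<sigma> in auto)
  show ?thesis
    using that[of E.lift] E.lift_hom E.lift_base E.lift_stable
    by (simp add: extend_centralizers_def base_class_def stable_class_def)
qed

lemma presentation_hom_eq:
  assumes "group H" "subgroup A H" "group M" "f \<in> hom (extend_centralizers (subgrp H A) \<C>) M"
    "g \<in> hom (extend_centralizers (subgrp H A) \<C>) M" "\<And>k. k \<in> A \<Longrightarrow> f (base_class H A \<C> k) = g (base_class H A \<C> k)"
    "\<And>C. C \<in> \<C> \<Longrightarrow> f (stable_class H A \<C> C) = g (stable_class H A \<C> C)"
    "p \<in> carrier (extend_centralizers (subgrp H A) \<C>)"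
  shows "f p = g p"
proof -
  interpret relative_presentation "subgrp H A" \<C> "commutation_relators (subgrp H A) \<C>"
    by (rule relative_presentation_subgrp[OF assms(1,2)])
  show ?thesis
    using hom_P_eqI[OF assms(3), of f g p] assms(4-8)
    by (simp add: extend_centralizers_def base_class_def stable_class_def)
qed

lemma extension_byI_injective:
  assumes H: "group H" "subgroup A H" and C: "\<And>C. C \<in> \<C> \<Longrightarrow> subgroup C H \<and> C \<subseteq> A"
    and \<tau>: "\<And>C. C \<in> \<C> \<Longrightarrow> \<tau> C \<in> carrier H"
    and B: "B = generate H (A \<union> \<tau> ` \<C>)"
    and \<psi>: "\<psi> \<in> hom (extend_centralizers (subgrp H A) \<C>) H" "\<And>k. k \<in> A \<Longrightarrow> \<psi> (base_class H A \<C> k) = k"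
      "\<And>C. C \<in> \<C> \<Longrightarrow> \<psi> (stable_class H A \<C> C) = \<tau> C"
    and inj: "inj_on \<psi> (carrier (extend_centralizers (subgrp H A) \<C>))"
  shows "extension_by H A \<C> \<tau> B"
proof -
  let ?P = "extend_centralizers (subgrp H A) \<C>"
  interpret group H by fact
  have AH: "A \<subseteq> carrier H"
    using subgroup.subset[OF H(2)] .
  have gens: "A \<union> \<tau> ` \<C> \<subseteq> carrier H"
    using AH \<tau> by auto
  have B_sub: "subgroup B H"
    unfolding B by (rule generate_is_subgroup[OF gens])
  interpret \<psi>: group_hom ?P H \<psi>
    using \<psi>(1) group_extend_centralizers[OF H] H(1) by (simp add: group_hom_def group_hom_axioms_def)
  have "B \<subseteq> \<psi> ` carrier ?P"
    unfolding B
  proof (rule generate_subgroup_incl[OF _ \<psi>.img_is_subgroup])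
    have "k \<in> \<psi> ` carrier ?P" if "k \<in> A" for k
      using \<psi>(2)[OF that] hom_in_carrier[OF base_class_hom[OF H], of k] that by force
    moreover have "\<tau> C \<in> \<psi> ` carrier ?P" if "C \<in> \<C>" for C
      using \<psi>(3)[OF that] stable_class_carrier[OF H that] by force
    ultimately show "A \<union> \<tau> ` \<C> \<subseteq> \<psi> ` carrier ?P"
      by blast
  qed
  moreover have "\<psi> p \<in> B" if p: "p \<in> carrier ?P" for p
  proof -
    obtain \<psi>' where \<psi>': "\<psi>' \<in> hom ?P (subgrp H B)" "\<And>k. k \<in> A \<Longrightarrow> \<psi>' (base_class H A \<C> k) = k"
        "\<And>C. C \<in> \<C> \<Longrightarrow> \<psi>' (stable_class H A \<C> C) = \<tau> C"
    proof (rule presentation_map[OF H subgroup_imp_group[OF B_sub], of "\<lambda>k. k" \<C> \<tau>])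
      show "(\<lambda>k. k) \<in> hom (subgrp H A) (subgrp H B)"
        by (auto simp: hom_def B intro: generate.incl)
      show "C \<subseteq> A" if "C \<in> \<C>" for C
        using C[OF that] by simp
      show "\<tau> C \<in> carrier (subgrp H B)" if "C \<in> \<C>" for C
        using that by (auto simp: B intro: generate.incl)
      show "c \<otimes>\<^bsub>subgrp H B\<^esub> \<tau> C = \<tau> C \<otimes>\<^bsub>subgrp H B\<^esub> c" if "C \<in> \<C>" "c \<in> C" for C c
      proof -
        have c: "c \<in> A"
          using C that by blast
        have "base_class H A \<C> c \<in> carrier ?P" "stable_class H A \<C> C \<in> carrier ?P"
          using hom_in_carrier[OF base_class_hom[OF H], of c] c stable_class_carrier[OF H that(1)] by auto
        then have "\<psi> (base_class H A \<C> c) \<otimes>\<^bsub>H\<^esub> \<psi> (stable_class H A \<C> C) =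
            \<psi> (stable_class H A \<C> C) \<otimes>\<^bsub>H\<^esub> \<psi> (base_class H A \<C> c)"
          using stable_class_commute[OF H that] C[OF that(1)] by (simp flip: \<psi>.hom_mult)
        then show ?thesis
          using \<psi>(2)[OF c] \<psi>(3)[OF that(1)] by simp
      qed
    qed blast
    have "\<psi>' \<in> hom ?P H"
      using \<psi>'(1) subgroup.subset[OF B_sub] by (auto simp: hom_def)
    then have "\<psi> p = \<psi>' p"
      using presentation_hom_eq[OF H H(1) \<psi>(1), of \<psi>' p] \<psi>' \<psi> p by simp
    then show ?thesis
      using hom_in_carrier[OF \<psi>'(1) p] by simp
  qed
  ultimately have "\<psi> ` carrier ?P = B"
    by blast
  then have "\<psi> \<in> iso ?P (subgrp H B)"
    using \<psi>(1) inj by (auto simp: iso_def bij_betw_def hom_def)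
  then show ?thesis
    unfolding extension_by_def using H B_sub C \<psi> by blast
qed

lemma extension_byI:
  assumes H: "group H" "subgroup A H" and C: "\<And>C. C \<in> \<C> \<Longrightarrow> subgroup C H \<and> C \<subseteq> A"
    and \<tau>: "\<And>C. C \<in> \<C> \<Longrightarrow> \<tau> C \<in> carrier H"
    and comm: "\<And>C c. C \<in> \<C> \<Longrightarrow> c \<in> C \<Longrightarrow> c \<otimes>\<^bsub>H\<^esub> \<tau> C = \<tau> C \<otimes>\<^bsub>H\<^esub> c"
    and B: "B = generate H (A \<union> \<tau> ` \<C>)"
    and \<theta>: "\<theta> \<in> hom (subgrp H B) (extend_centralizers (subgrp H A) \<C>)" "\<And>k. k \<in> A \<Longrightarrow> \<theta> k = base_class H A \<C> k"
      "\<And>C. C \<in> \<C> \<Longrightarrow> \<theta> (\<tau> C) = stable_class H A \<C> C"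
  shows "extension_by H A \<C> \<tau> B"
proof -
  let ?P = "extend_centralizers (subgrp H A) \<C>"
  interpret group H by fact
  have AH: "A \<subseteq> carrier H"
    using subgroup.subset[OF H(2)] .
  have B_sub: "subgroup B H"
    unfolding B using AH \<tau> by (intro generate_is_subgroup) auto
  obtain \<psi> where \<psi>: "\<psi> \<in> hom ?P (subgrp H B)" "\<And>k. k \<in> A \<Longrightarrow> \<psi> (base_class H A \<C> k) = k"
      "\<And>C. C \<in> \<C> \<Longrightarrow> \<psi> (stable_class H A \<C> C) = \<tau> C"
  proof (rule presentation_map[OF H subgroup_imp_group[OF B_sub], of "\<lambda>k. k" \<C> \<tau>])
    show "(\<lambda>k. k) \<in> hom (subgrp H A) (subgrp H B)"
      by (auto simp: hom_def B intro: generate.incl)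
    show "C \<subseteq> A" if "C \<in> \<C>" for C
      using C[OF that] by simp
    show "\<tau> C \<in> carrier (subgrp H B)" if "C \<in> \<C>" for C
      using that by (auto simp: B intro: generate.incl)
    show "c \<otimes>\<^bsub>subgrp H B\<^esub> \<tau> C = \<tau> C \<otimes>\<^bsub>subgrp H B\<^esub> c" if "C \<in> \<C>" "c \<in> C" for C c
      using comm[OF that] by simp
  qed blast
  have id: "(\<theta> \<circ> \<psi>) p = (\<lambda>p. p) p" if "p \<in> carrier ?P" for p
  proof (rule presentation_hom_eq[OF H group_extend_centralizers[OF H] _ _ _ _ that])
    show "\<theta> \<circ> \<psi> \<in> hom ?P ?P"
      using Group.hom_compose[OF \<psi>(1) \<theta>(1)] .
    show "(\<lambda>p. p) \<in> hom ?P ?P"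
      by (auto simp: hom_def)
  qed (use \<psi> \<theta> in auto)
  have "inj_on \<psi> (carrier ?P)"
    using id by (intro inj_on_inverseI[of _ \<theta>]) auto
  moreover have "\<psi> \<in> hom ?P H"
    using \<psi>(1) subgroup.subset[OF B_sub] by (auto simp: hom_def)
  ultimately show ?thesis
    using extension_byI_injective[OF H C \<tau> B] \<psi> by blast
qed

abbreviation single_extension :: "'h monoid \<Rightarrow> 'h set \<Rightarrow> 'h set \<Rightarrow> 'h \<Rightarrow> 'h set \<Rightarrow> bool" where
  "single_extension H A C t B \<equiv> extension_by H A {C} (\<lambda>_. t) B"

abbreviation centralizer_in :: "'h monoid \<Rightarrow> 'h set \<Rightarrow> 'h \<Rightarrow> 'h set" where
  "centralizer_in H A u \<equiv> centralizer (subgrp H A) u"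

lemma hom_subgrp_mono: "h \<in> hom (subgrp H B) M \<Longrightarrow> A \<subseteq> B \<Longrightarrow> h \<in> hom (subgrp H A) M"
  by (auto simp: hom_def subset_iff)

lemma (in group) subgroup_commuting:
  assumes "s \<in> carrier G"
  shows "subgroup {y \<in> carrier G. y \<otimes> s = s \<otimes> y} G"
  using assms by (intro subgroupI) (auto intro: commute_mult commute_inv)

lemma subgroup_centralizer_in:
  assumes "group H" "subgroup A H" "u \<in> A"
  shows "subgroup (centralizer_in H A u) H" "centralizer_in H A u \<subseteq> A"
proof -
  interpret group H by fact
  have eq: "centralizer_in H A u = A \<inter> {y \<in> carrier H. y \<otimes>\<^bsub>H\<^esub> u = u \<otimes>\<^bsub>H\<^esub> y}"
    using subgroup.subset[OF assms(2)] by (auto simp: centralizer_def)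
  show "subgroup (centralizer_in H A u) H"
    unfolding eq using assms(2,3) subgroup_commuting subgroup.mem_carrier[OF assms(2)]
    by (intro subgroups_Inter_pair) auto
qed (auto simp: centralizer_def)

lemma hom_word_val:
  assumes "group_hom G H h" "over (carrier G) w"
  shows "h (group.word_val G w) = group.word_val H (map (\<lambda>a. (h (fst a), snd a)) w)"
proof -
  interpret group_hom G H h by fact
  show ?thesis
    using assms(2)
  proof (induction w)
    case (Cons a w)
    then have "h (G.letter_val a) = H.letter_val (h (fst a), snd a)"
      by (simp add: G.letter_val_def H.letter_val_def)
    with Cons show ?case
      by (simp add: G.word_val_Cons H.word_val_Cons)
  qed simp
qed

lemma presentation_in_subgroup:
  assumes H: "group H" "subgroup A H" and D: "subgroup D (extend_centralizers (subgrp H A) \<C>)"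
    and gens: "\<And>k. k \<in> A \<Longrightarrow> base_class H A \<C> k \<in> D" "\<And>C. C \<in> \<C> \<Longrightarrow> stable_class H A \<C> C \<in> D"
    and p: "p \<in> carrier (extend_centralizers (subgrp H A) \<C>)"
  shows "p \<in> D"
proof -
  interpret P: relative_presentation "subgrp H A" \<C> "commutation_relators (subgrp H A) \<C>"
    by (rule relative_presentation_subgrp[OF H])
  have D: "subgroup D P.P"
    using D by (simp add: extend_centralizers_def)
  have letter: "P.cls [l] \<in> D" if "[l] \<in> P.words" for l
    using that gens subgroup.m_inv_closed[OF D]
    by (cases l) (auto simp: base_class_def stable_class_def simp flip: P.stable_inverse)
  have "P.cls w \<in> D" if "w \<in> P.words" for w
    using that
  proof (induction w)
    case Nil
    then show ?case
      using subgroup.one_closed[OF D] by (simp add: P.one_P)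
  next
    case (Cons l w)
    then have lw: "[l] \<in> P.words" "w \<in> P.words"
      using P.words_append[of "[l]" w] by simp_all
    then show ?case
      using subgroup.m_closed[OF D letter[OF lw(1)] Cons.IH] by simp
  qed
  then show ?thesis
    using p unfolding extend_centralizers_def by (auto elim!: P.P_cases)
qed

lemma single_extension_restrict:
  assumes ext: "single_extension H A C t B" and A': "subgroup A' H" "A' \<subseteq> A"
  shows "single_extension H A' (C \<inter> A') t (generate H (A' \<union> {t}))"
proof -
  note E = extension_byD[OF ext]
  have H: "group H"
    using E(1) .
  interpret F: free_over H A "conj_letters H A {C} (\<lambda>_. t)"
    by (rule extension_by_free(1)[OF ext])
  let ?C = "C \<inter> A'" and ?P = "extend_centralizers (subgrp H A') {C \<inter> A'}"
  have C: "subgroup ?C H"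
    using E(6) A' F.subgroups_Inter_pair by blast
  have tH: "t \<in> carrier H"
    using E(5) subgroup.subset[OF E(3)] by blast
  obtain \<psi> where \<psi>: "\<psi> \<in> hom ?P H" "\<And>k. k \<in> A' \<Longrightarrow> \<psi> (base_class H A' {?C} k) = k"
      "\<psi> (stable_class H A' {?C} ?C) = t"
  proof (rule presentation_map[OF H A'(1) H, of "\<lambda>k. k" "{?C}" "\<lambda>_. t"])
    show "(\<lambda>k. k) \<in> hom (subgrp H A') H"
      using subgroup.subset[OF A'(1)] by (auto simp: hom_def)
    show "c \<otimes>\<^bsub>H\<^esub> t = t \<otimes>\<^bsub>H\<^esub> c" if "D \<in> {?C}" "c \<in> D" for D c
      using E(9)[of C c] that A'(2) by auto
  qed (use tH in auto)
  have P_group: "group ?P"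
    by (rule group_extend_centralizers[OF H A'(1)])
  have b: "base_class H A' {?C} \<in> hom (subgrp H A') ?P"
    by (rule base_class_hom[OF H A'(1)])
  interpret P: group ?P by (rule P_group)
  interpret b: group_hom "subgrp H A'" ?P "base_class H A' {?C}"
    using b P_group F.subgroup_imp_group[OF A'(1)] by (simp add: group_hom_def group_hom_axioms_def)
  interpret \<psi>: group_hom ?P H \<psi>
    using \<psi>(1) P_group H by (simp add: group_hom_def group_hom_axioms_def)
  define s where "s = stable_class H A' {?C} ?C"
  define K where "K = base_class H A' {?C} ` A'"
  define X where "X = {k \<otimes>\<^bsub>?P\<^esub> s \<otimes>\<^bsub>?P\<^esub> inv\<^bsub>?P\<^esub> k | k. k \<in> K}"
  have s: "s \<in> carrier ?P"
    unfolding s_def by (rule stable_class_carrier[OF H A'(1)]) simp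
  have K: "subgroup K ?P"
    using b.img_is_subgroup by (simp add: K_def)
  have K_closed: "K \<subseteq> carrier ?P"
    using subgroup.subset[OF K] .
  interpret N: letter_system ?P K X
  proof (intro letter_system.intro letter_system_axioms.intro P_group K)
    show "X \<subseteq> carrier ?P"
      using s K_closed by (auto simp: X_def)
    fix k x
    assume k: "k \<in> K" and "x \<in> X"
    then obtain l where l: "l \<in> K" "x = l \<otimes>\<^bsub>?P\<^esub> s \<otimes>\<^bsub>?P\<^esub> inv\<^bsub>?P\<^esub> l"
      by (auto simp: X_def)
    have "k \<in> carrier ?P" "l \<in> carrier ?P"
      using k l K_closed by auto
    then have "k \<otimes>\<^bsub>?P\<^esub> x \<otimes>\<^bsub>?P\<^esub> inv\<^bsub>?P\<^esub> k =
        (k \<otimes>\<^bsub>?P\<^esub> l) \<otimes>\<^bsub>?P\<^esub> s \<otimes>\<^bsub>?P\<^esub> inv\<^bsub>?P\<^esub> (k \<otimes>\<^bsub>?P\<^esub> l)"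
      using s by (simp add: l(2) P.inv_mult_group P.m_assoc)
    then show "k \<otimes>\<^bsub>?P\<^esub> x \<otimes>\<^bsub>?P\<^esub> inv\<^bsub>?P\<^esub> k \<in> X"
      using subgroup.m_closed[OF K k l(1)] by (auto simp: X_def)
  qed
  have "s \<in> X"
    using subgroup.one_closed[OF K] s by (auto simp: X_def intro!: exI[of _ "\<one>\<^bsub>?P\<^esub>"])
  then have span: "p \<in> N.span" if "p \<in> carrier ?P" for p
    using presentation_in_subgroup[OF H A'(1) N.subgroup_span _ _ that] N.K_in_span N.X_in_span
    by (auto simp: K_def s_def)
  have X_image: "\<psi> x \<in> conj_letters H A {C} (\<lambda>_. t)" if "x \<in> X" for x
  proof -
    obtain k where k: "k \<in> A'" "x = base_class H A' {?C} k \<otimes>\<^bsub>?P\<^esub> s \<otimes>\<^bsub>?P\<^esub> inv\<^bsub>?P\<^esub> base_class H A' {?C} k"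
      using \<open>x \<in> X\<close> by (auto simp: X_def K_def)
    have "base_class H A' {?C} k \<in> carrier ?P"
      using b.hom_closed[of k] k(1) by simp
    then have "\<psi> x = k \<otimes>\<^bsub>H\<^esub> t \<otimes>\<^bsub>H\<^esub> inv\<^bsub>H\<^esub> k"
      using s k(1) \<psi>(2)[OF k(1)] \<psi>(3) by (simp add: k(2) flip: s_def)
    then show ?thesis
      using k(1) A'(2) by (auto simp: conj_letters_def)
  qed
  have X_inj: "x = y" if "x \<in> X" "y \<in> X" "\<psi> x = \<psi> y" for x y
  proof -
    obtain k l where k: "k \<in> A'" "x = base_class H A' {?C} k \<otimes>\<^bsub>?P\<^esub> s \<otimes>\<^bsub>?P\<^esub> inv\<^bsub>?P\<^esub> base_class H A' {?C} k"
      and l: "l \<in> A'" "y = base_class H A' {?C} l \<otimes>\<^bsub>?P\<^esub> s \<otimes>\<^bsub>?P\<^esub> inv\<^bsub>?P\<^esub> base_class H A' {?C} l"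
      using \<open>x \<in> X\<close> \<open>y \<in> X\<close> by (auto simp: X_def K_def)
    have kl: "base_class H A' {?C} k \<in> carrier ?P" "base_class H A' {?C} l \<in> carrier ?P"
      using b.hom_closed[of k] b.hom_closed[of l] k(1) l(1) by simp_all
    have klH: "k \<in> carrier H" "l \<in> carrier H"
      using k(1) l(1) subgroup.subset[OF A'(1)] by auto
    define c where "c = inv\<^bsub>H\<^esub> l \<otimes>\<^bsub>H\<^esub> k"
    have c: "c \<in> A'" "k = l \<otimes>\<^bsub>H\<^esub> c" "c \<in> carrier H"
      using k(1) l(1) subgroup.m_closed[OF A'(1)] subgroup.m_inv_closed[OF A'(1)] klH
      by (simp_all add: c_def)
    have "\<psi> x = k \<otimes>\<^bsub>H\<^esub> t \<otimes>\<^bsub>H\<^esub> inv\<^bsub>H\<^esub> k" "\<psi> y = l \<otimes>\<^bsub>H\<^esub> t \<otimes>\<^bsub>H\<^esub> inv\<^bsub>H\<^esub> l"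
      using s kl k(1) l(1) \<psi>(2) \<psi>(3) by (simp_all add: k(2) l(2) flip: s_def)
    then have "l \<otimes>\<^bsub>H\<^esub> (c \<otimes>\<^bsub>H\<^esub> t \<otimes>\<^bsub>H\<^esub> inv\<^bsub>H\<^esub> c) \<otimes>\<^bsub>H\<^esub> inv\<^bsub>H\<^esub> l = l \<otimes>\<^bsub>H\<^esub> t \<otimes>\<^bsub>H\<^esub> inv\<^bsub>H\<^esub> l"
      using that(3) klH c(3) tH by (simp add: c(2) F.inv_mult_group F.m_assoc)
    then have "c \<otimes>\<^bsub>H\<^esub> t \<otimes>\<^bsub>H\<^esub> inv\<^bsub>H\<^esub> c = t"
      using F.conj_inj[of l "c \<otimes>\<^bsub>H\<^esub> t \<otimes>\<^bsub>H\<^esub> inv\<^bsub>H\<^esub> c" t] klH c(3) tH by simp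
    then have "c \<in> ?C"
      using E(9)[of C c] c A'(2) F.conj_eq_iff[of c t t] tH by auto
    then have "base_class H A' {?C} c \<otimes>\<^bsub>?P\<^esub> s = s \<otimes>\<^bsub>?P\<^esub> base_class H A' {?C} c"
      unfolding s_def using stable_class_commute[OF H A'(1), of ?C "{?C}" c] by simp
    moreover have cP: "base_class H A' {?C} c \<in> carrier ?P"
      using b.hom_closed[of c] c by simp
    ultimately have cs: "base_class H A' {?C} c \<otimes>\<^bsub>?P\<^esub> s \<otimes>\<^bsub>?P\<^esub> inv\<^bsub>?P\<^esub> base_class H A' {?C} c = s"
      using P.conj_eq_iff[OF cP s s] by simp
    have "base_class H A' {?C} k = base_class H A' {?C} l \<otimes>\<^bsub>?P\<^esub> base_class H A' {?C} c"
      using b.hom_mult[of l c] l(1) c by simp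
    then have "x = base_class H A' {?C} l \<otimes>\<^bsub>?P\<^esub>
        (base_class H A' {?C} c \<otimes>\<^bsub>?P\<^esub> s \<otimes>\<^bsub>?P\<^esub> inv\<^bsub>?P\<^esub> base_class H A' {?C} c) \<otimes>\<^bsub>?P\<^esub> inv\<^bsub>?P\<^esub> base_class H A' {?C} l"
      using kl cP s by (simp add: k(2) P.inv_mult_group P.m_assoc)
    then show ?thesis
      by (simp only: cs l(2))
  qed
  have "p = \<one>\<^bsub>?P\<^esub>" if p: "p \<in> carrier ?P" "\<psi> p = \<one>\<^bsub>H\<^esub>" for p
  proof -
    obtain w k where w: "over X w" "reduced w" "k \<in> K" "p = P.word_val w \<otimes>\<^bsub>?P\<^esub> k"
      using span[OF p(1)] by (rule N.spanE)
    obtain l where l: "l \<in> A'" "k = base_class H A' {?C} l"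
      using w(3) by (auto simp: K_def)
    define w' where "w' = map (\<lambda>a. (\<psi> (fst a), snd a)) w"
    have w': "over (conj_letters H A {C} (\<lambda>_. t)) w'"
      using w(1) X_image by (auto simp: w'_def over_def)
    have "reduced w'"
      using reduced_map_letters[of \<psi> X w] X_inj w(1,2) by (simp add: w'_def inj_on_def)
    have lH: "l \<in> carrier H"
      using l(1) subgroup.subset[OF A'(1)] by blast
    have "F.word_val w' \<otimes>\<^bsub>H\<^esub> l = \<one>\<^bsub>H\<^esub>"
      using p(2) w hom_word_val[OF \<psi>.group_hom_axioms N.over_carrier[OF w(1)]] l \<psi>(2)[OF l(1)]
      by (simp add: w'_def)
    then have "F.word_val w' = inv\<^bsub>H\<^esub> l"
      using F.inv_equality[of "F.word_val w'" l] w' lH by simp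
    then have "F.word_val w' \<in> A"
      using l(1) A'(2) by (metis E(2) subgroup.m_inv_closed subset_iff)
    then have "w' = []"
      using F.free w' \<open>reduced w'\<close> by blast
    then have "w = []"
      by (simp add: w'_def)
    then have "p = k" "l = \<one>\<^bsub>H\<^esub>"
      using w p(2) l \<psi>(2)[OF l(1)] K_closed by auto
    then show ?thesis
      using l b.hom_one by simp
  qed
  then have "inj_on \<psi> (carrier ?P)"
    using \<psi>.inj_iff_trivial_ker by (auto simp: kernel_def)
  then show ?thesis
    using extension_byI_injective[OF H A'(1), of "{?C}" "\<lambda>_. t" "generate H (A' \<union> {t})" \<psi>] C tH \<psi> by auto
qed

lemma single_extension_transport:
  assumes ext: "single_extension G A C t B" and M: "group M" and h: "h \<in> hom (subgrp G B) M" "inj_on h B"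
  shows "single_extension M (h ` A) (h ` C) (h t) (h ` B)"
proof -
  note E = extension_byD[OF ext]
  interpret G: group G by (rule E(1))
  interpret h: group_hom "subgrp G B" M h
    using h M G.subgroup_imp_group[OF E(3)] by (simp add: group_hom_def group_hom_axioms_def)
  have CA: "C \<subseteq> A" "subgroup C G" "t \<in> B"
    using E(5-7) by auto
  have image: "subgroup (h ` D) M" if "subgroup D G" "D \<subseteq> B" for D
    using h.subgroup_img_is_subgroup[of D] G.subgroup_incl[OF that(1) E(3) that(2)] by simp
  have hA: "subgroup (h ` A) M" and hC: "subgroup (h ` C) M" "h ` C \<subseteq> h ` A"
    using image E(2,4) CA by auto
  let ?P = "extend_centralizers (subgrp M (h ` A)) {h ` C}"
  have b: "base_class M (h ` A) {h ` C} \<in> hom (subgrp M (h ` A)) ?P"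
    by (rule base_class_hom[OF M hA])
  have hA_hom: "h \<in> hom (subgrp G A) (subgrp M (h ` A))"
    using h(1) E(4) by (auto simp: hom_def)
  have "(base_class M (h ` A) {h ` C}) \<circ> h \<in> hom (subgrp G A) ?P"
    using Group.hom_compose[OF hA_hom b] .
  then obtain \<theta> where \<theta>: "\<theta> \<in> hom (subgrp G B) ?P" "\<And>k. k \<in> A \<Longrightarrow> \<theta> k = base_class M (h ` A) {h ` C} (h k)"
      "\<theta> t = stable_class M (h ` A) {h ` C} (h ` C)"
  proof (rule extension_by_universal[OF ext group_extend_centralizers[OF M hA],
        where \<sigma> = "\<lambda>_. stable_class M (h ` A) {h ` C} (h ` C)"])
    show "stable_class M (h ` A) {h ` C} (h ` C) \<in> carrier ?P"
      by (rule stable_class_carrier[OF M hA]) simp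
    show "(base_class M (h ` A) {h ` C} \<circ> h) c \<otimes>\<^bsub>?P\<^esub> stable_class M (h ` A) {h ` C} (h ` C) =
        stable_class M (h ` A) {h ` C} (h ` C) \<otimes>\<^bsub>?P\<^esub> (base_class M (h ` A) {h ` C} \<circ> h) c"
      if "D \<in> {C}" "c \<in> D" for D c
      using stable_class_commute[OF M hA, of "h ` C" "{h ` C}" "h c"] that hC by auto
  qed auto
  have "h ` B = h ` generate (subgrp G B) (A \<union> {t})"
    using E(8) G.generate_consistent[of "A \<union> {t}" B] E(3,4) CA by auto
  also have "\<dots> = generate M (h ` (A \<union> {t}))"
    using h.generate_img[of "A \<union> {t}"] E(4) CA by auto
  finally have B: "h ` B = generate M (h ` A \<union> (\<lambda>_. h t) ` {h ` C})"
    by (simp add: image_Un)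
  have inv_h: "inv_into B h (h x) = x" if "x \<in> B" for x
    using inv_into_f_f[OF h(2) that] .
  have "h \<in> iso (subgrp G B) (subgrp M (h ` B))"
    using h by (auto simp: iso_def bij_betw_def hom_def)
  then have "inv_into B h \<in> hom (subgrp M (h ` B)) (subgrp G B)"
    using group.iso_set_sym[OF G.subgroup_imp_group[OF E(3)]] by (fastforce simp: iso_def)
  then have \<theta>': "\<theta> \<circ> inv_into B h \<in> hom (subgrp M (h ` B)) ?P"
    using Group.hom_compose \<theta>(1) by blast
  show ?thesis
  proof (rule extension_byI[OF M hA _ _ _ B \<theta>'])
    show "subgroup D M \<and> D \<subseteq> h ` A" if "D \<in> {h ` C}" for D
      using that hC by simp
    show "h t \<in> carrier M"
      using h.hom_closed[of t] CA by simp
    show "c \<otimes>\<^bsub>M\<^esub> h t = h t \<otimes>\<^bsub>M\<^esub> c" if D: "D \<in> {h ` C}" "c \<in> D" for D c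
    proof -
      obtain x where x: "x \<in> C" "c = h x"
        using D by auto
      then have "x \<in> B" "x \<otimes>\<^bsub>G\<^esub> t = t \<otimes>\<^bsub>G\<^esub> x"
        using CA E(4) E(9)[of C x] by auto
      then show ?thesis
        using h.hom_mult[of x t] h.hom_mult[of t x] CA x(2) by simp
    qed
    show "(\<theta> \<circ> inv_into B h) k = base_class M (h ` A) {h ` C} k" if "k \<in> h ` A" for k
      using that \<theta>(2) inv_h E(4) by auto
    show "(\<theta> \<circ> inv_into B h) (h t) = stable_class M (h ` A) {h ` C} D" if "D \<in> {h ` C}" for D
      using that \<theta>(3) inv_h CA by simp
  qed
qed

lemma single_extension_iso:
  assumes ext: "single_extension G A C t B" and ext': "single_extension M A' (f ` C) t' B'"
    and f: "f \<in> iso (subgrp G A) (subgrp M A')"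
  shows "\<exists>g\<in>iso (subgrp G B) (subgrp M B'). \<forall>x\<in>A. g x = f x"
proof -
  note E = extension_byD[OF ext] and E' = extension_byD[OF ext']
  interpret G: group G by (rule E(1))
  interpret M: group M by (rule E'(1))
  have B: "group (subgrp G B)" and B': "group (subgrp M B')"
    using G.subgroup_imp_group[OF E(3)] M.subgroup_imp_group[OF E'(3)] .
  have f_hom: "f \<in> hom (subgrp G A) (subgrp M A')" and f_bij: "bij_betw f A A'"
    using f by (auto simp: iso_def)
  define f' where "f' = inv_into A f"
  have f'_hom: "f' \<in> hom (subgrp M A') (subgrp G A)"
    using group.iso_set_sym[OF G.subgroup_imp_group[OF E(2)] f] by (simp add: iso_def f'_def)
  have ff': "f (f' y) = y" "f' y \<in> A" if "y \<in> A'" for y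
    using f_bij that by (auto simp: f'_def bij_betw_def f_inv_into_f inv_into_into)
  have f'f: "f' (f x) = x" if "x \<in> A" for x
    using f_bij that by (simp add: f'_def bij_betw_def)
  have t: "t \<in> B" and t': "t' \<in> B'" and CA: "C \<subseteq> A"
    using E(5,7) E'(5) by auto
  obtain g where g: "g \<in> hom (subgrp G B) (subgrp M B')" "\<And>k. k \<in> A \<Longrightarrow> g k = f k" "g t = t'"
  proof (rule extension_by_universal[OF ext B', of f "\<lambda>_. t'"])
    show "f \<in> hom (subgrp G A) (subgrp M B')"
      using f_hom E'(4) by (auto simp: hom_def)
    show "f c \<otimes>\<^bsub>subgrp M B'\<^esub> t' = t' \<otimes>\<^bsub>subgrp M B'\<^esub> f c" if "D \<in> {C}" "c \<in> D" for D c
      using E'(9)[of "f ` C" "f c"] that CA f_bij by (auto simp: bij_betw_def)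
  qed (use t' in auto)
  obtain g' where g': "g' \<in> hom (subgrp M B') (subgrp G B)" "\<And>k. k \<in> A' \<Longrightarrow> g' k = f' k" "g' t' = t"
  proof (rule extension_by_universal[OF ext' B, of f' "\<lambda>_. t"])
    show "f' \<in> hom (subgrp M A') (subgrp G B)"
      using f'_hom E(4) by (auto simp: hom_def)
    show "f' c \<otimes>\<^bsub>subgrp G B\<^esub> t = t \<otimes>\<^bsub>subgrp G B\<^esub> f' c" if D: "D \<in> {f ` C}" "c \<in> D" for D c
    proof -
      obtain x where "x \<in> C" "c = f x"
        using D by auto
      then show ?thesis
        using f'f[of x] CA E(9)[of C x] by auto
    qed
  qed (use t in auto)
  have gg: "(g' \<circ> g) x = (\<lambda>x. x) x" if "x \<in> B" for x
  proof (rule extension_by_hom_eq[OF ext B _ _ _ _ that])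
    show "g' \<circ> g \<in> hom (subgrp G B) (subgrp G B)"
      using Group.hom_compose[OF g(1) g'(1)] .
    show "(\<lambda>x. x) \<in> hom (subgrp G B) (subgrp G B)"
      by (auto simp: hom_def)
    show "(g' \<circ> g) k = k" if "k \<in> A" for k
      using that g g' f'f f_bij by (auto simp: bij_betw_def)
  qed (use g g' in auto)
  have gg': "(g \<circ> g') x = (\<lambda>x. x) x" if "x \<in> B'" for x
  proof (rule extension_by_hom_eq[OF ext' B' _ _ _ _ that])
    show "g \<circ> g' \<in> hom (subgrp M B') (subgrp M B')"
      using Group.hom_compose[OF g'(1) g(1)] .
    show "(\<lambda>x. x) \<in> hom (subgrp M B') (subgrp M B')"
      by (auto simp: hom_def)
    show "(g \<circ> g') k = k" if "k \<in> A'" for k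
      using that g g' ff' by auto
  qed (use g g' in auto)
  have "bij_betw g B B'"
    using hom_in_carrier[OF g(1)] hom_in_carrier[OF g'(1)] gg gg'
    by (intro bij_betwI[where g = g']) auto
  then show ?thesis
    using g by (auto simp: iso_def)
qed

text \<open>By the universal property it is enough to compare relations, and these are the same for both
  orders: \<open>u\<close> commutes with \<open>k s k\<inverse>\<close> iff \<open>v\<close> commutes with \<open>k\<inverse> u k\<close>, iff \<open>u\<close> commutes with \<open>k v k\<inverse>\<close>,
  iff \<open>v\<close> commutes with \<open>k\<inverse> t k\<close>.\<close>

lemma single_extension_swap:
  fixes H (structure)
  assumes ext1: "single_extension H B (centralizer_in H B v) s E"
    and ext2: "single_extension H E (centralizer_in H E u) t F"
    and uv: "u \<in> B" "v \<in> B"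
  defines "D \<equiv> generate H (B \<union> {t})"
  shows "single_extension H B (centralizer_in H B u) t D"
    and "single_extension H D (centralizer_in H D v) s F"
proof -
  note E1 = extension_byD[OF ext1] and E2 = extension_byD[OF ext2]
  interpret group H by (rule E1(1))
  have "centralizer_in H E u \<inter> B = centralizer_in H B u"
    using E1(4) by (auto simp: centralizer_def)
  then show ext3: "single_extension H B (centralizer_in H B u) t D"
    using single_extension_restrict[OF ext2 E1(2,4)] by (simp add: D_def)
  note E3 = extension_byD[OF ext3]
  have B[simp]: "k \<otimes> l \<in> B" "inv k \<in> B" if "k \<in> B" "l \<in> B" for k l
    using that E1(2) by (auto simp: subgroup_def)
  have BG[simp]: "k \<in> carrier H" if "k \<in> B" for k
    using that subgroup.mem_carrier[OF E1(2)] by blast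
  have s: "s \<in> E" and t: "t \<in> F" "t \<in> D"
    using E1(5) E2(5) E3(5) by auto
  have sG[simp]: "s \<in> carrier H" and tG[simp]: "t \<in> carrier H"
    using s t subgroup.mem_carrier[OF E1(3)] subgroup.mem_carrier[OF E2(3)] by auto
  have s_comm: "k \<otimes> s = s \<otimes> k \<longleftrightarrow> k \<otimes> v = v \<otimes> k" if "k \<in> B" for k
    using E1(9)[of "centralizer_in H B v" k] that by (auto simp: centralizer_def)
  have t_comm: "k \<otimes> t = t \<otimes> k \<longleftrightarrow> k \<otimes> u = u \<otimes> k" if "k \<in> E" for k
    using E2(9)[of "centralizer_in H E u" k] that by (auto simp: centralizer_def)
  have EG: "x \<in> carrier H" if "x \<in> E" for x
    using that subgroup.mem_carrier[OF E1(3)] by blast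
  have DG: "x \<in> carrier H" if "x \<in> D" for x
    using that subgroup.mem_carrier[OF E3(3)] by blast
  have BE: "k \<in> E" if "k \<in> B" for k
    using that E1(4) by blast
  have BD: "k \<in> D" if "k \<in> B" for k
    using that E3(4) by blast
  have Emul: "k \<otimes> l \<in> E" "inv k \<in> E" if "k \<in> E" "l \<in> E" for k l
    using that E1(3) by (auto simp: subgroup_def)
  have Dmul: "k \<otimes> l \<in> D" "inv k \<in> D" if "k \<in> D" "l \<in> D" for k l
    using that E3(3) by (auto simp: subgroup_def)

  have s_centralizes: "y \<otimes> s = s \<otimes> y" if y: "y \<in> D" "v \<otimes> y = y \<otimes> v" for y
  proof -
    have "y \<in> {y \<in> carrier H. y \<otimes> s = s \<otimes> y}"
    proof (rule extension_by_centralizer[OF ext3 uv(2) y subgroup_commuting[OF sG]])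
      show "k \<in> {y \<in> carrier H. y \<otimes> s = s \<otimes> y}" if "k \<in> B" "v \<otimes> k = k \<otimes> v" for k
        using s_comm that by simp
      fix x
      assume "x \<in> conj_letters H B {centralizer_in H B u} (\<lambda>_. t)" and vx: "v \<otimes> x = x \<otimes> v"
      then obtain k where k: "k \<in> B" "x = k \<otimes> t \<otimes> inv k"
        by (auto simp: conj_letters_def)
      have "(inv k \<otimes> v \<otimes> k) \<otimes> t = t \<otimes> (inv k \<otimes> v \<otimes> k)"
        using conj_commute_shift[of t v k] vx k uv by simp
      then have "(inv k \<otimes> v \<otimes> k) \<otimes> u = u \<otimes> (inv k \<otimes> v \<otimes> k)"
        using t_comm[of "inv k \<otimes> v \<otimes> k"] k uv BE by simp
      then have "(k \<otimes> u \<otimes> inv k) \<otimes> v = v \<otimes> (k \<otimes> u \<otimes> inv k)"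
        using conj_commute_shift[of u v k] k uv by simp
      then have "(k \<otimes> u \<otimes> inv k) \<otimes> s = s \<otimes> (k \<otimes> u \<otimes> inv k)"
        using s_comm[of "k \<otimes> u \<otimes> inv k"] k uv by simp
      then have "(inv k \<otimes> s \<otimes> k) \<otimes> u = u \<otimes> (inv k \<otimes> s \<otimes> k)"
        using conj_commute_shift[of u s k] k uv by simp
      then have "(inv k \<otimes> s \<otimes> k) \<otimes> t = t \<otimes> (inv k \<otimes> s \<otimes> k)"
        using t_comm[of "inv k \<otimes> s \<otimes> k"] k s BE Emul by simp
      then have "x \<otimes> s = s \<otimes> x"
        unfolding k(2) using conj_commute_shift[of t s k] k by simp
      then show "x \<in> {y \<in> carrier H. y \<otimes> s = s \<otimes> y}"
        using k by simp
    qed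
    then show ?thesis by simp
  qed

  let ?C = "centralizer_in H D v"
  let ?P = "extend_centralizers (subgrp H D) {?C}"
  have C: "subgroup ?C H" "?C \<subseteq> D"
    using subgroup_centralizer_in[OF E3(1,3)] BD uv by blast+
  define b where "b = base_class H D {?C}"
  define st where "st = stable_class H D {?C} ?C"
  have P: "group ?P"
    by (rule group_extend_centralizers[OF E3(1,3)])
  interpret P: group ?P by (rule P)
  have b_hom: "b \<in> hom (subgrp H D) ?P"
    unfolding b_def by (rule base_class_hom[OF E3(1,3)])
  interpret b: group_hom "subgrp H D" ?P b
    using b_hom P subgroup_imp_group[OF E3(3)] by (simp add: group_hom_def group_hom_axioms_def)
  have st: "st \<in> carrier ?P"
    unfolding st_def by (rule stable_class_carrier[OF E3(1,3)]) simp
  have b_mult: "b (x \<otimes> y) = b x \<otimes>\<^bsub>?P\<^esub> b y" if "x \<in> D" "y \<in> D" for x y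
    using b.hom_mult[of x y] that by simp
  have b_inv: "b (inv x) = inv\<^bsub>?P\<^esub> (b x)" if "x \<in> D" for x
    using b.hom_inv[of x] that m_inv_consistent[OF E3(3) that] by simp
  have bP: "b x \<in> carrier ?P" if "x \<in> D" for x
    using b.hom_closed[of x] that by simp
  have b_st: "b x \<otimes>\<^bsub>?P\<^esub> st = st \<otimes>\<^bsub>?P\<^esub> b x" if "x \<in> D" "x \<otimes> v = v \<otimes> x" for x
    unfolding b_def st_def using that by (intro stable_class_commute[OF E3(1,3)]) (auto simp: centralizer_def)

  obtain \<phi> where \<phi>: "\<phi> \<in> hom (subgrp H E) ?P" "\<And>k. k \<in> B \<Longrightarrow> \<phi> k = b k" "\<phi> s = st"
  proof (rule extension_by_universal[OF ext1 P, of b "\<lambda>_. st"])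
    show "b \<in> hom (subgrp H B) ?P"
      using b_hom E3(4) by (auto simp: hom_def)
    show "b c \<otimes>\<^bsub>?P\<^esub> st = st \<otimes>\<^bsub>?P\<^esub> b c" if "C \<in> {centralizer_in H B v}" "c \<in> C" for C c
      using that BD by (intro b_st) (auto simp: centralizer_def)
  qed (use st in auto)
  interpret \<phi>: group_hom "subgrp H E" ?P \<phi>
    using \<phi>(1) P subgroup_imp_group[OF E1(3)] by (simp add: group_hom_def group_hom_axioms_def)
  have \<phi>_mult: "\<phi> (x \<otimes> y) = \<phi> x \<otimes>\<^bsub>?P\<^esub> \<phi> y" if "x \<in> E" "y \<in> E" for x y
    using \<phi>.hom_mult[of x y] that by simp
  have \<phi>_inv: "\<phi> (inv x) = inv\<^bsub>?P\<^esub> (\<phi> x)" if "x \<in> E" for x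
    using \<phi>.hom_inv[of x] that m_inv_consistent[OF E1(3) that] by simp
  have \<phi>P: "\<phi> x \<in> carrier ?P" if "x \<in> E" for x
    using \<phi>.hom_closed[of x] that by simp

  have bt: "b t \<in> carrier ?P"
    using bP t by simp
  have t_commutes: "\<phi> y \<otimes>\<^bsub>?P\<^esub> b t = b t \<otimes>\<^bsub>?P\<^esub> \<phi> y" if y: "y \<in> E" "u \<otimes> y = y \<otimes> u" for y
  proof -
    let ?W = "{y \<in> E. \<phi> y \<otimes>\<^bsub>?P\<^esub> b t = b t \<otimes>\<^bsub>?P\<^esub> \<phi> y}"
    have W: "subgroup ?W H"
    proof (rule subgroupI)
      show "?W \<subseteq> carrier H"
        using EG by blast
      have "\<one> \<in> ?W"
        using subgroup.one_closed[OF E1(3)] \<phi>.hom_one bt by simp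
      then show "?W \<noteq> {}"
        by blast
      show "inv x \<in> ?W" if "x \<in> ?W" for x
        using that Emul(2)[of x x] P.commute_inv[of "\<phi> x" "b t"] bt \<phi>P \<phi>_inv by simp
      show "x \<otimes> y \<in> ?W" if "x \<in> ?W" "y \<in> ?W" for x y
        using that Emul(1)[of x y] P.commute_mult[of "\<phi> x" "\<phi> y" "b t"] bt \<phi>P \<phi>_mult by simp
    qed
    have "y \<in> ?W"
    proof (rule extension_by_centralizer[OF ext1 uv(1) y W])
      fix k
      assume k: "k \<in> B" "u \<otimes> k = k \<otimes> u"
      then have "k \<otimes> t = t \<otimes> k"
        using t_comm[of k] BE by simp
      then have "b k \<otimes>\<^bsub>?P\<^esub> b t = b t \<otimes>\<^bsub>?P\<^esub> b k"
        using b_mult[of k t] b_mult[of t k] k t BD by simp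
      then show "k \<in> ?W"
        using k \<phi>(2) BE by simp
    next
      fix x
      assume "x \<in> conj_letters H B {centralizer_in H B v} (\<lambda>_. s)" and ux: "u \<otimes> x = x \<otimes> u"
      then obtain k where k: "k \<in> B" "x = k \<otimes> s \<otimes> inv k"
        by (auto simp: conj_letters_def)
      have kE: "k \<in> E" "inv k \<in> E" and kD: "k \<in> D" "inv k \<in> D"
        using k BE BD by simp_all
      have "(inv k \<otimes> u \<otimes> k) \<otimes> s = s \<otimes> (inv k \<otimes> u \<otimes> k)"
        using conj_commute_shift[of s u k] ux k uv by simp
      then have "(inv k \<otimes> u \<otimes> k) \<otimes> v = v \<otimes> (inv k \<otimes> u \<otimes> k)"
        using s_comm[of "inv k \<otimes> u \<otimes> k"] k uv by simp
      then have "(k \<otimes> v \<otimes> inv k) \<otimes> u = u \<otimes> (k \<otimes> v \<otimes> inv k)"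
        using conj_commute_shift[of v u k] k uv by simp
      then have "(k \<otimes> v \<otimes> inv k) \<otimes> t = t \<otimes> (k \<otimes> v \<otimes> inv k)"
        using t_comm[of "k \<otimes> v \<otimes> inv k"] k uv BE by simp
      then have "(inv k \<otimes> t \<otimes> k) \<otimes> v = v \<otimes> (inv k \<otimes> t \<otimes> k)"
        using conj_commute_shift[of v t k] k uv by simp
      then have "b (inv k \<otimes> t \<otimes> k) \<otimes>\<^bsub>?P\<^esub> st = st \<otimes>\<^bsub>?P\<^esub> b (inv k \<otimes> t \<otimes> k)"
        using b_st Dmul kD t by simp
      then have "st \<otimes>\<^bsub>?P\<^esub> (inv\<^bsub>?P\<^esub> b k \<otimes>\<^bsub>?P\<^esub> b t \<otimes>\<^bsub>?P\<^esub> b k) =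
          (inv\<^bsub>?P\<^esub> b k \<otimes>\<^bsub>?P\<^esub> b t \<otimes>\<^bsub>?P\<^esub> b k) \<otimes>\<^bsub>?P\<^esub> st"
        using b_mult b_inv kD t Dmul by simp
      then have "(b k \<otimes>\<^bsub>?P\<^esub> st \<otimes>\<^bsub>?P\<^esub> inv\<^bsub>?P\<^esub> b k) \<otimes>\<^bsub>?P\<^esub> b t = b t \<otimes>\<^bsub>?P\<^esub> (b k \<otimes>\<^bsub>?P\<^esub> st \<otimes>\<^bsub>?P\<^esub> inv\<^bsub>?P\<^esub> b k)"
        using P.conj_commute_shift[of st "b t" "b k"] st bt bP[OF kD(1)] by simp
      moreover have "\<phi> x = b k \<otimes>\<^bsub>?P\<^esub> st \<otimes>\<^bsub>?P\<^esub> inv\<^bsub>?P\<^esub> b k"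
        using k(1) kE kD s Emul \<phi>_mult b_inv \<phi>(2,3) by (simp add: k(2))
      ultimately show "x \<in> ?W"
        using kE s Emul by (simp add: k(2))
    qed
    then show ?thesis by simp
  qed

  obtain \<theta> where \<theta>: "\<theta> \<in> hom (subgrp H F) ?P" "\<And>k. k \<in> E \<Longrightarrow> \<theta> k = \<phi> k" "\<theta> t = b t"
  proof (rule extension_by_universal[OF ext2 P \<phi>(1), of "\<lambda>_. b t"])
    show "\<phi> c \<otimes>\<^bsub>?P\<^esub> b t = b t \<otimes>\<^bsub>?P\<^esub> \<phi> c" if "C \<in> {centralizer_in H E u}" "c \<in> C" for C c
      using that by (intro t_commutes) (auto simp: centralizer_def)
  qed (use bt in auto)
  have DF: "D \<subseteq> F"
    unfolding D_def using E1(4) E2(4) t by (intro generate_subgroup_incl[OF _ E2(3)]) auto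
  have F: "F = generate H (D \<union> (\<lambda>_. s) ` {?C})"
  proof
    have gens: "D \<union> (\<lambda>_. s) ` {?C} \<subseteq> carrier H"
      using DG by auto
    have sub: "subgroup (generate H (D \<union> (\<lambda>_. s) ` {?C})) H"
      by (rule generate_is_subgroup[OF gens])
    have "B \<union> {s} \<subseteq> generate H (D \<union> (\<lambda>_. s) ` {?C})"
      using BD by (auto intro: generate.incl)
    then have "E \<subseteq> generate H (D \<union> (\<lambda>_. s) ` {?C})"
      using E1(8) generate_subgroup_incl[OF _ sub] by simp
    moreover have "t \<in> generate H (D \<union> (\<lambda>_. s) ` {?C})"
      using t by (auto intro: generate.incl)
    ultimately show "F \<subseteq> generate H (D \<union> (\<lambda>_. s) ` {?C})"
      using E2(8) generate_subgroup_incl[OF _ sub, of "E \<union> {t}"] by simp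
    show "generate H (D \<union> (\<lambda>_. s) ` {?C}) \<subseteq> F"
      using DF s E2(4) by (intro generate_subgroup_incl[OF _ E2(3)]) auto
  qed
  have \<theta>_base: "\<theta> x = b x" if "x \<in> D" for x
  proof (rule extension_by_hom_eq[OF ext3 P _ b_hom _ _ that])
    show "\<theta> \<in> hom (subgrp H D) ?P"
      using \<theta>(1) DF by (rule hom_subgrp_mono)
  qed (use \<theta> \<phi> BE in auto)
  show "single_extension H D ?C s F"
  proof (rule extension_byI[OF E3(1,3) _ _ _ F \<theta>(1)])
    show "subgroup C' H \<and> C' \<subseteq> D" if "C' \<in> {?C}" for C'
      using that C by simp
    show "c \<otimes> s = s \<otimes> c" if "C' \<in> {?C}" "c \<in> C'" for C' c
      using that s_centralizes[of c] by (auto simp: centralizer_def)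
    show "\<theta> k = base_class H D {?C} k" if "k \<in> D" for k
      using \<theta>_base[OF that] by (simp add: b_def)
    show "\<theta> s = stable_class H D {?C} C'" if "C' \<in> {?C}" for C'
      using that \<theta>(2)[OF s] \<phi>(3) by (simp add: st_def)
  qed simp
qed

section \<open>Iterated extensions of centralizers\<close>

lemma is_extension_of_centralizers_iff:
  assumes "group H" "subgroup A H" "subgroup B H" "\<And>C. C \<in> \<C> \<Longrightarrow> subgroup C H \<and> C \<subseteq> A"
  shows "is_extension_of_centralizers (subgrp H A) \<C> (subgrp H B) \<longleftrightarrow> (\<exists>\<tau>. extension_by H A \<C> \<tau> B)"
proof
  assume "is_extension_of_centralizers (subgrp H A) \<C> (subgrp H B)"
  then obtain \<psi> where \<psi>: "\<psi> \<in> iso (extend_centralizers (subgrp H A) \<C>) (subgrp H B)"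
      "\<forall>k\<in>A. \<psi> (base_class H A \<C> k) = k"
    by (auto simp: is_extension_of_centralizers_def base_class_def)
  then have "extension_by H A \<C> (\<lambda>C. \<psi> (stable_class H A \<C> C)) B"
    using assms by (auto simp: extension_by_def)
  then show "\<exists>\<tau>. extension_by H A \<C> \<tau> B"
    by blast
qed (auto simp: is_extension_of_centralizers_def base_class_def extension_by_def)

lemma ICE_step_iff:
  assumes "group H"
  shows "ICE_step H A B \<longleftrightarrow>
    (\<exists>u\<in>A. u \<noteq> \<one>\<^bsub>H\<^esub> \<and> (\<exists>t. single_extension H A (centralizer_in H A u) t B))"
proof
  assume "ICE_step H A B"
  then obtain u where u: "subgroup A H" "subgroup B H" "u \<in> A" "u \<noteq> \<one>\<^bsub>H\<^esub>"
      "is_extension_of_centralizers (subgrp H A) {centralizer_in H A u} (subgrp H B)"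
    by (auto simp: ICE_step_def)
  then obtain \<tau> where "extension_by H A {centralizer_in H A u} \<tau> B"
    using is_extension_of_centralizers_iff[of H A B "{centralizer_in H A u}"] assms
      subgroup_centralizer_in[of H A u] by auto
  then have "single_extension H A (centralizer_in H A u) (\<tau> (centralizer_in H A u)) B"
    by (simp add: extension_by_def)
  then show "\<exists>u\<in>A. u \<noteq> \<one>\<^bsub>H\<^esub> \<and> (\<exists>t. single_extension H A (centralizer_in H A u) t B)"
    using u by blast
next
  assume "\<exists>u\<in>A. u \<noteq> \<one>\<^bsub>H\<^esub> \<and> (\<exists>t. single_extension H A (centralizer_in H A u) t B)"
  then obtain u t where u: "u \<in> A" "u \<noteq> \<one>\<^bsub>H\<^esub>" and ext: "single_extension H A (centralizer_in H A u) t B"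
    by blast
  note E = extension_byD[OF ext]
  have "is_extension_of_centralizers (subgrp H A) {centralizer_in H A u} (subgrp H B)"
    using is_extension_of_centralizers_iff[of H A B "{centralizer_in H A u}"] E(1-3,6,7) ext by blast
  then show "ICE_step H A B"
    using E(2-4) u by (auto simp: ICE_step_def)
qed

lemma ICE_le_refl: "subgroup A H \<Longrightarrow> ICE_le H A A"
  by (simp add: ICE_le_def)

lemma ICE_le_trans: "ICE_le H A B \<Longrightarrow> ICE_le H B C \<Longrightarrow> ICE_le H A C"
  by (auto simp: ICE_le_def)

lemma ICE_step_imp_le: "ICE_step H A B \<Longrightarrow> ICE_le H A B"
  by (simp add: ICE_le_def r_into_rtranclp) (simp add: ICE_step_def)

lemma ICE_leD:
  assumes "ICE_le H A B"
  shows "subgroup A H" "subgroup B H" "A \<subseteq> B"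
proof -
  have A: "subgroup A H" and "(ICE_step H)\<^sup>*\<^sup>* A B"
    using assms by (auto simp: ICE_le_def)
  from this(2) have "subgroup B H \<and> A \<subseteq> B"
    by (induction rule: rtranclp_induct) (use A in \<open>auto simp: ICE_step_def\<close>)
  with A show "subgroup A H" "subgroup B H" "A \<subseteq> B"
    by auto
qed

lemma ICE_le_induct [consumes 1, case_names refl step]:
  assumes "ICE_le H A B" "P A"
    and "\<And>B C. ICE_le H A B \<Longrightarrow> ICE_step H B C \<Longrightarrow> P B \<Longrightarrow> P C"
  shows "P B"
proof -
  have A: "subgroup A H" and "(ICE_step H)\<^sup>*\<^sup>* A B"
    using assms by (auto simp: ICE_le_def)
  from this(2) show ?thesis
    by (induction rule: rtranclp_induct) (use A assms in \<open>auto simp: ICE_le_def\<close>)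
qed

lemma single_extension_imp_step:
  assumes "single_extension H A (centralizer_in H A u) t B" "u \<in> A" "u \<noteq> \<one>\<^bsub>H\<^esub>"
  shows "ICE_step H A B"
  using assms ICE_step_iff[OF extension_byD(1)[OF assms(1)]] by blast

lemma ICE_le_transport:
  assumes "ICE_le G A B" "group G" "group M" "h \<in> hom (subgrp G B) M" "inj_on h B"
  shows "ICE_le M (h ` A) (h ` B)"
  using assms(1,4,5)
proof (induction rule: ICE_le_induct)
  case refl
  interpret h: group_hom "subgrp G A" M h
    using refl assms ICE_leD(1)[OF assms(1)] group.subgroup_imp_group[OF assms(2)]
    by (simp add: group_hom_def group_hom_axioms_def)
  show ?case
    using h.img_is_subgroup by (simp add: ICE_le_refl)
next
  case (step B C)
  obtain u t where u: "u \<in> B" "u \<noteq> \<one>\<^bsub>G\<^esub>" and ext: "single_extension G B (centralizer_in G B u) t C"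
    using step.hyps(2) ICE_step_iff[OF assms(2)] by blast
  note E = extension_byD[OF ext]
  interpret G: group G by fact
  interpret h: group_hom "subgrp G C" M h
    using step.prems assms G.subgroup_imp_group[OF E(3)] by (simp add: group_hom_def group_hom_axioms_def)
  have inj: "h x = h y \<longleftrightarrow> x = y" if "x \<in> C" "y \<in> C" for x y
    using inj_on_eq_iff[OF step.prems(2) that] .
  have mult: "h (x \<otimes>\<^bsub>G\<^esub> y) = h x \<otimes>\<^bsub>M\<^esub> h y" if "x \<in> C" "y \<in> C" for x y
    using h.hom_mult[of x y] that by simp
  have closed: "x \<otimes>\<^bsub>G\<^esub> y \<in> C" if "x \<in> C" "y \<in> C" for x y
    using subgroup.m_closed[OF E(3)] that by blast
  have uC: "u \<in> C"
    using u E(4) by blast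
  have "h x \<otimes>\<^bsub>M\<^esub> h u = h u \<otimes>\<^bsub>M\<^esub> h x \<longleftrightarrow> x \<otimes>\<^bsub>G\<^esub> u = u \<otimes>\<^bsub>G\<^esub> x" if "x \<in> B" for x
    using that E(4) uC inj[OF closed closed] by (simp add: subset_iff flip: mult)
  then have "h ` centralizer_in G B u = centralizer_in M (h ` B) (h u)"
    by (auto simp: centralizer_def)
  then have "single_extension M (h ` B) (centralizer_in M (h ` B) (h u)) (h t) (h ` C)"
    using single_extension_transport[OF ext assms(3) step.prems] by simp
  moreover have "h u \<noteq> \<one>\<^bsub>M\<^esub>"
    using u uC inj[of u "\<one>\<^bsub>G\<^esub>"] h.hom_one subgroup.one_closed[OF E(3)] by simp
  ultimately have "ICE_step M (h ` B) (h ` C)"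
    using u by (intro single_extension_imp_step) auto
  moreover have "ICE_le M (h ` A) (h ` B)"
    using step.IH hom_subgrp_mono[OF step.prems(1) E(4)] inj_on_subset[OF step.prems(2) E(4)] by blast
  ultimately show ?case
    using ICE_le_trans ICE_step_imp_le by blast
qed

lemma single_extension_push:
  assumes "ICE_le H A A'" "single_extension H A' (centralizer_in H A' u) t F" "u \<in> A" "u \<noteq> \<one>\<^bsub>H\<^esub>"
  defines "D \<equiv> generate H (A \<union> {t})"
  shows "single_extension H A (centralizer_in H A u) t D" "ICE_le H D F"
proof -
  have H: "group H"
    using extension_byD(1)[OF assms(2)] .
  have "(ICE_step H)\<^sup>*\<^sup>* A A'"
    using assms(1) by (simp add: ICE_le_def)
  then have "u \<in> A \<longrightarrow> single_extension H A (centralizer_in H A u) t (generate H (A \<union> {t})) \<and>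
      ICE_le H (generate H (A \<union> {t})) F"
  proof (induction rule: converse_rtranclp_induct)
    case base
    then show ?case
      using assms(2) extension_byD(3,8)[OF assms(2)] by (auto intro: ICE_le_refl)
  next
    case (step A A1)
    show ?case
    proof
      assume u: "u \<in> A"
      obtain v s where v: "v \<in> A" "v \<noteq> \<one>\<^bsub>H\<^esub>" and ext: "single_extension H A (centralizer_in H A v) s A1"
        using step.hyps(1) ICE_step_iff[OF H] by blast
      have u1: "u \<in> A1"
        using u extension_byD(4)[OF ext] by blast
      have IH: "single_extension H A1 (centralizer_in H A1 u) t (generate H (A1 \<union> {t}))"
          "ICE_le H (generate H (A1 \<union> {t})) F"
        using step.IH u1 by blast+
      note swap = single_extension_swap[OF ext IH(1) u v(1)]
      have "v \<in> generate H (A \<union> {t})"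
        using v by (auto intro: generate.incl)
      then have "ICE_step H (generate H (A \<union> {t})) (generate H (A1 \<union> {t}))"
        using single_extension_imp_step[OF swap(2)] v(2) by blast
      then show "single_extension H A (centralizer_in H A u) t (generate H (A \<union> {t})) \<and>
          ICE_le H (generate H (A \<union> {t})) F"
        using swap(1) IH(2) ICE_le_trans ICE_step_imp_le by blast
    qed
  qed
  with assms(3) show "single_extension H A (centralizer_in H A u) t D" "ICE_le H D F"
    by (auto simp: D_def)
qed

section \<open>Back and forth\<close>

text \<open>The analogue of the richness of a Fraisse limit, for the relation \<open>\<le>\<^sub>I\<^sub>C\<^sub>E\<close>.\<close>

definition rich :: "'h monoid \<Rightarrow> 'h set \<Rightarrow> 'h set set \<Rightarrow> bool" where
  "rich H A\<^sub>0 \<S> \<longleftrightarrow> group H \<and> A\<^sub>0 \<in> \<S> \<and> (\<forall>A\<in>\<S>. subgroup A H) \<and>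
     (\<forall>A\<in>\<S>. \<forall>h\<in>carrier H. \<exists>A'\<in>\<S>. ICE_le H A A' \<and> h \<in> A') \<and>
     (\<forall>A\<in>\<S>. \<forall>u\<in>A. u \<noteq> \<one>\<^bsub>H\<^esub> \<longrightarrow> (\<exists>t. \<exists>B\<in>\<S>. single_extension H A (centralizer_in H A u) t B))"

lemma rich_extend_iso:
  assumes H: "group H" and L: "rich L B\<^sub>0 \<S>" and le: "ICE_le H A A'" and B: "B \<in> \<S>"
    and f: "f \<in> iso (subgrp H A) (subgrp L B)"
  shows "\<exists>B'\<in>\<S>. \<exists>g\<in>iso (subgrp H A') (subgrp L B'). B \<subseteq> B' \<and> (\<forall>x\<in>A. g x = f x)"
  using le
proof (induction rule: ICE_le_induct)
  case refl
  then show ?case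
    using B f by blast
next
  case (step Y Z)
  interpret H: group H by fact
  obtain C g where C: "C \<in> \<S>" "B \<subseteq> C" and g: "g \<in> iso (subgrp H Y) (subgrp L C)" "\<And>x. x \<in> A \<Longrightarrow> g x = f x"
    using step.IH by blast
  obtain u t where u: "u \<in> Y" "u \<noteq> \<one>\<^bsub>H\<^esub>" and ext: "single_extension H Y (centralizer_in H Y u) t Z"
    using step.hyps(2) ICE_step_iff[OF H] by blast
  note E = extension_byD[OF ext]
  have L': "group L" "subgroup C L"
    using L C by (auto simp: rich_def)
  interpret L: group L by fact
  interpret g: group_hom "subgrp H Y" "subgrp L C" g
    using g(1) L.subgroup_imp_group[OF L'(2)] H.subgroup_imp_group[OF E(2)]
    by (simp add: group_hom_def group_hom_axioms_def iso_def)
  have bij: "bij_betw g Y C"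
    using g(1) by (simp add: iso_def)
  have inj: "g x = g y \<longleftrightarrow> x = y" if "x \<in> Y" "y \<in> Y" for x y
    using bij that by (auto simp: bij_betw_def inj_on_eq_iff)
  have mult: "g (x \<otimes>\<^bsub>H\<^esub> y) = g x \<otimes>\<^bsub>L\<^esub> g y" if "x \<in> Y" "y \<in> Y" for x y
    using g.hom_mult[of x y] that by simp
  have closed: "x \<otimes>\<^bsub>H\<^esub> y \<in> Y" if "x \<in> Y" "y \<in> Y" for x y
    using subgroup.m_closed[OF E(2)] that by blast
  have gu: "g u \<in> C" "g u \<noteq> \<one>\<^bsub>L\<^esub>"
    using bij u inj[of u "\<one>\<^bsub>H\<^esub>"] g.hom_one subgroup.one_closed[OF E(2)] by (auto simp: bij_betw_def)
  then obtain t' D where D: "D \<in> \<S>" "single_extension L C (centralizer_in L C (g u)) t' D"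
    using L C unfolding rich_def by meson
  have "g x \<otimes>\<^bsub>L\<^esub> g u = g u \<otimes>\<^bsub>L\<^esub> g x \<longleftrightarrow> x \<otimes>\<^bsub>H\<^esub> u = u \<otimes>\<^bsub>H\<^esub> x" if "x \<in> Y" for x
    using that u inj[OF closed closed] by (simp flip: mult)
  then have "g ` centralizer_in H Y u = centralizer_in L C (g u)"
    using bij by (auto simp: centralizer_def bij_betw_def)
  then have "single_extension L C (g ` centralizer_in H Y u) t' D"
    using D(2) by simp
  then obtain k where k: "k \<in> iso (subgrp H Z) (subgrp L D)" "\<forall>x\<in>Y. k x = g x"
    using single_extension_iso[OF ext _ g(1)] by blast
  moreover have "B \<subseteq> D" "\<forall>x\<in>A. k x = f x"
    using C(2) extension_byD(4)[OF D(2)] k(2) g(2) ICE_leD(3)[OF step.hyps(1)] by auto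
  ultimately show ?case
    using D(1) by blast
qed

lemma iso_subgrp_inverse:
  assumes "group H" "subgroup A H" "f \<in> iso (subgrp H A) (subgrp L B)"
  shows "inv_into A f \<in> iso (subgrp L B) (subgrp H A)"
  using group.iso_set_sym[OF group.subgroup_imp_group[OF assms(1,2)] assms(3)] by simp

lemma rich_step:
  assumes H: "rich H A\<^sub>0 \<S>" and L: "rich L B\<^sub>0 \<T>" and A: "A \<in> \<S>" and B: "B \<in> \<T>"
    and f: "f \<in> iso (subgrp H A) (subgrp L B)" and h: "h \<in> carrier H" and l: "l \<in> carrier L"
  shows "\<exists>A'\<in>\<S>. \<exists>B'\<in>\<T>. \<exists>g\<in>iso (subgrp H A') (subgrp L B').
    A \<subseteq> A' \<and> B \<subseteq> B' \<and> h \<in> A' \<and> l \<in> B' \<and> (\<forall>x\<in>A. g x = f x)"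
proof -
  have grp: "group H" "group L"
    using H L by (auto simp: rich_def)
  obtain A1 where A1: "A1 \<in> \<S>" "ICE_le H A A1" "h \<in> A1"
    using H A h unfolding rich_def by meson
  obtain B1 g where B1: "B1 \<in> \<T>" "B \<subseteq> B1" and g: "g \<in> iso (subgrp H A1) (subgrp L B1)" "\<forall>x\<in>A. g x = f x"
    using rich_extend_iso[OF grp(1) L A1(2) B f] by blast
  obtain B2 where B2: "B2 \<in> \<T>" "ICE_le L B1 B2" "l \<in> B2"
    using L B1(1) l unfolding rich_def by meson
  have sub: "subgroup A1 H" "subgroup B2 L"
    using H A1 L B2 by (auto simp: rich_def)
  obtain A2 k where A2: "A2 \<in> \<S>" "A1 \<subseteq> A2" and k: "k \<in> iso (subgrp L B2) (subgrp H A2)"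
      "\<forall>y\<in>B1. k y = inv_into A1 g y"
    using rich_extend_iso[OF grp(2) H B2(2) A1(1) iso_subgrp_inverse[OF grp(1) sub(1) g(1)]] by blast
  have k': "inv_into B2 k \<in> iso (subgrp H A2) (subgrp L B2)"
    using iso_subgrp_inverse[OF grp(2) sub(2) k(1)] .
  have "inv_into B2 k x = f x" if x: "x \<in> A" for x
  proof -
    have x1: "x \<in> A1"
      using x ICE_leD(3)[OF A1(2)] by blast
    have gx: "g x \<in> B1" and inj: "inj_on g A1" and injk: "inj_on k B2"
      using g(1) k(1) x1 by (auto simp: iso_def bij_betw_def)
    have "k (g x) = x"
      using k(2) gx inv_into_f_f[OF inj x1] by simp
    then have "inv_into B2 k x = g x"
      using inv_into_f_f[OF injk, of "g x"] gx ICE_leD(3)[OF B2(2)] by auto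
    then show ?thesis
      using g(2) x by simp
  qed
  moreover have "A \<subseteq> A2" "B \<subseteq> B2" "h \<in> A2"
    using A2(2) A1(3) ICE_leD(3)[OF A1(2)] ICE_leD(3)[OF B2(2)] B1(2) by auto
  ultimately show ?thesis
    using B2(3) by (intro bexI[OF _ A2(1)] bexI[OF _ B2(1)] bexI[OF _ k']) simp
qed

theorem rich_isomorphic:
  assumes H: "rich H A\<^sub>0 \<S>" and L: "rich L B\<^sub>0 \<T>" and f: "f \<in> iso (subgrp H A\<^sub>0) (subgrp L B\<^sub>0)"
    and count: "countable (carrier H)" "countable (carrier L)"
  shows "\<exists>F\<in>iso H L. \<forall>x\<in>A\<^sub>0. F x = f x"
proof -
  have grp: "group H" "group L"
    using H L by (auto simp: rich_def)
  interpret H: group H by (rule grp(1))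
  interpret L: group L by (rule grp(2))
  define a where "a = from_nat_into (carrier H)"
  define b where "b = from_nat_into (carrier L)"
  have a: "a n \<in> carrier H" and b: "b n \<in> carrier L" for n
    unfolding a_def b_def
    by (rule from_nat_into[OF H.carrier_not_empty], rule from_nat_into[OF L.carrier_not_empty])
  define P where "P = (\<lambda>s :: 'a set \<times> 'b set \<times> ('a \<Rightarrow> 'b). case s of (A, B, g) \<Rightarrow>
      A \<in> \<S> \<and> B \<in> \<T> \<and> g \<in> iso (subgrp H A) (subgrp L B))"
  define Q where "Q = (\<lambda>n (s :: 'a set \<times> 'b set \<times> ('a \<Rightarrow> 'b)) s'. case s of (A, B, g) \<Rightarrow> case s' of (A', B', g') \<Rightarrow>
      A \<subseteq> A' \<and> B \<subseteq> B' \<and> a n \<in> A' \<and> b n \<in> B' \<and> (\<forall>x\<in>A. g' x = g x))"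
  have "\<exists>s. \<forall>n. (P (s n) \<and> (n = 0 \<longrightarrow> s n = (A\<^sub>0, B\<^sub>0, f))) \<and> Q n (s n) (s (Suc n))"
  proof (rule dependent_nat_choice)
    show "\<exists>s. P s \<and> (0 = 0 \<longrightarrow> s = (A\<^sub>0, B\<^sub>0, f))"
      using H L f by (auto simp: P_def rich_def)
    fix s and n :: nat
    assume "P s \<and> (n = 0 \<longrightarrow> s = (A\<^sub>0, B\<^sub>0, f))"
    then have "P s" ..
    then obtain A B g where s: "s = (A, B, g)" "A \<in> \<S>" "B \<in> \<T>" "g \<in> iso (subgrp H A) (subgrp L B)"
      by (cases s) (auto simp: P_def)
    obtain A' B' g' where "A' \<in> \<S>" "B' \<in> \<T>" "g' \<in> iso (subgrp H A') (subgrp L B')"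
        "A \<subseteq> A'" "B \<subseteq> B'" "a n \<in> A'" "b n \<in> B'" "\<forall>x\<in>A. g' x = g x"
      using rich_step[OF H L s(2-4) a[of n] b[of n]] by blast
    then have "P (A', B', g') \<and> Q n s (A', B', g')"
      by (simp add: P_def Q_def s(1))
    then show "\<exists>s'. (P s' \<and> (Suc n = 0 \<longrightarrow> s' = (A\<^sub>0, B\<^sub>0, f))) \<and> Q n s s'"
      by blast
  qed
  then obtain s where s: "\<forall>n. (P (s n) \<and> (n = 0 \<longrightarrow> s n = (A\<^sub>0, B\<^sub>0, f))) \<and> Q n (s n) (s (Suc n))"
    by blast
  have s0: "s 0 = (A\<^sub>0, B\<^sub>0, f)" and Ps: "P (s n)" and Qs: "Q n (s n) (s (Suc n))" for n
    using s by blast+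
  define A B g where "A = (\<lambda>n. fst (s n))" and "B = (\<lambda>n. fst (snd (s n)))" and "g = (\<lambda>n. snd (snd (s n)))"
  have s_eq: "s n = (A n, B n, g n)" for n
    by (simp add: A_def B_def g_def)
  have AB: "A n \<in> \<S>" "B n \<in> \<T>" "g n \<in> iso (subgrp H (A n)) (subgrp L (B n))" for n
    using Ps[of n] by (simp_all add: P_def s_eq)
  have step: "A n \<subseteq> A (Suc n)" "B n \<subseteq> B (Suc n)" "a n \<in> A (Suc n)" "b n \<in> B (Suc n)"
      "x \<in> A n \<Longrightarrow> g (Suc n) x = g n x" for n x
    using Qs[of n] by (simp_all add: Q_def s_eq)
  have A_mono: "A m \<subseteq> A n" if "m \<le> n" for m n
    using lift_Suc_mono_le[of A] step(1) that by blast
  have g_mono: "g n x = g m x" if "m \<le> n" "x \<in> A m" for m n x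
    using that
  proof (induction n rule: dec_induct)
    case (step n)
    then show ?case
      using \<open>\<And>x n. x \<in> A n \<Longrightarrow> g (Suc n) x = g n x\<close> A_mono[of m n] by auto
  qed simp
  have A_sub: "subgroup (A n) H" and B_sub: "subgroup (B n) L" for n
    using H L AB[of n] by (auto simp: rich_def)
  have bij: "bij_betw (g n) (A n) (B n)" and hom: "g n \<in> hom (subgrp H (A n)) (subgrp L (B n))" for n
    using AB(3)[of n] by (auto simp: iso_def)
  have A_cover: "\<exists>n. x \<in> A n" if "x \<in> carrier H" for x
    using from_nat_into_surj[OF count(1) that] step(3) by (auto simp: a_def)
  have B_cover: "\<exists>n. y \<in> B n" if "y \<in> carrier L" for y
    using from_nat_into_surj[OF count(2) that] step(4) by (auto simp: b_def)
  define F where "F = (\<lambda>x. g (LEAST n. x \<in> A n) x)"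
  have F: "F x = g n x" if "x \<in> A n" for x n
  proof -
    have "x \<in> A (LEAST n. x \<in> A n)"
      using that by (rule LeastI)
    moreover have "(LEAST n. x \<in> A n) \<le> n"
      using that by (rule Least_le)
    ultimately show ?thesis
      using g_mono by (simp add: F_def)
  qed
  have common: "\<exists>n. x \<in> A n \<and> y \<in> A n" if xy: "x \<in> carrier H" "y \<in> carrier H" for x y
  proof -
    obtain m n where "x \<in> A m" "y \<in> A n"
      using A_cover[OF xy(1)] A_cover[OF xy(2)] by blast
    then have "x \<in> A (max m n)" "y \<in> A (max m n)"
      using A_mono[of m "max m n"] A_mono[of n "max m n"] by auto
    then show ?thesis
      by blast
  qed
  have "F \<in> hom H L"
  proof (rule homI)
    show "F x \<in> carrier L" if x: "x \<in> carrier H" for x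
    proof -
      obtain n where n: "x \<in> A n"
        using A_cover[OF x] by blast
      then have "g n x \<in> B n"
        using bij[of n] by (auto simp: bij_betw_def)
      then show ?thesis
        using F[OF n] subgroup.subset[OF B_sub[of n]] by auto
    qed
    show "F (x \<otimes>\<^bsub>H\<^esub> y) = F x \<otimes>\<^bsub>L\<^esub> F y" if xy: "x \<in> carrier H" "y \<in> carrier H" for x y
    proof -
      obtain n where n: "x \<in> A n" "y \<in> A n"
        using common[OF xy] by blast
      then have "x \<otimes>\<^bsub>H\<^esub> y \<in> A n"
        using subgroup.m_closed[OF A_sub] by blast
      then show ?thesis
        using n hom_mult[OF hom[of n], of x y] by (simp add: F)
    qed
  qed
  moreover have "bij_betw F (carrier H) (carrier L)"
    unfolding bij_betw_def
  proof
    show "inj_on F (carrier H)"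
    proof (rule inj_onI)
      fix x y
      assume xy: "x \<in> carrier H" "y \<in> carrier H" "F x = F y"
      obtain n where n: "x \<in> A n" "y \<in> A n"
        using common[OF xy(1,2)] by blast
      then show "x = y"
        using xy(3) F bij[of n] by (auto simp: bij_betw_def dest: inj_onD)
    qed
    show "F ` carrier H = carrier L"
    proof
      show "F ` carrier H \<subseteq> carrier L"
        using \<open>F \<in> hom H L\<close> by (auto simp: hom_def)
      show "carrier L \<subseteq> F ` carrier H"
      proof
        fix y
        assume "y \<in> carrier L"
        then obtain n where "y \<in> B n"
          using B_cover by blast
        then obtain x where x: "x \<in> A n" "y = g n x"
          using bij[of n] by (auto simp: bij_betw_def)
        then have "y = F x" "x \<in> carrier H"
          using F subgroup.subset[OF A_sub[of n]] by auto
        then show "y \<in> F ` carrier H"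
          by blast
      qed
    qed
  qed
  ultimately have "F \<in> iso H L"
    by (simp add: iso_def)
  moreover have "F x = f x" if "x \<in> A\<^sub>0" for x
    using F[of x 0] that s0 s_eq[of 0] by simp
  ultimately show ?thesis
    by blast
qed

section \<open>The stages of Lyndon's completion\<close>

lemma generate_absorb:
  assumes "group H" "S \<subseteq> carrier H" "S' \<subseteq> carrier H"
  shows "generate H (generate H S \<union> S') = generate H (S \<union> S')"
proof
  interpret group H by fact
  have sub: "subgroup (generate H (S \<union> S')) H"
    using assms by (intro generate_is_subgroup) auto
  have "generate H S \<subseteq> generate H (S \<union> S')"
    by (rule mono_generate) auto
  moreover have "S' \<subseteq> generate H (S \<union> S')"
    by (auto intro: generate.incl)
  ultimately show "generate H (generate H S \<union> S') \<subseteq> generate H (S \<union> S')"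
    by (intro generate_subgroup_incl[OF _ sub]) auto
  show "generate H (S \<union> S') \<subseteq> generate H (generate H S \<union> S')"
    by (rule mono_generate) (auto intro: generate.incl)
qed

lemma single_extension_conj:
  assumes ext: "single_extension H A (centralizer_in H A p) t B" and g: "g \<in> A" "p \<in> A"
  shows "single_extension H A (centralizer_in H A (g \<otimes>\<^bsub>H\<^esub> p \<otimes>\<^bsub>H\<^esub> inv\<^bsub>H\<^esub> g)) (g \<otimes>\<^bsub>H\<^esub> t \<otimes>\<^bsub>H\<^esub> inv\<^bsub>H\<^esub> g) B"
proof -
  note E = extension_byD[OF ext]
  interpret group H by (rule E(1))
  define h where "h = (\<lambda>x. g \<otimes>\<^bsub>H\<^esub> x \<otimes>\<^bsub>H\<^esub> inv\<^bsub>H\<^esub> g)"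
  have mem: "x \<in> carrier H" if "x \<in> B" for x
    using that subgroup.mem_carrier[OF E(3)] by blast
  have gG: "g \<in> carrier H" and gB: "g \<in> B"
    using g E(4) mem by auto
  have image: "h ` S = S" if S: "subgroup S H" "g \<in> S" for S
  proof
    have SG: "x \<in> carrier H" if "x \<in> S" for x
      using subgroup.mem_carrier[OF S(1)] that .
    have S_inv: "inv\<^bsub>H\<^esub> g \<in> S"
      using subgroup.m_inv_closed[OF S] .
    show "h ` S \<subseteq> S"
      using S S_inv subgroup.m_closed[OF S(1)] by (auto simp: h_def)
    show "S \<subseteq> h ` S"
    proof
      fix x
      assume x: "x \<in> S"
      then have "x = h (inv\<^bsub>H\<^esub> g \<otimes>\<^bsub>H\<^esub> x \<otimes>\<^bsub>H\<^esub> g)"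
        using SG[OF x] gG by (simp add: h_def m_assoc)
      moreover have "inv\<^bsub>H\<^esub> g \<otimes>\<^bsub>H\<^esub> x \<otimes>\<^bsub>H\<^esub> g \<in> S"
        using x S S_inv subgroup.m_closed[OF S(1)] by blast
      ultimately show "x \<in> h ` S"
        by blast
    qed
  qed
  have "h \<in> hom (subgrp H B) H"
    using mem gG by (intro homI) (auto simp: h_def m_assoc)
  moreover have "inj_on h B"
    using mem gG by (auto simp: inj_on_def h_def conj_inj)
  ultimately have "single_extension H (h ` A) (h ` centralizer_in H A p) (h t) (h ` B)"
    by (rule single_extension_transport[OF ext E(1)])
  moreover have "h ` centralizer_in H A p = centralizer_in H A (h p)"
  proof -
    have comm: "h x \<otimes>\<^bsub>H\<^esub> h p = h p \<otimes>\<^bsub>H\<^esub> h x \<longleftrightarrow> x \<otimes>\<^bsub>H\<^esub> p = p \<otimes>\<^bsub>H\<^esub> x" if "x \<in> A" for x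
      unfolding h_def using that g E(4) mem gG by (intro conj_commute_iff) auto
    have hA: "h ` A = A"
      by (rule image[OF E(2) g(1)])
    show ?thesis
    proof
      show "h ` centralizer_in H A p \<subseteq> centralizer_in H A (h p)"
        using comm hA by (auto simp: centralizer_def)
      show "centralizer_in H A (h p) \<subseteq> h ` centralizer_in H A p"
      proof
        fix y
        assume y: "y \<in> centralizer_in H A (h p)"
        then obtain x where "x \<in> A" "y = h x"
          using hA by (auto simp: centralizer_def)
        then show "y \<in> h ` centralizer_in H A p"
          using comm y by (auto simp: centralizer_def)
      qed
    qed
  qed
  ultimately show ?thesis
    using image[OF E(2) g(1)] image[OF E(3) gB] by (simp add: h_def)
qed

locale centralizer_level = group L for L :: "'l monoid" (structure) +
  fixes \<Gamma> :: "'l set" and \<C> :: "'l set set" and \<tau> :: "'l set \<Rightarrow> 'l" and \<Gamma>' :: "'l set"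
  assumes ext: "extension_by L \<Gamma> \<C> \<tau> \<Gamma>'"
    and csa: "CSA_torsion_free_on L \<Gamma>"
    and reps: "centralizer_representatives (subgrp L \<Gamma>) \<C>"
begin

lemmas E = extension_byD[OF ext]

lemma \<Gamma>'_carrier: "x \<in> \<Gamma>' \<Longrightarrow> x \<in> carrier L"
  using subgroup.mem_carrier[OF E(3)] .

lemma \<Gamma>_carrier [simp]: "x \<in> \<Gamma> \<Longrightarrow> x \<in> carrier L"
  using subgroup.mem_carrier[OF E(2)] .

lemma \<Gamma>_closed [simp]: "x \<in> \<Gamma> \<Longrightarrow> y \<in> \<Gamma> \<Longrightarrow> x \<otimes> y \<in> \<Gamma>" "x \<in> \<Gamma> \<Longrightarrow> inv x \<in> \<Gamma>"
  using E(2) by (auto simp: subgroup_def)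

lemma tau_carrier [simp]: "C \<in> \<C> \<Longrightarrow> \<tau> C \<in> carrier L"
  using E(5) \<Gamma>'_carrier by blast

lemma CT: "x \<in> \<Gamma> \<Longrightarrow> y \<in> \<Gamma> \<Longrightarrow> z \<in> \<Gamma> \<Longrightarrow> x \<noteq> \<one> \<Longrightarrow> x \<otimes> y = y \<otimes> x \<Longrightarrow> x \<otimes> z = z \<otimes> x \<Longrightarrow> y \<otimes> z = z \<otimes> y"
  and CS: "x \<in> \<Gamma> \<Longrightarrow> y \<in> \<Gamma> \<Longrightarrow> x \<noteq> \<one> \<Longrightarrow>
    x \<otimes> (inv y \<otimes> x \<otimes> y) = (inv y \<otimes> x \<otimes> y) \<otimes> x \<Longrightarrow> x \<otimes> y = y \<otimes> x"
  using csa unfolding CSA_torsion_free_on_def commutation_transitive_on_def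
    conjugately_separated_on_def by blast+

lemma rep_nontrivial:
  assumes "C \<in> \<C>"
  obtains u where "u \<in> \<Gamma>" "u \<noteq> \<one>" "C = centralizer_in L \<Gamma> u" "u \<in> C"
proof -
  obtain u where "u \<in> \<Gamma>" "u \<noteq> \<one>" "C = centralizer_in L \<Gamma> u"
    using reps assms by (auto simp: centralizer_representatives_def)
  moreover from this have "u \<in> C"
    by (simp add: centralizer_def)
  ultimately show ?thesis
    using that by blast
qed

lemma rep_eq_centralizer:
  assumes C: "C \<in> \<C>" and p: "p \<in> C" "p \<noteq> \<one>"
  shows "C = centralizer_in L \<Gamma> p"
proof -
  obtain u where u: "u \<in> \<Gamma>" "u \<noteq> \<one>" "C = centralizer_in L \<Gamma> u" "u \<in> C"
    using rep_nontrivial[OF C] .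
  have p\<Gamma>: "p \<in> \<Gamma>" "p \<otimes> u = u \<otimes> p"
    using p(1) u(3) by (auto simp: centralizer_def)
  have "y \<otimes> u = u \<otimes> y \<longleftrightarrow> y \<otimes> p = p \<otimes> y" if "y \<in> \<Gamma>" for y
    using CT[of u y p] CT[of p y u] that u(1,2) p(2) p\<Gamma> by metis
  then show ?thesis
    unfolding u(3) by (auto simp: centralizer_def)
qed

lemma conj_set_centralizer:
  assumes "g \<in> \<Gamma>" "k \<in> \<Gamma>"
  shows "conj_set (subgrp L \<Gamma>) (centralizer_in L \<Gamma> k) g = centralizer_in L \<Gamma> (inv g \<otimes> k \<otimes> g)"
proof -
  have inv_g: "inv\<^bsub>subgrp L \<Gamma>\<^esub> g = inv g"
    by (rule m_inv_consistent[OF E(2) assms(1)])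
  have shift: "(g \<otimes> y \<otimes> inv g) \<otimes> k = k \<otimes> (g \<otimes> y \<otimes> inv g) \<longleftrightarrow>
      y \<otimes> (inv g \<otimes> k \<otimes> g) = (inv g \<otimes> k \<otimes> g) \<otimes> y" if "y \<in> \<Gamma>" for y
    using conj_commute_shift[of y k g] that assms by simp
  show ?thesis
    unfolding conj_set_def inv_g
  proof
    show "(\<lambda>x. inv g \<otimes>\<^bsub>subgrp L \<Gamma>\<^esub> x \<otimes>\<^bsub>subgrp L \<Gamma>\<^esub> g) ` centralizer_in L \<Gamma> k
        \<subseteq> centralizer_in L \<Gamma> (inv g \<otimes> k \<otimes> g)"
    proof
      fix y
      assume "y \<in> (\<lambda>x. inv g \<otimes>\<^bsub>subgrp L \<Gamma>\<^esub> x \<otimes>\<^bsub>subgrp L \<Gamma>\<^esub> g) ` centralizer_in L \<Gamma> k"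
      then obtain x where x: "x \<in> \<Gamma>" "x \<otimes> k = k \<otimes> x" "y = inv g \<otimes> x \<otimes> g"
        by (auto simp: centralizer_def)
      have "g \<otimes> y \<otimes> inv g = x"
        using x(1) assms by (simp add: x(3) m_assoc)
      then show "y \<in> centralizer_in L \<Gamma> (inv g \<otimes> k \<otimes> g)"
        using shift[of y] x assms by (simp add: centralizer_def)
    qed
    show "centralizer_in L \<Gamma> (inv g \<otimes> k \<otimes> g)
        \<subseteq> (\<lambda>x. inv g \<otimes>\<^bsub>subgrp L \<Gamma>\<^esub> x \<otimes>\<^bsub>subgrp L \<Gamma>\<^esub> g) ` centralizer_in L \<Gamma> k"
    proof
      fix y
      assume "y \<in> centralizer_in L \<Gamma> (inv g \<otimes> k \<otimes> g)"
      then have y: "y \<in> \<Gamma>" "y \<otimes> (inv g \<otimes> k \<otimes> g) = (inv g \<otimes> k \<otimes> g) \<otimes> y"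
        by (auto simp: centralizer_def)
      have "y = inv g \<otimes> (g \<otimes> y \<otimes> inv g) \<otimes> g"
        using y assms by (simp add: m_assoc)
      moreover have "g \<otimes> y \<otimes> inv g \<in> centralizer_in L \<Gamma> k"
        using shift[OF y(1)] y assms by (simp add: centralizer_def)
      ultimately show "y \<in> (\<lambda>x. inv g \<otimes>\<^bsub>subgrp L \<Gamma>\<^esub> x \<otimes>\<^bsub>subgrp L \<Gamma>\<^esub> g) ` centralizer_in L \<Gamma> k"
        by (intro image_eqI[of _ _ "g \<otimes> y \<otimes> inv g"]) simp_all
    qed
  qed
qed

abbreviation "X \<equiv> conj_letters L \<Gamma> \<C> \<tau>"

lemma commute_letter_iff:
  assumes "k \<in> \<Gamma>" "g \<in> \<Gamma>" "C \<in> \<C>"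
  shows "k \<otimes> (g \<otimes> \<tau> C \<otimes> inv g) = (g \<otimes> \<tau> C \<otimes> inv g) \<otimes> k \<longleftrightarrow> inv g \<otimes> k \<otimes> g \<in> C"
  using conj_commute_shift[of "\<tau> C" k g] E(9)[OF assms(3), of "inv g \<otimes> k \<otimes> g"] assms by auto

lemma conj_nontrivial:
  assumes "k \<in> \<Gamma>" "g \<in> \<Gamma>" "k \<noteq> \<one>"
  shows "inv g \<otimes> k \<otimes> g \<noteq> \<one>"
  using conj_eq_iff[of "inv g" k \<one>] assms by auto

sublocale tame_extension L \<Gamma> X
proof (intro tame_extension.intro tame_extension_axioms.intro extension_by_free(1)[OF ext] csa)
  fix k x y
  assume k: "k \<in> \<Gamma>" "k \<noteq> \<one>" and "x \<in> X" "y \<in> X" and kx: "k \<otimes> x = x \<otimes> k" and ky: "k \<otimes> y = y \<otimes> k"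
  then obtain g C h D where x: "g \<in> \<Gamma>" "C \<in> \<C>" "x = g \<otimes> \<tau> C \<otimes> inv g"
    and y: "h \<in> \<Gamma>" "D \<in> \<C>" "y = h \<otimes> \<tau> D \<otimes> inv h"
    by (auto simp: conj_letters_def)
  define p q m where "p = inv g \<otimes> k \<otimes> g" and "q = inv h \<otimes> k \<otimes> h" and "m = inv g \<otimes> h"
  have pq: "p \<in> \<Gamma>" "q \<in> \<Gamma>" "m \<in> \<Gamma>" "p \<noteq> \<one>" "q \<noteq> \<one>"
    using k x y conj_nontrivial by (simp_all add: p_def q_def m_def)
  have pC: "p \<in> C" and qD: "q \<in> D"
    using commute_letter_iff[of k g C] commute_letter_iff[of k h D] kx ky k x y
    by (simp_all add: p_def q_def)
  have C: "C = conj_set (subgrp L \<Gamma>) (centralizer_in L \<Gamma> k) g"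
    using rep_eq_centralizer[OF x(2) pC pq(4)] conj_set_centralizer[OF x(1) k(1)] by (simp add: p_def)
  have D: "D = conj_set (subgrp L \<Gamma>) (centralizer_in L \<Gamma> k) h"
    using rep_eq_centralizer[OF y(2) qD pq(5)] conj_set_centralizer[OF y(1) k(1)] by (simp add: q_def)
  have "\<exists>!C. C \<in> \<C> \<and> (\<exists>g\<in>\<Gamma>. C = conj_set (subgrp L \<Gamma>) (centralizer_in L \<Gamma> k) g)"
    using reps k by (auto simp: centralizer_representatives_def)
  then have CD: "C = D"
    using C D x y by blast
  have "C = centralizer_in L \<Gamma> p"
    by (rule rep_eq_centralizer[OF x(2) pC pq(4)])
  then have "p \<otimes> q = q \<otimes> p"
    using qD CD by (auto simp: centralizer_def)
  moreover have "inv m \<otimes> p \<otimes> m = q"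
    using k x y by (simp add: p_def q_def m_def m_assoc inv_mult_group)
  ultimately have pm: "p \<otimes> m = m \<otimes> p"
    using CS[of p m] pq by simp
  then have "m \<in> C"
    using \<open>C = centralizer_in L \<Gamma> p\<close> pq by (simp add: centralizer_def)
  then have mC: "m \<otimes> \<tau> C = \<tau> C \<otimes> m"
    using E(9)[OF x(2), of m] pq by simp
  have h: "h = g \<otimes> m"
    using x y by (simp add: m_def)
  have "y = g \<otimes> (m \<otimes> \<tau> C) \<otimes> inv m \<otimes> inv g"
    using x y pq by (simp add: y(3) CD[symmetric] h inv_mult_group m_assoc)
  also have "\<dots> = x"
    using x pq by (simp add: x(3) mC m_assoc)
  finally show "x = y"
    by simp
next
  fix k l x
  assume k: "k \<in> \<Gamma>" "l \<in> \<Gamma>" and "x \<in> X" and kx: "k \<otimes> x = x \<otimes> k" "l \<otimes> x = x \<otimes> l"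
  then obtain g C where x: "g \<in> \<Gamma>" "C \<in> \<C>" "x = g \<otimes> \<tau> C \<otimes> inv g"
    by (auto simp: conj_letters_def)
  obtain u where u: "u \<in> \<Gamma>" "u \<noteq> \<one>" "C = centralizer_in L \<Gamma> u" "u \<in> C"
    using rep_nontrivial[OF x(2)] .
  have kl: "inv g \<otimes> k \<otimes> g \<in> C" "inv g \<otimes> l \<otimes> g \<in> C"
    using commute_letter_iff[of k g C] commute_letter_iff[of l g C] kx k x by simp_all
  then have "(inv g \<otimes> k \<otimes> g) \<otimes> (inv g \<otimes> l \<otimes> g) = (inv g \<otimes> l \<otimes> g) \<otimes> (inv g \<otimes> k \<otimes> g)"
    using CT[of u "inv g \<otimes> k \<otimes> g" "inv g \<otimes> l \<otimes> g"] u k x by (auto simp: centralizer_def)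
  then show "k \<otimes> l = l \<otimes> k"
    using conj_commute_iff[of k l "inv g"] k x by simp
qed

lemma span_level: "span = \<Gamma>'"
  using extension_by_free(2)[OF ext] .

lemma CSA_torsion_free_level: "CSA_torsion_free_on L \<Gamma>'"
  using CSA_torsion_free_span by (simp add: span_level)

definition without :: "'l set \<Rightarrow> 'l set" where
  "without C = generate L (\<Gamma> \<union> \<tau> ` (\<C> - {C}))"

lemma subgroup_without: "subgroup (without C) L"
  unfolding without_def by (rule generate_is_subgroup) auto

lemma base_in_without: "\<Gamma> \<subseteq> without C"
  by (auto simp: without_def intro: generate.incl)

lemma single_extension_without:
  assumes C: "C \<in> \<C>"
  shows "single_extension L (without C) C (\<tau> C) \<Gamma>'"
proof -
  let ?W = "without C"
  let ?P = "extend_centralizers (subgrp L ?W) {C}"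
  define b st where "b = base_class L ?W {C}" and "st = stable_class L ?W {C} C"
  have W: "subgroup ?W L"
    by (rule subgroup_without)
  have CW: "C \<subseteq> ?W"
    using E(7)[OF C] base_in_without by blast
  have P: "group ?P"
    by (rule group_extend_centralizers[OF is_group W])
  have b_hom: "b \<in> hom (subgrp L ?W) ?P"
    unfolding b_def by (rule base_class_hom[OF is_group W])
  have st: "st \<in> carrier ?P"
    unfolding st_def by (rule stable_class_carrier[OF is_group W]) simp
  have tau_W: "\<tau> D \<in> ?W" if "D \<in> \<C>" "D \<noteq> C" for D
    using that by (auto simp: without_def intro: generate.incl)
  have bP: "b x \<in> carrier ?P" if "x \<in> ?W" for x
    using hom_in_carrier[OF b_hom] that by simp
  have b_mult: "b (x \<otimes> y) = b x \<otimes>\<^bsub>?P\<^esub> b y" if "x \<in> ?W" "y \<in> ?W" for x y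
    using hom_mult[OF b_hom, of x y] that by simp
  define \<sigma> where "\<sigma> = (\<lambda>D. if D = C then st else b (\<tau> D))"
  obtain \<theta> where \<theta>: "\<theta> \<in> hom (subgrp L \<Gamma>') ?P" "\<And>k. k \<in> \<Gamma> \<Longrightarrow> \<theta> k = b k" "\<And>D. D \<in> \<C> \<Longrightarrow> \<theta> (\<tau> D) = \<sigma> D"
  proof (rule extension_by_universal[OF ext P, of b \<sigma>])
    show "b \<in> hom (subgrp L \<Gamma>) ?P"
      using b_hom base_in_without by (rule hom_subgrp_mono)
    show "\<sigma> D \<in> carrier ?P" if "D \<in> \<C>" for D
      using st bP tau_W that by (simp add: \<sigma>_def)
    show "b c \<otimes>\<^bsub>?P\<^esub> \<sigma> D = \<sigma> D \<otimes>\<^bsub>?P\<^esub> b c" if D: "D \<in> \<C>" "c \<in> D" for D c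
    proof (cases "D = C")
      case True
      then show ?thesis
        using stable_class_commute[OF is_group W, of C "{C}" c] D CW by (simp add: \<sigma>_def b_def st_def)
    next
      case False
      have c: "c \<in> \<Gamma>"
        using E(7)[OF D(1)] D(2) by blast
      then have "c \<otimes> \<tau> D = \<tau> D \<otimes> c"
        using E(9)[OF D(1)] D(2) by blast
      moreover have "c \<in> ?W"
        using c base_in_without by blast
      ultimately show ?thesis
        using b_mult[of c "\<tau> D"] b_mult[of "\<tau> D" c] tau_W[OF D(1) False] False by (simp add: \<sigma>_def)
    qed
  qed blast
  have W\<Gamma>': "?W \<subseteq> \<Gamma>'"
    unfolding without_def using E(4,5) by (intro generate_subgroup_incl[OF _ E(3)]) auto
  have \<Gamma>': "\<Gamma>' = generate L (?W \<union> (\<lambda>_. \<tau> C) ` {C})"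
  proof -
    have "generate L (?W \<union> {\<tau> C}) = generate L ((\<Gamma> \<union> \<tau> ` (\<C> - {C})) \<union> {\<tau> C})"
      unfolding without_def using C by (intro generate_absorb is_group) auto
    also have "(\<Gamma> \<union> \<tau> ` (\<C> - {C})) \<union> {\<tau> C} = \<Gamma> \<union> \<tau> ` \<C>"
      using C by auto
    finally show ?thesis
      using E(8) by simp
  qed
  have \<theta>_base: "\<theta> x = b x" if "x \<in> ?W" for x
  proof (rule hom_eq_on_generate[OF is_group P])
    show "\<Gamma> \<union> \<tau> ` (\<C> - {C}) \<subseteq> carrier L"
      by auto
    show "\<theta> \<in> hom (subgrp L (generate L (\<Gamma> \<union> \<tau> ` (\<C> - {C})))) ?P"
      using hom_subgrp_mono[OF \<theta>(1) W\<Gamma>'] by (simp add: without_def)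
    show "b \<in> hom (subgrp L (generate L (\<Gamma> \<union> \<tau> ` (\<C> - {C})))) ?P"
      using b_hom by (simp add: without_def)
    show "\<theta> s = b s" if s: "s \<in> \<Gamma> \<union> \<tau> ` (\<C> - {C})" for s
    proof (cases "s \<in> \<Gamma>")
      case False
      then obtain D where "D \<in> \<C>" "D \<noteq> C" "s = \<tau> D"
        using s by blast
      then show ?thesis
        using \<theta>(3)[of D] by (simp add: \<sigma>_def)
    qed (use \<theta>(2) in simp)
    show "x \<in> generate L (\<Gamma> \<union> \<tau> ` (\<C> - {C}))"
      using that by (simp add: without_def)
  qed
  show ?thesis
  proof (rule extension_byI[OF is_group W _ _ _ \<Gamma>' \<theta>(1)])
    show "subgroup D L \<and> D \<subseteq> ?W" if "D \<in> {C}" for D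
      using that E(6)[OF C] CW by simp
    show "c \<otimes> \<tau> C = \<tau> C \<otimes> c" if "D \<in> {C}" "c \<in> D" for D c
      using that E(7)[OF C] E(9)[OF C, of c] by auto
    show "\<theta> k = base_class L ?W {C} k" if "k \<in> ?W" for k
      using \<theta>_base[OF that] by (simp add: b_def)
    show "\<theta> (\<tau> C) = stable_class L ?W {C} D" if "D \<in> {C}" for D
      using that \<theta>(3)[OF C] by (simp add: \<sigma>_def st_def)
  qed (use C in simp)
qed

lemma centralizer_in_without:
  assumes C: "C \<in> \<C>" and u: "u \<in> C" "u \<noteq> \<one>"
  shows "centralizer_in L (without C) u = C"
proof
  have u\<Gamma>: "u \<in> \<Gamma>"
    using E(7)[OF C] u by blast
  have ZC: "C = centralizer_in L \<Gamma> u"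
    by (rule rep_eq_centralizer[OF C u])
  show "C \<subseteq> centralizer_in L (without C) u"
    using ZC base_in_without by (auto simp: centralizer_def)
  interpret W: free_over L "without C" "conj_letters L (without C) {C} (\<lambda>_. \<tau> C)"
    by (rule extension_by_free(1)[OF single_extension_without[OF C]])
  have \<tau>: "\<tau> C = \<one> \<otimes> \<tau> C \<otimes> inv \<one>"
    using C by simp
  have \<tau>X: "\<tau> C \<in> X" and \<tau>W: "\<tau> C \<in> conj_letters L (without C) {C} (\<lambda>_. \<tau> C)"
    unfolding conj_letters_def using \<tau> C K_closed(3) W.K_closed(3) by blast+
  have u\<tau>: "u \<otimes> \<tau> C = \<tau> C \<otimes> u"
    using E(9)[OF C u\<Gamma>] u by simp
  show "centralizer_in L (without C) u \<subseteq> C"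
  proof
    fix y
    assume "y \<in> centralizer_in L (without C) u"
    then have y: "y \<in> without C" "u \<otimes> y = y \<otimes> u"
      by (auto simp: centralizer_def)
    then have "y \<in> span"
      using extension_byD(4)[OF single_extension_without[OF C]] span_level by blast
    then obtain w k where w: "over X w" "reduced w" "k \<in> \<Gamma>" "y = word_val w \<otimes> k"
      by (rule spanE)
    have c: "conj_word u w = w" "u \<otimes> k = k \<otimes> u"
      using centralizer_of_base[OF u\<Gamma> w(1-3)] y(2) w(4) by simp_all
    have "fst a = \<tau> C" if a: "a \<in> set w" for a
    proof -
      have "fst a \<in> X"
        using w(1) a by (auto simp: over_def)
      then show ?thesis
        using fixed_unique[OF u\<Gamma> u(2) _ \<tau>X conj_word_eq_self[OF u\<Gamma> w(1) c(1) a] u\<tau>] by blast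
    qed
    then have "over (conj_letters L (without C) {C} (\<lambda>_. \<tau> C)) w"
      using \<tau>W by (auto simp: over_def)
    moreover have "word_val w \<in> without C"
    proof -
      have "word_val w = y \<otimes> inv k"
        using w by (simp add: m_assoc)
      moreover have "k \<in> without C"
        using w(3) base_in_without by blast
      ultimately show ?thesis
        using y(1) by simp
    qed
    ultimately have "w = []"
      using W.free w(2) by blast
    then have "y = k"
      using w by simp
    then show "y \<in> C"
      unfolding ZC using w(3) c(2) by (simp add: centralizer_def)
  qed
qed

definition adjoin :: "'l set \<Rightarrow> 'l set set \<Rightarrow> 'l set" where
  "adjoin A T = generate L (A \<union> \<tau> ` T)"

definition supported :: "'l set \<Rightarrow> 'l set set \<Rightarrow> bool" where
  "supported A T \<longleftrightarrow> finite T \<and> T \<subseteq> \<C> \<and> (\<forall>C\<in>T. \<exists>u\<in>A \<inter> C. u \<noteq> \<one>)"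

lemma adjoin_insert:
  assumes "A \<subseteq> \<Gamma>" "T \<subseteq> \<C>" "C \<in> \<C>"
  shows "adjoin A (insert C T) = generate L (adjoin A T \<union> {\<tau> C})"
proof -
  have "generate L (adjoin A T \<union> {\<tau> C}) = generate L ((A \<union> \<tau> ` T) \<union> {\<tau> C})"
    unfolding adjoin_def using assms by (intro generate_absorb is_group) auto
  also have "(A \<union> \<tau> ` T) \<union> {\<tau> C} = A \<union> \<tau> ` insert C T"
    by auto
  finally show ?thesis
    by (simp add: adjoin_def)
qed

lemma adjoin_empty: "subgroup A L \<Longrightarrow> adjoin A {} = A"
  using generate_subgroup_incl[of A A] by (auto simp: adjoin_def intro: generate.incl)

lemma subgroup_adjoin: "A \<subseteq> \<Gamma> \<Longrightarrow> T \<subseteq> \<C> \<Longrightarrow> subgroup (adjoin A T) L"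
  unfolding adjoin_def by (rule generate_is_subgroup) auto

lemma adjoin_subset: "A \<subseteq> adjoin A T"
  by (auto simp: adjoin_def intro: generate.incl)

lemma adjoin_in_level: "A \<subseteq> \<Gamma> \<Longrightarrow> T \<subseteq> \<C> \<Longrightarrow> adjoin A T \<subseteq> \<Gamma>'"
  unfolding adjoin_def using E(4,5) by (intro generate_subgroup_incl[OF _ E(3)]) auto

lemma single_extension_adjoin:
  assumes A: "A \<subseteq> \<Gamma>" and T: "T \<subseteq> \<C>" and C: "C \<in> \<C>" "C \<notin> T" and u: "u \<in> A" "u \<in> C" "u \<noteq> \<one>"
  shows "single_extension L (adjoin A T) (centralizer_in L (adjoin A T) u) (\<tau> C) (adjoin A (insert C T))"
proof -
  have sub: "adjoin A T \<subseteq> without C"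
    unfolding adjoin_def without_def using A T C by (intro mono_generate) auto
  have "C \<inter> adjoin A T = centralizer_in L (adjoin A T) u"
    using centralizer_in_without[OF C(1) u(2,3)] sub by (auto simp: centralizer_def)
  then show ?thesis
    using single_extension_restrict[OF single_extension_without[OF C(1)] subgroup_adjoin[OF A T] sub]
    by (simp add: adjoin_insert[OF A T C(1)])
qed

lemma ICE_le_adjoin:
  assumes "A \<subseteq> \<Gamma>" "supported A T" "supported A T'"
  shows "ICE_le L (adjoin A T) (adjoin A (T \<union> T'))"
proof -
  have "finite T'"
    using assms by (simp add: supported_def)
  then show ?thesis
    using assms(3)
  proof (induction T')
    case empty
    then show ?case
      using assms by (simp add: ICE_le_refl subgroup_adjoin supported_def)
  next
    case (insert C T')
    have IH: "ICE_le L (adjoin A T) (adjoin A (T \<union> T'))"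
      using insert by (simp add: supported_def)
    show ?case
    proof (cases "C \<in> T")
      case True
      then have "T \<union> insert C T' = T \<union> T'"
        by auto
      then show ?thesis
        using IH by simp
    next
      case False
      obtain u where u: "u \<in> A" "u \<in> C" "u \<noteq> \<one>"
        using insert.prems by (auto simp: supported_def)
      have TC: "T \<union> T' \<subseteq> \<C>" "C \<in> \<C>" "C \<notin> T \<union> T'"
        using insert assms False by (auto simp: supported_def)
      have "ICE_step L (adjoin A (T \<union> T')) (adjoin A (insert C (T \<union> T')))"
        using single_extension_imp_step[OF single_extension_adjoin[OF assms(1) TC u]] u adjoin_subset
        by blast
      then show ?thesis
        using IH ICE_le_trans ICE_step_imp_le by fastforce
    qed
  qed
qed

lemma ICE_le_adjoin_mono:
  assumes "ICE_le L A A'" "A' \<subseteq> \<Gamma>" "supported A T"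
  shows "ICE_le L (adjoin A T) (adjoin A' T)"
proof -
  have A: "A \<subseteq> A'" "subgroup A L" "subgroup A' L"
    using ICE_leD[OF assms(1)] by auto
  have "finite T"
    using assms by (simp add: supported_def)
  then show ?thesis
    using assms(3)
  proof (induction T)
    case empty
    then show ?case
      using assms A by (simp add: adjoin_empty)
  next
    case (insert C T)
    have IH: "ICE_le L (adjoin A T) (adjoin A' T)"
      using insert by (simp add: supported_def)
    obtain u where u: "u \<in> A" "u \<in> C" "u \<noteq> \<one>"
      using insert.prems by (auto simp: supported_def)
    have TC: "T \<subseteq> \<C>" "C \<in> \<C>"
      using insert by (auto simp: supported_def)
    have uA: "u \<in> A'" "u \<in> adjoin A T"
      using u A adjoin_subset by auto
    show ?case
      using single_extension_push(2)[OF IH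
          single_extension_adjoin[OF assms(2) TC insert.hyps(2) uA(1) u(2,3)] uA(2) u(3)]
        adjoin_insert[of A T C] A(1) assms(2) TC by auto
  qed
qed

definition next_family :: "'l set set \<Rightarrow> 'l set set" where
  "next_family \<D> = {adjoin A T | A T. A \<in> \<D> \<and> supported A T}"

definition cofinal :: "'l set \<Rightarrow> 'l set set \<Rightarrow> bool" where
  "cofinal \<Delta> \<D> \<longleftrightarrow> (\<forall>A\<in>\<D>. subgroup A L \<and> A \<subseteq> \<Delta>) \<and> (\<forall>A\<in>\<D>. \<forall>l\<in>\<Delta>. \<exists>A'\<in>\<D>. ICE_le L A A' \<and> l \<in> A')"

lemma cofinal_finite:
  assumes "cofinal \<Delta> \<D>" "finite F" "F \<subseteq> \<Delta>" "A \<in> \<D>"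
  shows "\<exists>A'\<in>\<D>. ICE_le L A A' \<and> F \<subseteq> A'"
  using assms(2,3)
proof (induction F)
  case empty
  then show ?case
    using assms by (auto simp: cofinal_def intro!: bexI[of _ A] ICE_le_refl)
next
  case (insert l F)
  then obtain A1 where A1: "A1 \<in> \<D>" "ICE_le L A A1" "F \<subseteq> A1"
    by auto
  obtain A2 where A2: "A2 \<in> \<D>" "ICE_le L A1 A2" "l \<in> A2"
    using assms(1) A1(1) insert.prems unfolding cofinal_def by (meson insert_subset)
  have "ICE_le L A A2" "insert l F \<subseteq> A2"
    using ICE_le_trans[OF A1(2) A2(2)] ICE_leD(3)[OF A2(2)] A1(3) A2(3) by auto
  then show ?case
    using A2(1) by blast
qed

lemma finitely_generated_member:
  assumes "l \<in> \<Gamma>'"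
  shows "\<exists>F T. finite F \<and> F \<subseteq> \<Gamma> \<and> finite T \<and> T \<subseteq> \<C> \<and> l \<in> generate L (F \<union> \<tau> ` T)"
proof -
  have "l \<in> generate L (\<Gamma> \<union> \<tau> ` \<C>)"
    using assms E(8) by simp
  then show ?thesis
  proof (induction rule: generate.induct)
    case one
    have "\<one> \<in> generate L ({} \<union> \<tau> ` {})"
      by (rule generate.one)
    then show ?case
      by (intro exI[of _ "{}"] exI[of _ "{} :: 'l set set"]) simp
  next
    case (incl h)
    then consider "h \<in> \<Gamma>" | C where "C \<in> \<C>" "h = \<tau> C"
      by auto
    then show ?case
    proof cases
      case 1
      then show ?thesis
        by (intro exI[of _ "{h}"] exI[of _ "{} :: 'l set set"]) (auto intro: generate.incl)
    next
      case 2
      then show ?thesis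
        by (intro exI[of _ "{}"] exI[of _ "{C}"]) (auto intro: generate.incl)
    qed
  next
    case (inv h)
    then consider "h \<in> \<Gamma>" | C where "C \<in> \<C>" "h = \<tau> C"
      by auto
    then show ?case
    proof cases
      case 1
      then show ?thesis
        by (intro exI[of _ "{h}"] exI[of _ "{} :: 'l set set"]) (auto intro: generate.inv)
    next
      case 2
      then show ?thesis
        by (intro exI[of _ "{}"] exI[of _ "{C}"]) (auto intro: generate.inv)
    qed
  next
    case (eng h1 h2)
    then obtain F T F' T' where 1: "finite F" "F \<subseteq> \<Gamma>" "finite T" "T \<subseteq> \<C>" "h1 \<in> generate L (F \<union> \<tau> ` T)"
      and 2: "finite F'" "F' \<subseteq> \<Gamma>" "finite T'" "T' \<subseteq> \<C>" "h2 \<in> generate L (F' \<union> \<tau> ` T')"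
      by blast
    have "h1 \<in> generate L ((F \<union> F') \<union> \<tau> ` (T \<union> T'))" "h2 \<in> generate L ((F \<union> F') \<union> \<tau> ` (T \<union> T'))"
      using 1(5) 2(5) mono_generate[of "F \<union> \<tau> ` T" "(F \<union> F') \<union> \<tau> ` (T \<union> T')"]
        mono_generate[of "F' \<union> \<tau> ` T'" "(F \<union> F') \<union> \<tau> ` (T \<union> T')"] by blast+
    then have "h1 \<otimes> h2 \<in> generate L ((F \<union> F') \<union> \<tau> ` (T \<union> T'))"
      by (rule generate.eng)
    then show ?case
      using 1 2 by (intro exI[of _ "F \<union> F'"] exI[of _ "T \<union> T'"]) simp
  qed
qed

lemma next_family_supset:
  assumes "cofinal \<Gamma> \<D>"
  shows "\<D> \<subseteq> next_family \<D>"
proof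
  fix A
  assume A: "A \<in> \<D>"
  then have "A = adjoin A {}"
    using assms by (simp add: cofinal_def adjoin_empty)
  moreover have "supported A {}"
    by (simp add: supported_def)
  ultimately show "A \<in> next_family \<D>"
    using A unfolding next_family_def by blast
qed

lemma cofinal_next:
  assumes "cofinal \<Gamma> \<D>"
  shows "cofinal \<Gamma>' (next_family \<D>)"
proof -
  have D: "subgroup A L" "A \<subseteq> \<Gamma>" if "A \<in> \<D>" for A
    using assms that by (auto simp: cofinal_def)
  have "\<exists>B'\<in>next_family \<D>. ICE_le L B B' \<and> l \<in> B'" if B: "B \<in> next_family \<D>" and l: "l \<in> \<Gamma>'" for B l
  proof -
    obtain A T where A: "A \<in> \<D>" "supported A T" "B = adjoin A T"
      using B by (auto simp: next_family_def)
    obtain F T' where F: "finite F" "F \<subseteq> \<Gamma>" "finite T'" "T' \<subseteq> \<C>" "l \<in> generate L (F \<union> \<tau> ` T')"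
      using finitely_generated_member[OF l] by blast
    have "\<forall>C\<in>T'. \<exists>u. u \<in> \<Gamma> \<and> u \<in> C \<and> u \<noteq> \<one>"
      using rep_nontrivial F(4) by blast
    then obtain f where f: "\<And>C. C \<in> T' \<Longrightarrow> f C \<in> \<Gamma> \<and> f C \<in> C \<and> f C \<noteq> \<one>"
      by metis
    have "finite (F \<union> f ` T')" "F \<union> f ` T' \<subseteq> \<Gamma>"
      using F f by auto
    then obtain A' where A': "A' \<in> \<D>" "ICE_le L A A'" "F \<union> f ` T' \<subseteq> A'"
      using cofinal_finite[OF assms _ _ A(1), of "F \<union> f ` T'"] by blast
    have sub: "A \<subseteq> A'"
      using ICE_leD(3)[OF A'(2)] .
    have "supported A' T"
      using A(2) sub unfolding supported_def by blast
    moreover have "supported A' T'"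
      using F(3,4) f A'(3) unfolding supported_def by blast
    ultimately have supp: "supported A' T" "supported A' T'" .
    have supp': "supported A' (T \<union> T')"
      using supp by (auto simp: supported_def)
    have "ICE_le L B (adjoin A' (T \<union> T'))"
      unfolding A(3) using ICE_le_trans[OF ICE_le_adjoin_mono[OF A'(2) D(2)[OF A'(1)] A(2)]
          ICE_le_adjoin[OF D(2)[OF A'(1)] supp]] .
    moreover have "generate L (F \<union> \<tau> ` T') \<subseteq> adjoin A' (T \<union> T')"
      unfolding adjoin_def using A'(3) by (intro mono_generate) auto
    ultimately have "ICE_le L B (adjoin A' (T \<union> T'))" "l \<in> adjoin A' (T \<union> T')"
      using F(5) by blast+
    moreover have "adjoin A' (T \<union> T') \<in> next_family \<D>"
      using A'(1) supp' unfolding next_family_def by blast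
    ultimately show ?thesis
      by blast
  qed
  moreover have "subgroup B L \<and> B \<subseteq> \<Gamma>'" if B: "B \<in> next_family \<D>" for B
  proof -
    obtain A T where "A \<in> \<D>" "T \<subseteq> \<C>" "B = adjoin A T"
      using B by (auto simp: next_family_def supported_def)
    then show ?thesis
      using D(2)[of A] subgroup_adjoin[of A T] adjoin_in_level[of A T] by simp
  qed
  ultimately show ?thesis
    unfolding cofinal_def by blast
qed

lemma realize_extension:
  assumes D: "cofinal \<Gamma> \<D>" "A' \<in> \<D>" and le: "ICE_le L A A'" and u: "u \<in> A" "u \<noteq> \<one>"
  shows "\<exists>t B. \<exists>B'\<in>next_family \<D>. ICE_le L B B' \<and> single_extension L A (centralizer_in L A u) t B"
proof -
  have u\<Gamma>: "u \<in> \<Gamma>"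
    using D ICE_leD(3)[OF le] u by (auto simp: cofinal_def)
  have "\<exists>!C. C \<in> \<C> \<and> (\<exists>g\<in>\<Gamma>. C = conj_set (subgrp L \<Gamma>) (centralizer_in L \<Gamma> u) g)"
    using reps u u\<Gamma> by (auto simp: centralizer_representatives_def)
  then obtain C g where C: "C \<in> \<C>" "g \<in> \<Gamma>" "C = conj_set (subgrp L \<Gamma>) (centralizer_in L \<Gamma> u) g"
    by blast
  define p where "p = inv g \<otimes> u \<otimes> g"
  have p: "p \<in> C" "p \<noteq> \<one>"
    using C conj_set_centralizer[OF C(2) u\<Gamma>] conj_nontrivial[OF u\<Gamma> C(2) u(2)] u\<Gamma>
    by (simp_all add: p_def centralizer_def)
  obtain A1 where A1: "A1 \<in> \<D>" "ICE_le L A' A1" "g \<in> A1"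
    using D C(2) unfolding cofinal_def by meson
  have A1': "subgroup A1 L" "A1 \<subseteq> \<Gamma>" "u \<in> A1" "ICE_le L A A1"
    using D A1 u ICE_leD(3)[OF ICE_le_trans[OF le A1(2)]] ICE_le_trans[OF le A1(2)] by (auto simp: cofinal_def)
  have pA: "p \<in> A1"
    using A1' A1(3) subgroup.m_closed[OF A1'(1)] subgroup.m_inv_closed[OF A1'(1)] by (simp add: p_def)
  have "single_extension L A1 (centralizer_in L A1 p) (\<tau> C) (adjoin A1 {C})"
    using single_extension_adjoin[OF A1'(2), of "{}" C p] C p pA A1' by (simp add: adjoin_empty)
  then have "single_extension L A1 (centralizer_in L A1 (g \<otimes> p \<otimes> inv g)) (g \<otimes> \<tau> C \<otimes> inv g) (adjoin A1 {C})"
    using A1(3) pA by (rule single_extension_conj)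
  moreover have "g \<otimes> p \<otimes> inv g = u"
    using C(2) u\<Gamma> by (simp add: p_def m_assoc)
  ultimately have "single_extension L A1 (centralizer_in L A1 u) (g \<otimes> \<tau> C \<otimes> inv g) (adjoin A1 {C})"
    by simp
  note push = single_extension_push[OF A1'(4) this u]
  moreover have "adjoin A1 {C} \<in> next_family \<D>"
    using A1(1) C(1) p pA by (auto simp: next_family_def supported_def)
  ultimately show ?thesis
    by blast
qed

lemma countable_level:
  assumes "countable \<Gamma>"
  shows "countable \<Gamma>'"
proof -
  have "\<C> \<subseteq> centralizer_in L \<Gamma> ` \<Gamma>"
    using reps by (auto simp: centralizer_representatives_def)
  then have "countable \<C>"
    using assms by (meson countable_image countable_subset)
  then have "countable ((\<lambda>(k, C). k \<otimes> \<tau> C \<otimes> inv k) ` (\<Gamma> \<times> \<C>))"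
    using assms by simp
  moreover have "X \<subseteq> (\<lambda>(k, C). k \<otimes> \<tau> C \<otimes> inv k) ` (\<Gamma> \<times> \<C>)"
    by (auto simp: conj_letters_def)
  ultimately have X: "countable X"
    using countable_subset by blast
  then have "countable ((\<lambda>(w, k). word_val w \<otimes> k) ` (lists (X \<times> UNIV) \<times> \<Gamma>))"
    using assms by (simp add: countable_lists)
  moreover have "span \<subseteq> (\<lambda>(w, k). word_val w \<otimes> k) ` (lists (X \<times> UNIV) \<times> \<Gamma>)"
    by (force simp: span_def over_def)
  ultimately show ?thesis
    using countable_subset span_level by metis
qed

end

theorem Lyndon_completion_rich:
  fixes G :: "'a monoid" and L :: "'l monoid"
  assumes lyndon: "Lyndon_completion G \<kappa> L" and csa: "CSA_torsion_free_on L (\<kappa> ` carrier G)"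
  obtains \<S> where "rich L (\<kappa> ` carrier G) \<S>"
    and "countable (carrier G) \<Longrightarrow> countable (carrier L)"
proof -
  have L: "group L"
    using lyndon by (simp add: Lyndon_completion_def G_group_def)
  interpret group L by fact
  obtain \<Gamma> :: "nat \<Rightarrow> 'l set" where \<Gamma>0: "\<Gamma> 0 = \<kappa> ` carrier G"
    and \<Gamma>: "\<And>i. subgroup (\<Gamma> i) L \<and> \<Gamma> i \<subseteq> \<Gamma> (Suc i) \<and>
      (\<exists>\<C>. centralizer_representatives (subgrp L (\<Gamma> i)) \<C> \<and>
         is_extension_of_centralizers (subgrp L (\<Gamma> i)) \<C> (subgrp L (\<Gamma> (Suc i))))"
    and union: "(\<Union>i. \<Gamma> i) = carrier L"
    using lyndon by (auto simp: Lyndon_completion_def)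
  have "\<exists>\<C> \<tau>. centralizer_representatives (subgrp L (\<Gamma> i)) \<C> \<and> extension_by L (\<Gamma> i) \<C> \<tau> (\<Gamma> (Suc i))" for i
  proof -
    obtain \<C> where \<C>: "centralizer_representatives (subgrp L (\<Gamma> i)) \<C>"
        "is_extension_of_centralizers (subgrp L (\<Gamma> i)) \<C> (subgrp L (\<Gamma> (Suc i)))"
      using \<Gamma>[of i] by blast
    have "subgroup C L \<and> C \<subseteq> \<Gamma> i" if C: "C \<in> \<C>" for C
    proof -
      obtain u where "u \<in> \<Gamma> i" "C = centralizer_in L (\<Gamma> i) u"
        using \<C>(1) C by (auto simp: centralizer_representatives_def)
      then show ?thesis
        using subgroup_centralizer_in[OF L] \<Gamma>[of i] by blast
    qed
    then show ?thesis
      using \<C> is_extension_of_centralizers_iff[of L "\<Gamma> i" "\<Gamma> (Suc i)" \<C>] L \<Gamma>[of i] \<Gamma>[of "Suc i"] by auto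
  qed
  then obtain \<C> \<tau> where C: "\<And>i. centralizer_representatives (subgrp L (\<Gamma> i)) (\<C> i)"
      "\<And>i. extension_by L (\<Gamma> i) (\<C> i) (\<tau> i) (\<Gamma> (Suc i))"
    by metis
  have csa_i: "CSA_torsion_free_on L (\<Gamma> i)" for i
  proof (induction i)
    case 0
    then show ?case
      using csa \<Gamma>0 by simp
  next
    case (Suc i)
    then interpret centralizer_level L "\<Gamma> i" "\<C> i" "\<tau> i" "\<Gamma> (Suc i)"
      using C by unfold_locales
    show ?case
      by (rule CSA_torsion_free_level)
  qed
  interpret lev: centralizer_level L "\<Gamma> i" "\<C> i" "\<tau> i" "\<Gamma> (Suc i)" for i
    using C csa_i by unfold_locales
  define \<D> where "\<D> = rec_nat {\<Gamma> 0} (\<lambda>i. lev.next_family i)"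
  have \<D>0: "\<D> 0 = {\<Gamma> 0}" and \<D>_Suc: "\<D> (Suc i) = lev.next_family i (\<D> i)" for i
    by (simp_all add: \<D>_def)
  have cof: "lev.cofinal (\<Gamma> i) (\<D> i)" for i
  proof (induction i)
    case 0
    then show ?case
      using \<Gamma>[of 0] by (auto simp: \<D>0 lev.cofinal_def intro: ICE_le_refl)
  next
    case (Suc i)
    then show ?case
      using lev.cofinal_next by (simp add: \<D>_Suc)
  qed
  have \<D>_mono: "\<D> i \<subseteq> \<D> j" if "i \<le> j" for i j
    using lift_Suc_mono_le[of \<D> i j] lev.next_family_supset[OF cof] that by (simp add: \<D>_Suc)
  have \<Gamma>_mono: "\<Gamma> i \<subseteq> \<Gamma> j" if "i \<le> j" for i j
    using lift_Suc_mono_le[of \<Gamma> i j] \<Gamma> that by blast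
  define \<S> where "\<S> = {A. \<exists>i. \<exists>D\<in>\<D> i. ICE_le L A D}"
  have \<D>_refl: "ICE_le L D D" if "D \<in> \<D> i" for D i
    using cof[of i] that by (auto simp: lev.cofinal_def intro: ICE_le_refl)
  have "rich L (\<kappa> ` carrier G) \<S>"
    unfolding rich_def
  proof (intro conjI ballI impI L)
    show "\<kappa> ` carrier G \<in> \<S>"
      using \<D>_refl[of "\<Gamma> 0" 0] by (auto simp: \<S>_def \<D>0 \<Gamma>0[symmetric] intro: exI[of _ 0])
    show "subgroup A L" if "A \<in> \<S>" for A
      using that ICE_leD(1) by (auto simp: \<S>_def)
    fix A
    assume "A \<in> \<S>"
    then obtain i D where D: "D \<in> \<D> i" "ICE_le L A D"
      by (auto simp: \<S>_def)
    show "\<exists>A'\<in>\<S>. ICE_le L A A' \<and> h \<in> A'" if h: "h \<in> carrier L" for h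
    proof -
      obtain j where j: "h \<in> \<Gamma> j"
        using h union by blast
      have "D \<in> \<D> (max i j)" "h \<in> \<Gamma> (max i j)"
        using D(1) j \<D>_mono[of i "max i j"] \<Gamma>_mono[of j "max i j"] by auto
      then obtain D' where D': "D' \<in> \<D> (max i j)" "ICE_le L D D'" "h \<in> D'"
        using cof[of "max i j"] unfolding lev.cofinal_def by meson
      have "D' \<in> \<S>"
        using D'(1) \<D>_refl by (auto simp: \<S>_def)
      then show ?thesis
        using D' ICE_le_trans[OF D(2)] by blast
    qed
    show "\<exists>t. \<exists>B\<in>\<S>. single_extension L A (centralizer_in L A u) t B" if u: "u \<in> A" "u \<noteq> \<one>\<^bsub>L\<^esub>" for u
    proof -
      obtain t B B' where B: "B' \<in> \<D> (Suc i)" "ICE_le L B B'" "single_extension L A (centralizer_in L A u) t B"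
        using lev.realize_extension[OF cof D u] by (auto simp: \<D>_Suc)
      then have "B \<in> \<S>"
        by (auto simp: \<S>_def)
      then show ?thesis
        using B by blast
    qed
  qed
  moreover have "countable (carrier L)" if count: "countable (carrier G)"
  proof -
    have "countable (\<Gamma> i)" for i
    proof (induction i)
      case 0
      then show ?case
        using count by (simp add: \<Gamma>0)
    next
      case (Suc i)
      then show ?case
        by (rule lev.countable_level)
    qed
    then have "countable (\<Union>i. \<Gamma> i)"
      by simp
    then show ?thesis
      using union by simp
  qed
  ultimately show ?thesis
    using that by blast
qed

section \<open>The homogeneous limit\<close>

lemma subgrp_carrier [simp]: "subgrp G (carrier G) = G"
  by simp

lemma hom_subgrp: "h \<in> hom H M \<Longrightarrow> A \<subseteq> carrier H \<Longrightarrow> h \<in> hom (subgrp H A) M"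
  by (auto simp: hom_def subset_iff)

lemma image_eq_self: "(\<And>x. x \<in> S \<Longrightarrow> h x = x) \<Longrightarrow> h ` S = S"
  by simp

lemma abstract_extension:
  fixes H :: "'h monoid"
  assumes H: "group H" "subgroup A H" and C: "subgroup C H" "C \<subseteq> A"
  defines "P \<equiv> extend_centralizers (subgrp H A) {C}" and "b \<equiv> base_class H A {C}"
  shows "inj_on b A" "single_extension P (b ` A) (b ` C) (stable_class H A {C} C) (carrier P)"
proof -
  interpret H: group H by fact
  let ?s = "stable_class H A {C} C"
  have P: "group P"
    unfolding P_def by (rule group_extend_centralizers[OF H])
  have b: "b \<in> hom (subgrp H A) P"
    unfolding b_def P_def by (rule base_class_hom[OF H])
  have s: "?s \<in> carrier P"
    unfolding P_def by (rule stable_class_carrier[OF H]) simp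
  have A: "group (subgrp H A)"
    by (rule H.subgroup_imp_group[OF H(2)])
  obtain \<rho> where "\<And>k. k \<in> A \<Longrightarrow> \<rho> (base_class H A {C} k) = k"
  proof (rule presentation_map[OF H A, of "\<lambda>k. k" "{C}" "\<lambda>_. \<one>\<^bsub>H\<^esub>"])
    show "(\<lambda>k. k) \<in> hom (subgrp H A) (subgrp H A)"
      by (auto simp: hom_def)
    show "\<one>\<^bsub>H\<^esub> \<in> carrier (subgrp H A)"
      using subgroup.one_closed[OF H(2)] by simp
    show "c \<otimes>\<^bsub>subgrp H A\<^esub> \<one>\<^bsub>H\<^esub> = \<one>\<^bsub>H\<^esub> \<otimes>\<^bsub>subgrp H A\<^esub> c" if "D \<in> {C}" "c \<in> D" for D c
      using that C(2) subgroup.mem_carrier[OF H(2)] by auto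
  qed (use C in auto)
  then show inj: "inj_on b A"
    unfolding b_def by (intro inj_on_inverseI[of _ \<rho>]) auto
  interpret bh: group_hom "subgrp H A" P b
    using b A P by (simp add: group_hom_def group_hom_axioms_def)
  have image: "subgroup (b ` D) P" if "subgroup D H" "D \<subseteq> A" for D
    using bh.subgroup_img_is_subgroup[of D] H.subgroup_incl[OF that(1) H(2) that(2)] by simp
  have bA: "subgroup (b ` A) P" and bC: "subgroup (b ` C) P" "b ` C \<subseteq> b ` A"
    using image H(2) C by auto
  let ?P' = "extend_centralizers (subgrp P (b ` A)) {b ` C}"
  have b': "base_class P (b ` A) {b ` C} \<in> hom (subgrp P (b ` A)) ?P'"
    by (rule base_class_hom[OF P bA])
  have "b \<in> hom (subgrp H A) (subgrp P (b ` A))"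
    using b by (auto simp: hom_def)
  then have b'b: "base_class P (b ` A) {b ` C} \<circ> b \<in> hom (subgrp H A) ?P'"
    using Group.hom_compose b' by blast
  obtain \<theta> where \<theta>: "\<theta> \<in> hom P ?P'" "\<And>k. k \<in> A \<Longrightarrow> \<theta> (b k) = base_class P (b ` A) {b ` C} (b k)"
      "\<theta> ?s = stable_class P (b ` A) {b ` C} (b ` C)"
  proof (rule presentation_map[OF H group_extend_centralizers[OF P bA] b'b,
        where \<C> = "{C}" and \<sigma> = "\<lambda>_. stable_class P (b ` A) {b ` C} (b ` C)"])
    show "stable_class P (b ` A) {b ` C} (b ` C) \<in> carrier ?P'"
      by (rule stable_class_carrier[OF P bA]) simp
    show "(base_class P (b ` A) {b ` C} \<circ> b) c \<otimes>\<^bsub>?P'\<^esub> stable_class P (b ` A) {b ` C} (b ` C) =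
        stable_class P (b ` A) {b ` C} (b ` C) \<otimes>\<^bsub>?P'\<^esub> (base_class P (b ` A) {b ` C} \<circ> b) c"
      if "D \<in> {C}" "c \<in> D" for D c
      using that bC stable_class_commute[OF P bA, of "b ` C" "{b ` C}" "b c"] by auto
  qed (use C in \<open>auto simp: P_def b_def\<close>)
  have gens: "b ` A \<union> {?s} \<subseteq> carrier P"
    using subgroup.subset[OF bA] s by auto
  have gen: "carrier P = generate P (b ` A \<union> (\<lambda>_. ?s) ` {b ` C})"
  proof
    have sub: "subgroup (generate P (b ` A \<union> {?s})) P"
      by (rule group.generate_is_subgroup[OF P gens])
    have "p \<in> generate P (b ` A \<union> {?s})" if "p \<in> carrier P" for p
      using presentation_in_subgroup[OF H, of "generate P (b ` A \<union> {?s})" "{C}" p] sub that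
      by (auto simp: P_def b_def intro: generate.incl)
    then show "carrier P \<subseteq> generate P (b ` A \<union> (\<lambda>_. ?s) ` {b ` C})"
      by auto
    show "generate P (b ` A \<union> (\<lambda>_. ?s) ` {b ` C}) \<subseteq> carrier P"
      using group.generate_incl[OF P gens] by simp
  qed
  show "single_extension P (b ` A) (b ` C) ?s (carrier P)"
  proof (rule extension_byI[OF P bA _ _ _ gen])
    show "subgroup D P \<and> D \<subseteq> b ` A" if "D \<in> {b ` C}" for D
      using that bC by simp
    show "?s \<in> carrier P"
      by (rule s)
    show "c \<otimes>\<^bsub>P\<^esub> ?s = ?s \<otimes>\<^bsub>P\<^esub> c" if D: "D \<in> {b ` C}" "c \<in> D" for D c
    proof -
      obtain x where "x \<in> C" "c = b x"
        using D by auto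
      then show ?thesis
        using stable_class_commute[OF H, of C "{C}" x] C(2) by (simp add: b_def P_def)
    qed
    show "\<theta> \<in> hom (subgrp P (carrier P)) ?P'"
      using \<theta>(1) by simp
    show "\<theta> k = base_class P (b ` A) {b ` C} k" if "k \<in> b ` A" for k
      using that \<theta>(2) by auto
    show "\<theta> ?s = stable_class P (b ` A) {b ` C} D" if "D \<in> {b ` C}" for D
      using that \<theta>(3) by simp
  qed
qed

lemma countable_extend_centralizers:
  assumes "group H" "subgroup A H" "countable A" "countable \<C>"
  shows "countable (carrier (extend_centralizers (subgrp H A) \<C>))"
proof -
  interpret P: relative_presentation "subgrp H A" \<C> "commutation_relators (subgrp H A) \<C>"
    by (rule relative_presentation_subgrp[OF assms(1,2)])
  have "countable (rel_words (subgrp H A) \<C>)"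
    unfolding rel_words_def using assms(3,4) by (intro countable_lists) auto
  then show ?thesis
    by (simp add: extend_centralizers_def P.carrier_P)
qed

lemma countable_group_on_nat:
  fixes P :: "'p monoid"
  assumes P: "group P" "countable (carrier P)"
  obtains Q :: "nat monoid" and e where "group Q" "e \<in> iso P Q"
proof -
  interpret P: group P by fact
  define e where "e = to_nat_on (carrier P)"
  define d where "d = inv_into (carrier P) e"
  have inj: "inj_on e (carrier P)"
    unfolding e_def by (rule inj_on_to_nat_on[OF P(2)])
  have de: "d (e x) = x" if "x \<in> carrier P" for x
    unfolding d_def by (rule inv_into_f_f[OF inj that])
  define Q\<^sub>0 where "Q\<^sub>0 = \<lparr>carrier = UNIV :: nat set, monoid.mult = (\<lambda>x y. e (d x \<otimes>\<^bsub>P\<^esub> d y)), one = e \<one>\<^bsub>P\<^esub>\<rparr>"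
  have "e \<in> hom P Q\<^sub>0"
    by (auto simp: hom_def Q\<^sub>0_def de)
  then have Q: "group (Q\<^sub>0\<lparr>carrier := e ` carrier P, one := e \<one>\<^bsub>P\<^esub>\<rparr>)"
    by (rule P.hom_imp_img_group)
  have "e \<in> iso P (Q\<^sub>0\<lparr>carrier := e ` carrier P, one := e \<one>\<^bsub>P\<^esub>\<rparr>)"
    using inj by (auto simp: iso_def hom_def bij_betw_def Q\<^sub>0_def de)
  with Q show ?thesis
    by (rule that)
qed

lemma image_centralizer_in:
  assumes h: "h \<in> hom (subgrp H A) M" "inj_on h A" and A: "subgroup A H" and u: "u \<in> A"
  shows "h ` centralizer_in H A u = centralizer_in M (h ` A) (h u)"
proof -
  have mult: "h (x \<otimes>\<^bsub>H\<^esub> y) = h x \<otimes>\<^bsub>M\<^esub> h y" if "x \<in> A" "y \<in> A" for x y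
    using hom_mult[OF h(1), of x y] that by simp
  have closed: "x \<otimes>\<^bsub>H\<^esub> y \<in> A" if "x \<in> A" "y \<in> A" for x y
    using subgroup.m_closed[OF A] that .
  have "h x \<otimes>\<^bsub>M\<^esub> h u = h u \<otimes>\<^bsub>M\<^esub> h x \<longleftrightarrow> x \<otimes>\<^bsub>H\<^esub> u = u \<otimes>\<^bsub>H\<^esub> x" if "x \<in> A" for x
    using inj_on_eq_iff[OF h(2) closed closed] that u by (simp flip: mult)
  then show ?thesis
    by (auto simp: centralizer_def)
qed

lemma ICE_le_to_subgrp:
  assumes "ICE_le H A B" "group H"
  shows "ICE_le (subgrp H B) A B"
proof -
  have "group (subgrp H B)"
    using group.subgroup_imp_group[OF assms(2) ICE_leD(2)[OF assms(1)]] .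
  moreover have "(\<lambda>x. x) \<in> hom (subgrp H B) (subgrp H B)"
    by (auto simp: hom_def)
  ultimately show ?thesis
    using ICE_le_transport[OF assms, of "subgrp H B" "\<lambda>x. x"] by simp
qed

lemma ICE_le_from_subgrp:
  assumes "ICE_le (subgrp H B) A B" "group H" "subgroup B H"
  shows "ICE_le H A B"
proof -
  have "(\<lambda>x. x) \<in> hom (subgrp (subgrp H B) B) H"
    using subgroup.subset[OF assms(3)] by (auto simp: hom_def)
  then show ?thesis
    using ICE_le_transport[OF assms(1) group.subgroup_imp_group[OF assms(2,3)] assms(2), of "\<lambda>x. x"] by simp
qed

lemma ICE_le_automorphism:
  assumes "ICE_le H A B" "group H" "\<alpha> \<in> iso H H"
  shows "ICE_le H (\<alpha> ` A) (\<alpha> ` B)"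
proof -
  have B: "B \<subseteq> carrier H"
    using subgroup.subset[OF ICE_leD(2)[OF assms(1)]] .
  have "\<alpha> \<in> hom (subgrp H B) H" "inj_on \<alpha> B"
    using assms(3) B by (auto simp: iso_def bij_betw_def intro: hom_subgrp inj_on_subset)
  then show ?thesis
    by (rule ICE_le_transport[OF assms(1,2,2)])
qed

theorem ICE_homogeneous_limit_rich:
  fixes G :: "'a monoid" and H :: "'h monoid"
  assumes G: "group G" and limit: "ICE_homogeneous_limit G \<iota> H"
  obtains \<S> where "rich H (\<iota> ` carrier G) \<S>"
proof -
  have count: "countable (carrier H)"
    using limit by (simp add: ICE_homogeneous_limit_def)
  obtain \<Gamma> where union: "union_of_ICE_chain G \<iota> H \<Gamma>"
    and age_iff: "\<forall>(\<kappa> :: 'a \<Rightarrow> nat) A. in_ICE_age G \<iota> H \<Gamma> \<kappa> A \<longleftrightarrow> in_ICE G \<kappa> A"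
    and hom: "\<forall>A B. ICE_le_union G \<iota> H \<Gamma> A \<and> ICE_le_union G \<iota> H \<Gamma> B \<longrightarrow>
      (\<forall>\<psi>\<in>G_iso G \<iota> (subgrp H A) \<iota> (subgrp H B). \<exists>\<alpha>\<in>iso H H. \<forall>x\<in>A. \<alpha> x = \<psi> x)"
    using limit unfolding ICE_homogeneous_limit_def by (elim conjE exE)
  have age: "in_ICE_age G \<iota> H \<Gamma> \<kappa> A" if "in_ICE G \<kappa> A" for \<kappa> :: "'a \<Rightarrow> nat" and A
    using age_iff that by simp
  have homogeneous: "\<exists>\<alpha>\<in>iso H H. \<forall>x\<in>A. \<alpha> x = \<psi> x"
    if "ICE_le_union G \<iota> H \<Gamma> A" "ICE_le_union G \<iota> H \<Gamma> B" "\<psi> \<in> G_iso G \<iota> (subgrp H A) \<iota> (subgrp H B)" for A B \<psi>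
    using hom that by simp
  have H: "group H" and \<iota>: "\<iota> \<in> hom G H" "inj_on \<iota> (carrier G)"
    and chain: "\<And>i. ICE_le H (\<Gamma> i) (\<Gamma> (Suc i))" and \<Gamma>: "\<And>i. in_ICE G \<iota> (subgrp H (\<Gamma> i))"
    and cover: "(\<Union>i. \<Gamma> i) = carrier H"
    using union by (auto simp: union_of_ICE_chain_def G_group_def mon_def ICE_chain_def)
  interpret H: group H by fact
  let ?G = "\<iota> ` carrier G"
  have \<Gamma>_sub: "subgroup (\<Gamma> i) H" for i
    using ICE_leD(1)[OF chain] .
  have G_\<Gamma>: "ICE_le H ?G (\<Gamma> i)" for i
    using \<Gamma>[of i] ICE_le_from_subgrp[OF _ H \<Gamma>_sub] by (simp add: in_ICE_def)
  have chain_mono: "ICE_le H (\<Gamma> i) (\<Gamma> j)" if "i \<le> j" for i j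
    using that
  proof (induction j rule: dec_induct)
    case base
    then show ?case
      by (rule ICE_le_refl[OF \<Gamma>_sub])
  next
    case (step j)
    then show ?case
      using ICE_le_trans[OF _ chain] by blast
  qed
  have in_ICE_sub: "in_ICE G \<iota> (subgrp H A)" if le: "ICE_le H ?G A" for A
  proof -
    have A: "subgroup A H" "?G \<subseteq> A"
      using ICE_leD[OF le] by auto
    have "\<iota> \<in> mon G (subgrp H A)"
      using \<iota> A(2) by (auto simp: mon_def hom_def)
    then show ?thesis
      using ICE_le_to_subgrp[OF le H] H.subgroup_imp_group[OF A(1)] by (simp add: in_ICE_def G_group_def)
  qed
  have le_unionI: "ICE_le_union G \<iota> H \<Gamma> A" if "ICE_le H ?G A" "ICE_le H A (\<Gamma> i)" for A i
    using in_ICE_sub[OF that(1)] ICE_leD[OF that(1)] that(2) by (auto simp: ICE_le_union_def)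
  define fixes_G where "fixes_G = (\<lambda>\<alpha>. \<alpha> \<in> iso H H \<and> (\<forall>x\<in>?G. \<alpha> x = x))"
  define \<S> where "\<S> = {A. ICE_le H ?G A \<and> (\<exists>\<alpha> i. fixes_G \<alpha> \<and> ICE_le H A (\<alpha> ` \<Gamma> i))}"
  have "rich H ?G \<S>"
    unfolding rich_def
  proof (intro conjI ballI impI H)
    show "?G \<in> \<S>"
    proof -
      have "fixes_G (\<lambda>x. x)"
        using iso_set_refl by (auto simp: fixes_G_def)
      moreover have "ICE_le H ?G ((\<lambda>x. x) ` \<Gamma> 0)"
        using G_\<Gamma>[of 0] by simp
      ultimately show ?thesis
        using ICE_le_refl[OF ICE_leD(1)[OF G_\<Gamma>]] unfolding \<S>_def by blast
    qed
    show "subgroup A H" if "A \<in> \<S>" for A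
      using that ICE_leD(2) by (auto simp: \<S>_def)
    fix A
    assume "A \<in> \<S>"
    then obtain \<alpha> i where A: "ICE_le H ?G A" and \<alpha>: "fixes_G \<alpha>" and A\<Gamma>: "ICE_le H A (\<alpha> ` \<Gamma> i)"
      by (auto simp: \<S>_def)
    have \<alpha>_iso: "\<alpha> \<in> iso H H"
      using \<alpha> by (simp add: fixes_G_def)
    have A_sub: "subgroup A H" "A \<subseteq> carrier H"
      using ICE_leD(2)[OF A] subgroup.subset by blast+
    show "\<exists>A'\<in>\<S>. ICE_le H A A' \<and> h \<in> A'" if h: "h \<in> carrier H" for h
    proof -
      obtain x where x: "x \<in> carrier H" "h = \<alpha> x"
        using h \<alpha>_iso by (auto simp: iso_def bij_betw_def)
      then obtain j where j: "x \<in> \<Gamma> j"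
        using cover by blast
      define k where "k = max i j"
      have le: "ICE_le H (\<alpha> ` \<Gamma> i) (\<alpha> ` \<Gamma> k)"
        using chain_mono[of i k] ICE_le_automorphism[OF _ H \<alpha>_iso] by (simp add: k_def)
      have "x \<in> \<Gamma> k"
        using j ICE_leD(3)[OF chain_mono[of j k]] by (auto simp: k_def)
      moreover have "\<alpha> ` \<Gamma> k \<in> \<S>"
        using ICE_le_trans[OF A ICE_le_trans[OF A\<Gamma> le]] \<alpha> ICE_le_refl[OF ICE_leD(2)[OF le]]
        unfolding \<S>_def by blast
      ultimately show ?thesis
        using ICE_le_trans[OF A\<Gamma> le] x(2) by blast
    qed
    show "\<exists>t. \<exists>B\<in>\<S>. single_extension H A (centralizer_in H A u) t B" if u: "u \<in> A" "u \<noteq> \<one>\<^bsub>H\<^esub>" for u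
    proof -
      define C where "C = centralizer_in H A u"
      have C: "subgroup C H" "C \<subseteq> A"
        using subgroup_centralizer_in[OF H A_sub(1) u(1)] by (simp_all add: C_def)
      define P b where "P = extend_centralizers (subgrp H A) {C}" and "b = base_class H A {C}"
      have P: "group P"
        unfolding P_def by (rule group_extend_centralizers[OF H A_sub(1)])
      have "countable (carrier P)"
        unfolding P_def using countable_subset[OF A_sub(2) count]
        by (intro countable_extend_centralizers[OF H A_sub(1)]) auto
      then obtain Q :: "nat monoid" and e where Q: "group Q" and e: "e \<in> iso P Q"
        using countable_group_on_nat[OF P] by blast
      have e_hom: "e \<in> hom P Q" and e_bij: "bij_betw e (carrier P) (carrier Q)"
        using e by (auto simp: iso_def)
      have b_hom: "b \<in> hom (subgrp H A) P"
        unfolding b_def P_def by (rule base_class_hom[OF H A_sub(1)])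
      note ab = abstract_extension[OF H A_sub(1) C, folded P_def b_def]
      define j where "j = e \<circ> b"
      have j_hom: "j \<in> hom (subgrp H A) Q"
        unfolding j_def using Group.hom_compose[OF b_hom e_hom] .
      have bP: "b ` A \<subseteq> carrier P"
        using hom_in_carrier[OF b_hom] by auto
      have j_inj: "inj_on j A"
        unfolding j_def using ab(1) e_bij bP
        by (intro comp_inj_on) (auto simp: bij_betw_def intro: inj_on_subset)
      define q where "q = e (stable_class H A {C} C)"
      have "single_extension Q (e ` b ` A) (e ` b ` C) q (e ` carrier P)"
        unfolding q_def using e_hom e_bij
        by (intro single_extension_transport[OF ab(2) Q]) (auto simp: bij_betw_def)
      then have Q_ext: "single_extension Q (j ` A) (j ` C) q (carrier Q)"
        using e_bij by (simp add: j_def image_comp bij_betw_def)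
      have jC: "j ` C = centralizer_in Q (j ` A) (j u)"
        unfolding C_def by (rule image_centralizer_in[OF j_hom j_inj A_sub(1) u(1)])
      have ju: "j u \<noteq> \<one>\<^bsub>Q\<^esub>"
      proof -
        interpret j: group_hom "subgrp H A" Q j
          using j_hom Q H.subgroup_imp_group[OF A_sub(1)] by (simp add: group_hom_def group_hom_axioms_def)
        have "j \<one>\<^bsub>H\<^esub> = \<one>\<^bsub>Q\<^esub>"
          using j.hom_one by simp
        then show ?thesis
          using inj_onD[OF j_inj, of u "\<one>\<^bsub>H\<^esub>"] u subgroup.one_closed[OF A_sub(1)] by auto
      qed
      have Q_step: "ICE_step Q (j ` A) (carrier Q)"
        using single_extension_imp_step[of Q "j ` A" "j u" q "carrier Q"] Q_ext jC ju u by simp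
      define \<kappa> where "\<kappa> = j \<circ> \<iota>"
      have G_A: "?G \<subseteq> A"
        using ICE_leD(3)[OF A] .
      have "\<kappa> \<in> mon G Q"
      proof -
        have "\<iota> \<in> hom G (subgrp H A)"
          using \<iota>(1) G_A by (auto simp: hom_def)
        then have "\<kappa> \<in> hom G Q"
          unfolding \<kappa>_def using Group.hom_compose j_hom by blast
        moreover have "inj_on \<kappa> (carrier G)"
          unfolding \<kappa>_def using \<iota>(2) j_inj G_A by (intro comp_inj_on) (auto intro: inj_on_subset)
        ultimately show ?thesis
          by (simp add: mon_def)
      qed
      moreover have "ICE_le Q (j ` ?G) (j ` A)"
        by (rule ICE_le_transport[OF A H Q j_hom j_inj])
      then have "ICE_le Q (\<kappa> ` carrier G) (carrier Q)"
        using ICE_le_trans[OF _ ICE_step_imp_le[OF Q_step]] by (simp add: \<kappa>_def image_comp)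
      ultimately have "in_ICE G \<kappa> Q"
        using Q by (simp add: in_ICE_def G_group_def)
      then obtain B\<^sub>0 g where B\<^sub>0: "ICE_le_union G \<iota> H \<Gamma> B\<^sub>0" and "g \<in> G_iso G \<kappa> Q \<iota> (subgrp H B\<^sub>0)"
        using age unfolding in_ICE_age_def G_isomorphic_def by blast
      then have g: "g \<in> iso Q (subgrp H B\<^sub>0)" and g_fix: "\<And>x. x \<in> carrier G \<Longrightarrow> g (\<kappa> x) = \<iota> x"
        by (auto simp: G_iso_def)
      obtain n where n: "ICE_le H B\<^sub>0 (\<Gamma> n)"
        using B\<^sub>0 by (auto simp: ICE_le_union_def)
      have B\<^sub>0_sub: "B\<^sub>0 \<subseteq> carrier H"
        using subgroup.subset[OF ICE_leD(1)[OF n]] .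
      have g_hom: "g \<in> hom Q H" and g_inj: "inj_on g (carrier Q)" and g_img: "g ` carrier Q = B\<^sub>0"
        using g B\<^sub>0_sub by (auto simp: iso_def hom_def bij_betw_def)
      define f where "f = g \<circ> j"
      have jQ: "j ` A \<subseteq> carrier Q"
        using hom_in_carrier[OF j_hom] by auto
      have f_hom: "f \<in> hom (subgrp H A) H" and f_inj: "inj_on f A"
        unfolding f_def using Group.hom_compose[OF j_hom g_hom] j_inj g_inj jQ
        by (auto intro!: comp_inj_on intro: inj_on_subset)
      have f_fix: "f x = x" if "x \<in> ?G" for x
        using that g_fix by (auto simp: f_def \<kappa>_def)
      define A\<^sub>0 where "A\<^sub>0 = f ` A"
      have "single_extension H (g ` j ` A) (g ` j ` C) (g q) (g ` carrier Q)"
        by (rule single_extension_transport[OF Q_ext H]) (use g_hom g_inj in simp_all)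
      then have ext\<^sub>0: "single_extension H A\<^sub>0 (f ` C) (g q) B\<^sub>0"
        by (simp add: A\<^sub>0_def f_def g_img image_comp)
      have fC: "f ` C = centralizer_in H A\<^sub>0 (f u)"
        unfolding C_def A\<^sub>0_def by (rule image_centralizer_in[OF f_hom f_inj A_sub(1) u(1)])
      have fu: "f u \<in> A\<^sub>0" "f u \<noteq> \<one>\<^bsub>H\<^esub>"
      proof -
        interpret f: group_hom "subgrp H A" H f
          using f_hom H H.subgroup_imp_group[OF A_sub(1)] by (simp add: group_hom_def group_hom_axioms_def)
        have "f \<one>\<^bsub>H\<^esub> = \<one>\<^bsub>H\<^esub>"
          using f.hom_one by simp
        then show "f u \<in> A\<^sub>0" "f u \<noteq> \<one>\<^bsub>H\<^esub>"
          using inj_onD[OF f_inj, of u "\<one>\<^bsub>H\<^esub>"] u subgroup.one_closed[OF A_sub(1)] by (auto simp: A\<^sub>0_def)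
      qed
      have "ICE_step H A\<^sub>0 B\<^sub>0"
        using single_extension_imp_step[of H A\<^sub>0 "f u" "g q" B\<^sub>0] ext\<^sub>0 fC fu by simp
      then have A\<^sub>0_le: "ICE_le H A\<^sub>0 (\<Gamma> n)"
        using ICE_le_trans[OF ICE_step_imp_le n] by blast
      have "ICE_le H (f ` ?G) A\<^sub>0"
        unfolding A\<^sub>0_def by (rule ICE_le_transport[OF A H H f_hom f_inj])
      moreover have "f ` ?G = ?G"
        using f_fix by (rule image_eq_self)
      ultimately have A\<^sub>0: "ICE_le_union G \<iota> H \<Gamma> A\<^sub>0"
        using le_unionI[OF _ A\<^sub>0_le] by simp
      define \<alpha>' where "\<alpha>' = inv_into (carrier H) \<alpha>"
      have \<alpha>'_iso: "\<alpha>' \<in> iso H H"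
        unfolding \<alpha>'_def by (rule H.iso_set_sym[OF \<alpha>_iso])
      have \<alpha>_bij: "bij_betw \<alpha> (carrier H) (carrier H)"
        using \<alpha>_iso by (simp add: iso_def)
      have \<alpha>'\<alpha>: "\<alpha>' (\<alpha> x) = x" and \<alpha>\<alpha>': "\<alpha> (\<alpha>' x) = x" if "x \<in> carrier H" for x
        using \<alpha>_bij that by (auto simp: \<alpha>'_def bij_betw_def f_inv_into_f)
      have G_H: "?G \<subseteq> carrier H"
        using G_A A_sub by blast
      have \<alpha>'_fix: "\<alpha>' x = x" if "x \<in> ?G" for x
        using \<alpha>'\<alpha>[of x] that G_H \<alpha> by (auto simp: fixes_G_def)
      have "ICE_le H (\<alpha>' ` ?G) (\<alpha>' ` A)" "ICE_le H (\<alpha>' ` A) (\<alpha>' ` \<alpha> ` \<Gamma> i)"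
        using ICE_le_automorphism[OF _ H \<alpha>'_iso] A A\<Gamma> by blast+
      moreover have "\<alpha>' ` ?G = ?G"
        using \<alpha>'_fix by (rule image_eq_self)
      moreover have "\<alpha>' ` \<alpha> ` \<Gamma> i = \<Gamma> i"
        unfolding image_image using \<alpha>'\<alpha> subgroup.subset[OF \<Gamma>_sub[of i]] by (intro image_eq_self) blast
      ultimately have A': "ICE_le_union G \<iota> H \<Gamma> (\<alpha>' ` A)"
        using le_unionI by simp
      have "f \<circ> \<alpha> \<in> G_iso G \<iota> (subgrp H (\<alpha>' ` A)) \<iota> (subgrp H A\<^sub>0)"
      proof -
        have 1: "\<alpha> \<in> iso (subgrp H (\<alpha>' ` A)) (subgrp H A)"
        proof -
          have "\<alpha> ` \<alpha>' ` A = A"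
            unfolding image_image using \<alpha>\<alpha>' A_sub(2) by (intro image_eq_self) blast
          moreover have "\<alpha>' ` A \<subseteq> carrier H"
            using \<alpha>'_iso A_sub(2) by (auto simp: iso_def hom_def)
          ultimately show ?thesis
            using \<alpha>_iso by (auto simp: iso_def bij_betw_def hom_def subset_iff intro: inj_on_subset)
        qed
        have 2: "f \<in> iso (subgrp H A) (subgrp H A\<^sub>0)"
          using f_hom f_inj by (auto simp: iso_def bij_betw_def hom_def A\<^sub>0_def)
        have "f \<circ> \<alpha> \<in> iso (subgrp H (\<alpha>' ` A)) (subgrp H A\<^sub>0)"
          by (rule iso_set_trans[OF 1 2])
        moreover have "(f \<circ> \<alpha>) (\<iota> x) = \<iota> x" if "x \<in> carrier G" for x
          using that f_fix \<alpha> by (simp add: fixes_G_def)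
        ultimately show ?thesis
          by (simp add: G_iso_def)
      qed
      then obtain \<beta> where \<beta>_iso: "\<beta> \<in> iso H H" and "\<forall>x\<in>\<alpha>' ` A. \<beta> x = (f \<circ> \<alpha>) x"
        using homogeneous[OF A' A\<^sub>0] by blast
      then have \<beta>: "\<beta> \<in> iso H H" "\<And>x. x \<in> \<alpha>' ` A \<Longrightarrow> \<beta> x = f (\<alpha> x)"
        unfolding comp_def by blast+
      define \<beta>' where "\<beta>' = inv_into (carrier H) \<beta>"
      have \<beta>'_iso: "\<beta>' \<in> iso H H"
        unfolding \<beta>'_def by (rule H.iso_set_sym[OF \<beta>(1)])
      define \<delta> where "\<delta> = \<alpha> \<circ> \<beta>'"
      have \<delta>_iso: "\<delta> \<in> iso H H"
        unfolding \<delta>_def by (rule iso_set_trans[OF \<beta>'_iso \<alpha>_iso])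
      have \<delta>f: "\<delta> (f x) = x" if x: "x \<in> A" for x
      proof -
        have xH: "x \<in> carrier H" and x': "\<alpha>' x \<in> carrier H"
          using x A_sub(2) \<alpha>'_iso by (auto simp: iso_def hom_def)
        have "\<beta> (\<alpha>' x) = f x"
          using \<beta>(2)[of "\<alpha>' x"] x \<alpha>\<alpha>'[OF xH] by simp
        moreover have "\<beta>' (\<beta> (\<alpha>' x)) = \<alpha>' x"
          using \<beta>(1) x' by (simp add: \<beta>'_def iso_def bij_betw_def)
        ultimately show ?thesis
          using \<alpha>\<alpha>'[OF xH] by (simp add: \<delta>_def)
      qed
      have \<delta>_fix: "fixes_G \<delta>"
        using \<delta>_iso \<delta>f f_fix G_A unfolding fixes_G_def by (metis subsetD)
      define B where "B = \<delta> ` B\<^sub>0"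
      have "\<delta> \<in> hom (subgrp H B\<^sub>0) H" "inj_on \<delta> B\<^sub>0"
        using \<delta>_iso B\<^sub>0_sub by (auto simp: iso_def bij_betw_def intro: hom_subgrp inj_on_subset)
      then have "single_extension H (\<delta> ` A\<^sub>0) (\<delta> ` f ` C) (\<delta> (g q)) B"
        unfolding B_def by (rule single_extension_transport[OF ext\<^sub>0 H])
      moreover have "\<delta> ` A\<^sub>0 = A" "\<delta> ` f ` C = C"
        unfolding A\<^sub>0_def image_image using \<delta>f C(2) by (blast intro!: image_eq_self)+
      ultimately have ext: "single_extension H A C (\<delta> (g q)) B"
        by simp
      then have "ICE_step H A B"
        unfolding C_def using u by (rule single_extension_imp_step)
      then have "ICE_le H ?G B"
        using ICE_le_trans[OF A ICE_step_imp_le] by blast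
      moreover have "ICE_le H B (\<delta> ` \<Gamma> n)"
        unfolding B_def by (rule ICE_le_automorphism[OF n H \<delta>_iso])
      ultimately have "B \<in> \<S>"
        using \<delta>_fix unfolding \<S>_def by blast
      then show ?thesis
        using ext unfolding C_def by blast
    qed
  qed
  then show ?thesis
    by (rule that)
qed

section \<open>CSA groups and free groups\<close>

lemma abelian_subgroup_iff:
  assumes "group G"
  shows "abelian_subgroup G M \<longleftrightarrow> subgroup M G \<and> (\<forall>x\<in>M. \<forall>y\<in>M. x \<otimes>\<^bsub>G\<^esub> y = y \<otimes>\<^bsub>G\<^esub> x)"
proof
  assume "abelian_subgroup G M"
  then have M: "subgroup M G" "comm_group (subgrp G M)"
    by (auto simp: abelian_subgroup_def)
  have "x \<otimes>\<^bsub>G\<^esub> y = y \<otimes>\<^bsub>G\<^esub> x" if "x \<in> M" "y \<in> M" for x y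
    using comm_groupE(4)[OF M(2), of x y] that by simp
  then show "subgroup M G \<and> (\<forall>x\<in>M. \<forall>y\<in>M. x \<otimes>\<^bsub>G\<^esub> y = y \<otimes>\<^bsub>G\<^esub> x)"
    using M by blast
next
  assume M: "subgroup M G \<and> (\<forall>x\<in>M. \<forall>y\<in>M. x \<otimes>\<^bsub>G\<^esub> y = y \<otimes>\<^bsub>G\<^esub> x)"
  then have "comm_group (subgrp G M)"
    using group.group_comm_groupI[OF group.subgroup_imp_group[OF assms]] by simp
  then show "abelian_subgroup G M"
    using M by (simp add: abelian_subgroup_def)
qed

text \<open>The double centralizer of a commuting set is abelian.\<close>

lemma commuting_set_in_abelian_subgroup:
  assumes G: "group G" and S: "S \<subseteq> carrier G" "\<And>x y. x \<in> S \<Longrightarrow> y \<in> S \<Longrightarrow> x \<otimes>\<^bsub>G\<^esub> y = y \<otimes>\<^bsub>G\<^esub> x"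
  obtains M where "abelian_subgroup G M" "S \<subseteq> M"
proof -
  interpret group G by fact
  define D where "D = {z \<in> carrier G. \<forall>w\<in>carrier G. (\<forall>s\<in>S. w \<otimes>\<^bsub>G\<^esub> s = s \<otimes>\<^bsub>G\<^esub> w) \<longrightarrow> z \<otimes>\<^bsub>G\<^esub> w = w \<otimes>\<^bsub>G\<^esub> z}"
  have "subgroup D G"
    by (rule subgroupI) (auto simp: D_def commute_mult commute_inv)
  moreover have SD: "S \<subseteq> D"
    using S(1) by (force simp: D_def)
  moreover have "x \<otimes>\<^bsub>G\<^esub> y = y \<otimes>\<^bsub>G\<^esub> x" if x: "x \<in> D" and y: "y \<in> D" for x y
  proof -
    have "y \<otimes>\<^bsub>G\<^esub> s = s \<otimes>\<^bsub>G\<^esub> y" if "s \<in> S" for s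
      using y S that by (auto simp: D_def)
    then show ?thesis
      using x y by (auto simp: D_def)
  qed
  ultimately show ?thesis
    using that abelian_subgroup_iff[OF G] by blast
qed

lemma abelian_subgroup_in_maximal:
  assumes G: "group G" and A: "abelian_subgroup G A"
  obtains M where "maximal_abelian_subgroup G M" "A \<subseteq> M"
proof -
  interpret group G by fact
  let ?\<A> = "{M. abelian_subgroup G M \<and> A \<subseteq> M}"
  have "\<exists>M\<in>?\<A>. \<forall>X\<in>?\<A>. M \<subseteq> X \<longrightarrow> X = M"
  proof (rule subset_Zorn_nonempty)
    show "?\<A> \<noteq> {}"
      using A by blast
    fix \<C>
    assume ne: "\<C> \<noteq> {}" and chain: "subset.chain ?\<A> \<C>"
    have C: "abelian_subgroup G M" "A \<subseteq> M" if "M \<in> \<C>" for M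
      using chain that by (auto simp: subset.chain_def)
    have C': "subgroup M G" "\<And>x y. x \<in> M \<Longrightarrow> y \<in> M \<Longrightarrow> x \<otimes>\<^bsub>G\<^esub> y = y \<otimes>\<^bsub>G\<^esub> x" if "M \<in> \<C>" for M
      using C(1)[OF that] abelian_subgroup_iff[OF G] by blast+
    have common: "\<exists>M\<in>\<C>. x \<in> M \<and> y \<in> M" if "x \<in> \<Union>\<C>" "y \<in> \<Union>\<C>" for x y
    proof -
      obtain M N where "M \<in> \<C>" "N \<in> \<C>" "x \<in> M" "y \<in> N"
        using \<open>x \<in> \<Union>\<C>\<close> \<open>y \<in> \<Union>\<C>\<close> by blast
      moreover from this have "M \<subseteq> N \<or> N \<subseteq> M"
        using chain by (auto simp: subset_chain_def)
      ultimately show ?thesis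
        by blast
    qed
    have "subgroup (\<Union>\<C>) G"
    proof (rule subgroupI)
      show "\<Union>\<C> \<subseteq> carrier G"
        using C'(1) subgroup.subset by blast
      show "\<Union>\<C> \<noteq> {}"
        using ne C'(1) subgroup.one_closed by blast
      show "inv\<^bsub>G\<^esub> x \<in> \<Union>\<C>" if "x \<in> \<Union>\<C>" for x
        using that subgroup.m_inv_closed[OF C'(1)] by blast
      show "x \<otimes>\<^bsub>G\<^esub> y \<in> \<Union>\<C>" if "x \<in> \<Union>\<C>" "y \<in> \<Union>\<C>" for x y
        using common[OF that] subgroup.m_closed[OF C'(1)] by blast
    qed
    moreover have "x \<otimes>\<^bsub>G\<^esub> y = y \<otimes>\<^bsub>G\<^esub> x" if "x \<in> \<Union>\<C>" "y \<in> \<Union>\<C>" for x y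
      using common[OF that] C'(2) by blast
    ultimately have "abelian_subgroup G (\<Union>\<C>)"
      using abelian_subgroup_iff[OF G] by blast
    moreover have "A \<subseteq> \<Union>\<C>"
      using ne C(2) by blast
    ultimately show "\<Union>\<C> \<in> ?\<A>"
      by blast
  qed
  then obtain M where M: "abelian_subgroup G M" "A \<subseteq> M" and max: "\<forall>N\<in>?\<A>. M \<subseteq> N \<longrightarrow> N = M"
    by auto
  have "N = M" if "abelian_subgroup G N" "M \<subseteq> N" for N
    using max that M(2) by (metis (mono_tags, lifting) mem_Collect_eq order_trans)
  then have "maximal_abelian_subgroup G M"
    using M(1) by (auto simp only: maximal_abelian_subgroup_def)
  then show ?thesis
    using M(2) by (rule that)
qed

lemma CSA_torsion_free_onI:
  fixes G (structure)
  assumes G: "group G" and csa: "CSA G" and tf: "torsion_free G"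
  shows "CSA_torsion_free_on G (carrier G)"
proof -
  interpret group G by fact
  have pair: "\<exists>M. abelian_subgroup G M \<and> malnormal G M \<and> x \<in> M \<and> y \<in> M"
    if xy: "x \<in> carrier G" "y \<in> carrier G" "x \<otimes> y = y \<otimes> x" for x y
  proof -
    obtain A where A: "abelian_subgroup G A" "{x, y} \<subseteq> A"
      by (rule commuting_set_in_abelian_subgroup[OF G, of "{x, y}"]) (use xy in auto)
    obtain M where "maximal_abelian_subgroup G M" "A \<subseteq> M"
      using abelian_subgroup_in_maximal[OF G A(1)] .
    then have "abelian_subgroup G M \<and> malnormal G M \<and> x \<in> M \<and> y \<in> M"
      using A(2) csa by (simp add: CSA_def maximal_abelian_subgroup_def subset_iff)
    then show ?thesis ..
  qed
  have mal: "g \<in> M"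
    if "malnormal G M" "g \<in> carrier G" "z \<in> M" "z \<noteq> \<one>" "m \<in> M" "z = inv g \<otimes> m \<otimes> g" for M g z m
  proof (rule ccontr)
    assume "g \<notin> M"
    then have "M \<inter> conj_set G M g = {\<one>}"
      using that by (auto simp: malnormal_def)
    moreover have "z \<in> conj_set G M g"
      unfolding conj_set_def using that(5,6) by blast
    ultimately show False
      using that(3,4) by blast
  qed
  have "commutation_transitive_on G (carrier G)"
    unfolding commutation_transitive_on_def
  proof (intro ballI impI)
    fix x y z
    assume G: "x \<in> carrier G" "y \<in> carrier G" "z \<in> carrier G" and x: "x \<noteq> \<one>" "x \<otimes> y = y \<otimes> x" "x \<otimes> z = z \<otimes> x"
    obtain M where M: "abelian_subgroup G M" "malnormal G M" "x \<in> M" "y \<in> M"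
      using pair[OF G(1,2) x(2)] by blast
    have "x = inv z \<otimes> x \<otimes> z"
      using G by (simp add: m_assoc x(3))
    then have "z \<in> M"
      using mal[OF M(2) G(3) M(3) x(1) M(3)] by blast
    then show "y \<otimes> z = z \<otimes> y"
      using M abelian_subgroup_iff[OF is_group] by blast
  qed
  moreover have "conjugately_separated_on G (carrier G)"
    unfolding conjugately_separated_on_def
  proof (intro ballI impI)
    fix x y
    assume G: "x \<in> carrier G" "y \<in> carrier G" and x: "x \<noteq> \<one>"
      and comm: "x \<otimes> (inv y \<otimes> x \<otimes> y) = (inv y \<otimes> x \<otimes> y) \<otimes> x"
    have z: "inv y \<otimes> x \<otimes> y \<in> carrier G"
      using G by simp
    obtain M where M: "abelian_subgroup G M" "malnormal G M" "x \<in> M" "inv y \<otimes> x \<otimes> y \<in> M"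
      using pair[OF G(1) z comm] by blast
    have "inv y \<otimes> x \<otimes> y \<noteq> \<one>"
      using conj_eq_iff[of "inv y" x \<one>] G x by auto
    then have "y \<in> M"
      using mal[OF M(2) G(2) M(4) _ M(3)] by blast
    then show "x \<otimes> y = y \<otimes> x"
      using M abelian_subgroup_iff[OF is_group] by blast
  qed
  ultimately show ?thesis
    using tf by (simp add: CSA_torsion_free_on_def torsion_free_on_def torsion_free_def)
qed

lemma CSA_torsion_free_on_image:
  assumes h: "group_hom G M h" "inj_on h (carrier G)" and csa: "CSA_torsion_free_on G (carrier G)"
  shows "CSA_torsion_free_on M (h ` carrier G)"
proof -
  interpret group_hom G M h by (rule h(1))
  have eq_iff: "h x = h y \<longleftrightarrow> x = y" if "x \<in> carrier G" "y \<in> carrier G" for x y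
    using inj_on_eq_iff[OF h(2) that] .
  have eq_one: "h x = \<one>\<^bsub>M\<^esub> \<longleftrightarrow> x = \<one>\<^bsub>G\<^esub>" if "x \<in> carrier G" for x
    using eq_iff[OF that G.one_closed] by simp
  have pow: "h x [^]\<^bsub>M\<^esub> n = h (x [^]\<^bsub>G\<^esub> n)" if "x \<in> carrier G" for x and n :: nat
    using hom_nat_pow[OF that] by simp
  have comm: "h x \<otimes>\<^bsub>M\<^esub> h y = h y \<otimes>\<^bsub>M\<^esub> h x \<longleftrightarrow> x \<otimes>\<^bsub>G\<^esub> y = y \<otimes>\<^bsub>G\<^esub> x"
    if "x \<in> carrier G" "y \<in> carrier G" for x y
    using eq_iff[of "x \<otimes>\<^bsub>G\<^esub> y" "y \<otimes>\<^bsub>G\<^esub> x"] that by simp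
  have "commutation_transitive_on M (h ` carrier G)"
    unfolding commutation_transitive_on_def
  proof (intro ballI impI)
    fix u v w
    assume uvw: "u \<in> h ` carrier G" "v \<in> h ` carrier G" "w \<in> h ` carrier G"
      and u: "u \<noteq> \<one>\<^bsub>M\<^esub>" "u \<otimes>\<^bsub>M\<^esub> v = v \<otimes>\<^bsub>M\<^esub> u" "u \<otimes>\<^bsub>M\<^esub> w = w \<otimes>\<^bsub>M\<^esub> u"
    obtain x y z where x: "x \<in> carrier G" "u = h x" and y: "y \<in> carrier G" "v = h y" and z: "z \<in> carrier G" "w = h z"
      using uvw by blast
    have "x \<noteq> \<one>\<^bsub>G\<^esub>" "x \<otimes>\<^bsub>G\<^esub> y = y \<otimes>\<^bsub>G\<^esub> x" "x \<otimes>\<^bsub>G\<^esub> z = z \<otimes>\<^bsub>G\<^esub> x"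
      using u eq_one[OF x(1)] comm[OF x(1) y(1)] comm[OF x(1) z(1)] unfolding x(2) y(2) z(2) by blast+
    then have "y \<otimes>\<^bsub>G\<^esub> z = z \<otimes>\<^bsub>G\<^esub> y"
      using csa x(1) y(1) z(1) unfolding CSA_torsion_free_on_def commutation_transitive_on_def by blast
    then show "v \<otimes>\<^bsub>M\<^esub> w = w \<otimes>\<^bsub>M\<^esub> v"
      unfolding y(2) z(2) using comm[OF y(1) z(1)] by blast
  qed
  moreover have "conjugately_separated_on M (h ` carrier G)"
    unfolding conjugately_separated_on_def
  proof (intro ballI impI)
    fix u v
    assume uv: "u \<in> h ` carrier G" "v \<in> h ` carrier G" and u: "u \<noteq> \<one>\<^bsub>M\<^esub>"
      "u \<otimes>\<^bsub>M\<^esub> (inv\<^bsub>M\<^esub> v \<otimes>\<^bsub>M\<^esub> u \<otimes>\<^bsub>M\<^esub> v) = (inv\<^bsub>M\<^esub> v \<otimes>\<^bsub>M\<^esub> u \<otimes>\<^bsub>M\<^esub> v) \<otimes>\<^bsub>M\<^esub> u"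
    obtain x y where x: "x \<in> carrier G" "u = h x" and y: "y \<in> carrier G" "v = h y"
      using uv by blast
    define z where "z = inv\<^bsub>G\<^esub> y \<otimes>\<^bsub>G\<^esub> x \<otimes>\<^bsub>G\<^esub> y"
    have z: "z \<in> carrier G" "inv\<^bsub>M\<^esub> v \<otimes>\<^bsub>M\<^esub> u \<otimes>\<^bsub>M\<^esub> v = h z"
      using x y by (simp_all add: z_def)
    have "x \<noteq> \<one>\<^bsub>G\<^esub>" "x \<otimes>\<^bsub>G\<^esub> z = z \<otimes>\<^bsub>G\<^esub> x"
      using u(1) u(2)[unfolded z(2)] eq_one[OF x(1)] comm[OF x(1) z(1)] unfolding x(2) by blast+
    then have "x \<otimes>\<^bsub>G\<^esub> y = y \<otimes>\<^bsub>G\<^esub> x"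
      using csa x(1) y(1) unfolding z_def CSA_torsion_free_on_def conjugately_separated_on_def by blast
    then show "u \<otimes>\<^bsub>M\<^esub> v = v \<otimes>\<^bsub>M\<^esub> u"
      unfolding x(2) y(2) using comm[OF x(1) y(1)] by blast
  qed
  moreover have "torsion_free_on M (h ` carrier G)"
    using csa by (auto simp: CSA_torsion_free_on_def torsion_free_on_def pow eq_one)
  ultimately show ?thesis
    by (simp add: CSA_torsion_free_on_def)
qed

lemma CSA_torsion_free_on_free_group:
  fixes F :: "'a monoid"
  assumes "free_group F"
  shows "CSA_torsion_free_on F (carrier F)"
proof -
  obtain X \<psi> where F: "group F" "X \<subseteq> carrier F"
    and \<psi>: "\<psi> \<in> iso (rel_presentation (subgrp F {\<one>\<^bsub>F\<^esub>}) X {}) F"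
      "\<And>x. x \<in> X \<Longrightarrow> \<psi> (rel_class (subgrp F {\<one>\<^bsub>F\<^esub>}) X {} [Stable x]) = x"
    using assms by (auto simp: free_group_def free_group_on_def)
  interpret group F by (rule F(1))
  have triv: "subgroup {\<one>\<^bsub>F\<^esub>} F"
    by (rule triv_subgroup)
  interpret P: relative_presentation "subgrp F {\<one>\<^bsub>F\<^esub>}" X "{}"
    by (rule relative_presentation_subgrp[OF F(1) triv])
  have "P.cls [Base \<one>\<^bsub>F\<^esub>] = P.cls []"
    using P.cls_eqI[OF rel_congruence.base_one[of "subgrp F {\<one>\<^bsub>F\<^esub>}" X "{}"]] by simp
  moreover have "\<psi> \<one>\<^bsub>P.P\<^esub> = \<one>\<^bsub>F\<^esub>"
    using \<psi>(1) hom_one[of \<psi> P.P F] P.group_P F(1) by (simp add: iso_def)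
  ultimately have base: "\<psi> (P.cls [Base \<one>\<^bsub>F\<^esub>]) = \<one>\<^bsub>F\<^esub>"
    by (simp add: P.one_P)
  interpret E: relative_extension F "{\<one>\<^bsub>F\<^esub>}" "carrier F" X "{}" "\<lambda>_. {\<one>\<^bsub>F\<^esub>}" \<psi> "\<lambda>x. x"
    using F triv \<psi> base subgroup_self by (intro relative_extension.intro relative_extension_axioms.intro) auto
  interpret E: tame_extension F "{\<one>\<^bsub>F\<^esub>}" E.letters
    by unfold_locales
      (auto simp: CSA_torsion_free_on_def commutation_transitive_on_def conjugately_separated_on_def torsion_free_on_def)
  show ?thesis
    using E.CSA_torsion_free_span E.span_eq by simp
qed

section \<open>The limit is Lyndon's completion\<close>

lemma limit_isomorphic_completion:
  fixes G :: "'a monoid" and H :: "'h monoid" and L :: "'l monoid"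
  assumes G: "group G" "countable (carrier G)" and limit: "ICE_homogeneous_limit G \<iota> H"
    and lyndon: "Lyndon_completion G \<kappa> L" and csa: "CSA_torsion_free_on G (carrier G)"
  shows "G_isomorphic G \<iota> H \<kappa> L"
proof -
  have \<iota>: "group H" "\<iota> \<in> hom G H" "inj_on \<iota> (carrier G)"
    using limit by (auto simp: ICE_homogeneous_limit_def union_of_ICE_chain_def G_group_def mon_def)
  have \<kappa>: "group L" "\<kappa> \<in> hom G L" "inj_on \<kappa> (carrier G)"
    using lyndon by (auto simp: Lyndon_completion_def G_group_def mon_def)
  obtain \<S> where H: "rich H (\<iota> ` carrier G) \<S>"
    using ICE_homogeneous_limit_rich[OF G(1) limit] .
  have "CSA_torsion_free_on L (\<kappa> ` carrier G)"
    using CSA_torsion_free_on_image[of G L \<kappa>] \<kappa> G csa by (simp add: group_hom_def group_hom_axioms_def)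
  then obtain \<T> where L: "rich L (\<kappa> ` carrier G) \<T>" and "countable (carrier G) \<Longrightarrow> countable (carrier L)"
    using Lyndon_completion_rich[OF lyndon] by blast
  then have count: "countable (carrier L)" "countable (carrier H)"
    using G(2) limit by (auto simp: ICE_homogeneous_limit_def)
  have \<iota>_iso: "\<iota> \<in> iso G (subgrp H (\<iota> ` carrier G))" and \<kappa>_iso: "\<kappa> \<in> iso G (subgrp L (\<kappa> ` carrier G))"
    using \<iota> \<kappa> by (auto simp: iso_def hom_def bij_betw_def)
  have "\<kappa> \<circ> inv_into (carrier G) \<iota> \<in> iso (subgrp H (\<iota> ` carrier G)) (subgrp L (\<kappa> ` carrier G))"
    by (rule iso_set_trans[OF group.iso_set_sym[OF G(1) \<iota>_iso] \<kappa>_iso])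
  then obtain F where F: "F \<in> iso H L" "\<forall>x\<in>\<iota> ` carrier G. F x = (\<kappa> \<circ> inv_into (carrier G) \<iota>) x"
    using rich_isomorphic[OF H L _ count(2,1)] by blast
  have "F (\<iota> g) = \<kappa> g" if "g \<in> carrier G" for g
    using F(2) that inv_into_f_f[OF \<iota>(3) that] by simp
  then show ?thesis
    using F(1) by (auto simp: G_isomorphic_def G_iso_def)
qed

theorem theorem4p4:
  fixes G :: "'a monoid" and H :: "'h monoid" and \<iota> :: "'a \<Rightarrow> 'h"
    and L :: "'l monoid" and \<kappa> :: "'a \<Rightarrow> 'l"
  assumes "group G" and "countable (carrier G)" and "\<not> comm_group G"
    and "ICE_homogeneous_limit G \<iota> H"
    and "Lyndon_completion G \<kappa> L"
  shows "(torsion_free G \<and> CSA G \<longrightarrow> G_isomorphic G \<iota> H \<kappa> L)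
       \<and> (free_group G \<longrightarrow> G_isomorphic G \<iota> H \<kappa> L)"
  using limit_isomorphic_completion[OF assms(1,2,4,5)] CSA_torsion_free_onI[OF assms(1)]
    CSA_torsion_free_on_free_group by blast

end
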